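(* Let $d\geq 2$ and let $\Omega$ be a set of equiangular lines in $\mathbb{R}^d$ such that $|\Omega|=\frac{d(d+1)}{2}$ (i.e. $\Omega$ saturates the absolute bound) and $\operatorname{Inc}(\Omega)=d$ (i.e. $\Omega$ saturates the incoherence bound). Then $d=2,3,7$ or $23$, and $\Omega$ is isometric to the standard set of lines $\Omega_d$ described in the context.
   Context: Lines are lines through the origin of $\mathbb{R}^d$. A set of lines is equiangular if there is $\kappa$ with $0\le\kappa<1$ such that, choosing a unit vector spanning each line, the inner product of any two unit vectors spanning distinct lines is $\pm\kappa$. A line is identified with a unit vector $\alpha$ spanning it; $(\cdot,\cdot)$ is the standard Euclidean inner product. It is known that a set of equiangular lines in $\mathbb{R}^d$ has at most $d(d+1)/2$ elements (the absolute bound). A set $\Gamma$ of equiangular lines is incoherent if $|\Gamma|\leq 2$ or $(\alpha_1,\alpha_2)(\alpha_1,\alpha_3)(\alpha_2,\alpha_3)>0$ for every $3$-subset $\{\alpha_1,\alpha_2,\alpha_3\}$ of $\Gamma$ (this does not depend on the choice of unit vectors). $\operatorname{Inc}(\Omega)$ is the maximum size of an incoherent subset of $\Omega$; it is known that $\operatorname{Inc}(\Omega)\leq d$ (the incoherence bound). Two sets of lines are isometric if an orthogonal transformation maps one onto the other. A quasi-symmetric $t$-$(d,k,\lambda;s_1,s_2)$ design is a pair $(\mathcal{P},\mathcal{B})$, $|\mathcal P|=d$, $\mathcal B$ a set of $k$-subsets of $\mathcal P$ (blocks), such that every $t$-subset of $\mathcal P$ lies in exactly $\lambda$ blocks and the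 set of intersection sizes of distinct blocks is exactly $\{s_1,s_2\}$. Standard sets $\Omega_d$: $\Omega_2$ is the set of $3$ lines through opposite vertices of a regular hexagon in $\mathbb{R}^2$ centred at the origin; $\Omega_3$ is the set of $6$ lines through opposite vertices of a regular icosahedron in $\mathbb{R}^3$ centred at the origin. For $d=7$ let $(\mathcal{P},\mathcal{B})$ be the $2$-$(7,2,1;1,0)$ design of all $2$-subsets of $\mathcal P=\{1,\dots,7\}$; for $d=23$ let $(\mathcal{P},\mathcal{B})$ be the (unique up to isomorphism) Steiner system $S(4,7,23)$ on $\mathcal P=\{1,\dots,23\}$, which is a quasi-symmetric $4$-$(23,7,1;3,1)$ design. With $k$ the block size and $s_1>s_2$ the intersection numbers, put $\Delta_1=k^2-\frac{d(s_1+s_2)}{2}$ and $\Delta_2=(k-s_1)+\frac{d(s_1-s_2)}{2}$. For $B\in\mathcal{B}$ let $v(B)\in\mathbb{R}^d$ have $j$th entry $d-k+\sqrt{\Delta_1}$ if $j\in B$ and $-k+\sqrt{\Delta_1}$ if $j\notin B$. For $i\in\mathcal{P}$ let $v(i)\in\mathbb{R}^d$ have $j$th entry $(s_1-s_2)(d-1)-\sqrt{\Delta_2}$ if $j=i$ and $-(s_1-s_2)-\sqrt{\Delta_2}$ if $j\ne i$. Then $\Omega_d$ is the set of lines spanned by the vectors $v(B)$ ($B\in\mathcal{B}$) and $v(i)$ ($i\in\mathcal{P}$); it has $28$ lines for $d=7$ and $276$ lines for $d=23$. *)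

theory Defs
  imports "HOL-Analysis.Analysis"
begin

text \<open>Lines through the origin are one-dimensional subspaces. A line contains exactly two unit
  vectors, which differ by sign; the conditions below are insensitive to that sign, so they are
  imposed for all unit vectors spanning the lines involved.\<close>

definition is_line :: "'a::euclidean_space set \<Rightarrow> bool" where
  "is_line L \<longleftrightarrow> subspace L \<and> dim L = 1"

definition equiangular :: "'a::euclidean_space set set \<Rightarrow> bool" where
  "equiangular \<Omega> \<longleftrightarrow> (\<forall>L\<in>\<Omega>. is_line L) \<and>
    (\<exists>\<kappa>. 0 \<le> \<kappa> \<and> \<kappa> < 1 \<and>
      (\<forall>L\<in>\<Omega>. \<forall>M\<in>\<Omega>. L \<noteq> M \<longrightarrow>
        (\<forall>a\<in>L. \<forall>b\<in>M. norm a = 1 \<longrightarrow> norm b = 1 \<longrightarrow> a \<bullet> b = \<kappa> \<or> a \<bullet> b = - \<kappa>)))"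

definition incoherent :: "'a::euclidean_space set set \<Rightarrow> bool" where
  "incoherent \<Gamma> \<longleftrightarrow> equiangular \<Gamma> \<and>
    (finite \<Gamma> \<and> card \<Gamma> \<le> 2 \<or>
     (\<forall>L\<^sub>1\<in>\<Gamma>. \<forall>L\<^sub>2\<in>\<Gamma>. \<forall>L\<^sub>3\<in>\<Gamma>. L\<^sub>1 \<noteq> L\<^sub>2 \<longrightarrow> L\<^sub>1 \<noteq> L\<^sub>3 \<longrightarrow> L\<^sub>2 \<noteq> L\<^sub>3 \<longrightarrow>
       (\<forall>a\<^sub>1\<in>L\<^sub>1. \<forall>a\<^sub>2\<in>L\<^sub>2. \<forall>a\<^sub>3\<in>L\<^sub>3. norm a\<^sub>1 = 1 \<longrightarrow> norm a\<^sub>2 = 1 \<longrightarrow> norm a\<^sub>3 = 1 \<longrightarrow>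
         (a\<^sub>1 \<bullet> a\<^sub>2) * (a\<^sub>1 \<bullet> a\<^sub>3) * (a\<^sub>2 \<bullet> a\<^sub>3) > 0)))"

text \<open>For a finite set of lines this is the maximum of a finite nonempty set.\<close>

definition Inc :: "'a::euclidean_space set set \<Rightarrow> nat" where
  "Inc \<Omega> = Max {card \<Gamma> | \<Gamma>. \<Gamma> \<subseteq> \<Omega> \<and> incoherent \<Gamma>}"

text \<open>The two sets of lines may live in different copies of Euclidean space (for example
  \<open>real^'n\<close> with \<open>CARD('n) = 7\<close>, and \<open>real^7\<close>). When the two types coincide, the maps
  \<open>f\<close> are the orthogonal transformations; in general their existence forces equal dimensions.\<close>

definition isometric_lines ::
  "'a::euclidean_space set set \<Rightarrow> 'b::euclidean_space set set \<Rightarrow> bool" where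
  "isometric_lines \<Omega> \<Omega>' \<longleftrightarrow>
    (\<exists>f. linear f \<and> bij f \<and> (\<forall>x y. f x \<bullet> f y = x \<bullet> y) \<and> (\<lambda>L. f ` L) ` \<Omega> = \<Omega>')"

definition hexagon_vertices :: "(real^2) set" where
  "hexagon_vertices = {vector [cos (real j * pi / 3), sin (real j * pi / 3)] | j. j < 6}"

definition golden_ratio :: real where
  "golden_ratio = (1 + sqrt 5) / 2"

definition icosahedron_vertices :: "(real^3) set" where
  "icosahedron_vertices =
    (\<Union>s\<in>{-1, 1}. \<Union>t\<in>{- golden_ratio, golden_ratio}.
      {vector [0, s, t], vector [s, t, 0], vector [t, 0, s]})"

text \<open>Both vertex sets are symmetric about the origin, so the line through \<open>v\<close> and the
  opposite vertex \<open>- v\<close> is \<open>span {v}\<close>.\<close>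

definition Omega_2 :: "(real^2) set set" where
  "Omega_2 = (\<lambda>v. span {v}) ` hexagon_vertices"

definition Omega_3 :: "(real^3) set set" where
  "Omega_3 = (\<lambda>v. span {v}) ` icosahedron_vertices"

definition quasi_symmetric_design ::
  "nat \<Rightarrow> nat \<Rightarrow> nat \<Rightarrow> nat \<Rightarrow> nat \<Rightarrow> nat \<Rightarrow> 'p set \<Rightarrow> 'p set set \<Rightarrow> bool" where
  "quasi_symmetric_design t d k l s\<^sub>1 s\<^sub>2 P \<B> \<longleftrightarrow>
    finite P \<and> card P = d \<and>
    (\<forall>B\<in>\<B>. B \<subseteq> P \<and> card B = k) \<and>
    (\<forall>T. T \<subseteq> P \<and> card T = t \<longrightarrow> card {B\<in>\<B>. T \<subseteq> B} = l) \<and>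
    {card (B \<inter> C) | B C. B \<in> \<B> \<and> C \<in> \<B> \<and> B \<noteq> C} = {s\<^sub>1, s\<^sub>2}"

definition Delta_1 :: "nat \<Rightarrow> nat \<Rightarrow> nat \<Rightarrow> nat \<Rightarrow> real" where
  "Delta_1 d k s\<^sub>1 s\<^sub>2 = (real k)\<^sup>2 - real d * (real s\<^sub>1 + real s\<^sub>2) / 2"

definition Delta_2 :: "nat \<Rightarrow> nat \<Rightarrow> nat \<Rightarrow> nat \<Rightarrow> real" where
  "Delta_2 d k s\<^sub>1 s\<^sub>2 = (real k - real s\<^sub>1) + real d * (real s\<^sub>1 - real s\<^sub>2) / 2"

text \<open>The point set of the design is the index type \<open>'n\<close>.\<close>

definition block_vec :: "nat \<Rightarrow> nat \<Rightarrow> nat \<Rightarrow> 'n::finite set \<Rightarrow> real^'n" where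
  "block_vec k s\<^sub>1 s\<^sub>2 B =
    (\<chi> j. if j \<in> B then real CARD('n) - real k + sqrt (Delta_1 CARD('n) k s\<^sub>1 s\<^sub>2)
          else - real k + sqrt (Delta_1 CARD('n) k s\<^sub>1 s\<^sub>2))"

definition point_vec :: "nat \<Rightarrow> nat \<Rightarrow> nat \<Rightarrow> 'n::finite \<Rightarrow> real^'n" where
  "point_vec k s\<^sub>1 s\<^sub>2 i =
    (\<chi> j. if j = i
          then (real s\<^sub>1 - real s\<^sub>2) * (real CARD('n) - 1) - sqrt (Delta_2 CARD('n) k s\<^sub>1 s\<^sub>2)
          else - (real s\<^sub>1 - real s\<^sub>2) - sqrt (Delta_2 CARD('n) k s\<^sub>1 s\<^sub>2))"

definition design_lines ::
  "nat \<Rightarrow> nat \<Rightarrow> nat \<Rightarrow> 'n::finite set set \<Rightarrow> (real^'n) set set" where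
  "design_lines k s\<^sub>1 s\<^sub>2 \<B> =
    (\<lambda>B. span {block_vec k s\<^sub>1 s\<^sub>2 B}) ` \<B> \<union> range (\<lambda>i. span {point_vec k s\<^sub>1 s\<^sub>2 i})"

definition Omega_7 :: "(real^7) set set" where
  "Omega_7 = design_lines 2 1 0 {B. card B = 2}"

text \<open>The Steiner system \<open>S(4,7,23)\<close> exists and is unique up to isomorphism, and its block
  intersection numbers are 3 and 1. Hence choosing one is harmless: another choice permutes the
  coordinates of \<open>Omega_23\<close>.\<close>

definition steiner_4_7_23 :: "23 set set" where
  "steiner_4_7_23 = (SOME \<B>. quasi_symmetric_design 4 23 7 1 3 1 UNIV \<B>)"

definition Omega_23 :: "(real^23) set set" where
  "Omega_23 = design_lines 7 3 1 steiner_4_7_23"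

end

theory Submission
  imports Defs
begin

text \<open>Let \<open>\<kappa>\<close> be the common angle and \<open>d\<close> the dimension. The projections onto the \<open>d(d+1)/2\<close> lines
  are linearly independent, hence a basis of the symmetric matrices. Expanding matrices in this basis
  gives \<open>\<kappa>\<^sup>2 = 1/(d+2)\<close> and the second and fourth moments of the unit vectors.

  An incoherent subset of size \<open>d\<close> provides a basis \<open>\<alpha>\<close> with all inner products \<open>\<kappa>\<close>. Each other
  line is then a sign pattern \<open>\<epsilon>\<close> with \<open>(\<beta>, \<alpha> i) = \<kappa> \<epsilon> i\<close>. With \<open>q = 1/\<kappa>\<close>, normalisation forces
  the sum \<open>m\<close> of the signs to satisfy \<open>m\<^sup>2 = (q-2)(q\<^sup>2+q-3)\<close>, so \<open>d \<le> 3\<close> or \<open>q\<close> is an integer. For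
  \<open>d \<ge> 4\<close> the fourth moment yields \<open>2ms = (q\<^sup>2+q-3)(q\<^sup>2-6q+7)\<close> with an integral third moment \<open>s\<close> of
  the signs, so \<open>q-2\<close> divides \<open>m\<close> and then \<open>3\<close>, that is \<open>q = 3\<close> or \<open>q = 5\<close>.

  The Gram matrix of the basis and the sign patterns determine the lines up to isometry. For
  \<open>d = 2, 3, 7\<close> every pattern with the right number of positive signs occurs. For \<open>d = 23\<close> the
  supports of the positive signs are 253 blocks of size 7 meeting in 1 or 3 points, hence an \<open>S(4,7,23)\<close>.
  In such a system a set of at most 7 points meeting all blocks oddly is a block. This allows us to
  coordinatise the complement of a block by the affine space \<open>F\<^sub>2\<^sup>4\<close>, whose planes carry triples of
  points of the block, so that 12 blocks are known up to relabelling; the sums of an odd number of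
  these that have weight 7 are all 253 blocks.\<close>

section \<open>Moments of equiangular lines meeting the absolute bound\<close>

text \<open>The symmetrised rank-one matrix; for a unit vector \<open>v\<close>,
  \<open>outer v v\<close> is the projection onto its line. Two arguments make the moment identities
  available in polarised form.\<close>

definition outer :: "real^'n \<Rightarrow> real^'n \<Rightarrow> real^'n^'n" where
  "outer x y = (\<chi> i j. (x$i * y$j + x$j * y$i) / 2)"

definition symmetric_matrices :: "(real^'n^'n) set" where
  "symmetric_matrices = {A. \<forall>i j. A$i$j = A$j$i}"

lemma outer_inner_outer:
  "outer x y \<bullet> outer z w = ((x \<bullet> z) * (y \<bullet> w) + (x \<bullet> w) * (y \<bullet> z)) / 2"
proof -
  have e1: "(\<Sum>i\<in>UNIV. \<Sum>j\<in>UNIV. a$i * b$j * (c$i * e$j)) = (a \<bullet> c) * (b \<bullet> e)"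
    for a b c e :: "real^'n"
    unfolding inner_vec_def sum_product by (intro sum.cong) simp_all
  have e2: "(\<Sum>i\<in>UNIV. \<Sum>j\<in>UNIV. a$j * b$i * (c$j * e$i)) = (a \<bullet> c) * (b \<bullet> e)"
    for a b c e :: "real^'n"
    by (subst e1[symmetric], subst sum.swap) (rule refl)
  have e3: "(\<Sum>i\<in>UNIV. \<Sum>j\<in>UNIV. a$i * b$j * (c$j * e$i)) = (a \<bullet> e) * (b \<bullet> c)"
    "(\<Sum>i\<in>UNIV. \<Sum>j\<in>UNIV. a$j * b$i * (c$i * e$j)) = (a \<bullet> e) * (b \<bullet> c)"
    for a b c e :: "real^'n"
    using e1[of a b e c] e2[of a b e c] by (simp_all add: mult.commute)
  have "outer x y \<bullet> outer z w = (\<Sum>i\<in>UNIV. \<Sum>j\<in>UNIV.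
      (x$i * y$j * (z$i * w$j) + x$j * y$i * (z$j * w$i) + x$i * y$j * (z$j * w$i) + x$j * y$i * (z$i * w$j)) / 4)"
    unfolding outer_def inner_vec_def by (simp add: field_simps)
  also have "\<dots> = ((x \<bullet> z) * (y \<bullet> w) + (x \<bullet> w) * (y \<bullet> z)) / 2"
    unfolding sum_divide_distrib[symmetric] sum.distrib e1 e2 e3 by (simp add: field_simps)
  finally show ?thesis .
qed

lemma mat_1_inner_outer: "mat 1 \<bullet> outer x y = x \<bullet> y"
proof -
  have "mat 1 \<bullet> outer x y = (\<Sum>i\<in>UNIV. \<Sum>j\<in>UNIV. if i = j then x$i * y$i else 0)"
    unfolding outer_def mat_def inner_vec_def by (intro sum.cong) auto
  then show ?thesis by (simp add: inner_vec_def)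
qed

lemma outer_inner_mat_1: "outer x y \<bullet> mat 1 = x \<bullet> y"
  by (metis inner_commute mat_1_inner_outer)

lemma mat_1_inner_mat_1: "mat 1 \<bullet> (mat 1 :: real^'n^'n) = real CARD('n)"
  unfolding mat_def inner_vec_def
  by (simp add: if_distrib[of "\<lambda>c. c * _"] sum.delta cong: if_cong)

lemma outer_symmetric: "outer x y \<in> symmetric_matrices"
  by (simp add: symmetric_matrices_def outer_def algebra_simps)

lemma mat_1_symmetric: "mat 1 \<in> symmetric_matrices"
  by (auto simp: symmetric_matrices_def mat_def)

text \<open>A set of one or two indices names a diagonal entry or a mirror pair of off-diagonal
  entries, and the matrices with ones exactly there span.\<close>

lemma dim_symmetric_matrices_le:
  "dim (symmetric_matrices :: (real^'n^'n) set) \<le> CARD('n) * (CARD('n) + 1) div 2"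
proof -
  define P :: "'n set set" where "P = {X. card X = 1} \<union> {X. card X = 2}"
  define E :: "'n set \<Rightarrow> real^'n^'n" where "E X = (\<chi> i j. if X = {i, j} then 1 else 0)" for X
  have "card P = card {X::'n set. card X = 1} + card {X::'n set. card X = 2}"
    unfolding P_def by (rule card_Un_disjoint) auto
  also have "\<dots> = CARD('n) + (CARD('n) choose 2)"
    by (simp add: n_subsets[of "UNIV::'n set", simplified])
  also have "\<dots> = CARD('n) * (CARD('n) + 1) div 2"
  proof -
    have "CARD('n) * (CARD('n) + 1) = CARD('n) * (CARD('n) - 1) + 2 * CARD('n)"
      by (cases "CARD('n)") (simp_all add: algebra_simps)
    then show ?thesis by (simp add: choose_two)
  qed
  finally have cP: "card P = CARD('n) * (CARD('n) + 1) div 2" .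
  have "A \<in> span (E ` P)" if "A \<in> symmetric_matrices" for A
  proof -
    have fin: "finite P" by simp
    define c where "c X = (THE t. \<forall>i j. X = {i, j} \<longrightarrow> A$i$j = t)" for X
    have c: "c {i, j} = A$i$j" for i j
      unfolding c_def using that
      by (intro the_equality) (auto simp: symmetric_matrices_def doubleton_eq_iff)
    have "A$i$j = (\<Sum>X\<in>P. c X *\<^sub>R E X)$i$j" for i j
    proof -
      have "{i, j} \<in> P" unfolding P_def by (cases "i = j") auto
      have "(\<Sum>X\<in>P. c X *\<^sub>R E X)$i$j = (\<Sum>X\<in>P. if X = {i, j} then c X else 0)"
        by (simp add: E_def if_distrib cong: if_cong)
      also have "\<dots> = A$i$j" using \<open>{i, j} \<in> P\<close> by (simp add: sum.delta fin c)
      finally show ?thesis by simp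
    qed
    then have "A = (\<Sum>X\<in>P. c X *\<^sub>R E X)" by (simp add: vec_eq_iff)
    then show ?thesis by (metis (no_types, lifting) imageI span_base span_scale span_sum)
  qed
  then have "dim (symmetric_matrices :: (real^'n^'n) set) \<le> card (E ` P)"
    by (intro dim_le_card) auto
  also have "\<dots> \<le> card P" by (rule card_image_le) simp
  finally show ?thesis using cP by simp
qed

text \<open>One unit vector represents each line. The squared angle condition ignores signs, so the
  same setting applies before and after the signs are normalised.\<close>

locale tight_equiangular =
  fixes V :: "(real^'n) set" and \<kappa> :: real
  assumes card_V: "card V = CARD('n) * (CARD('n) + 1) div 2"
    and dim_ge_2: "CARD('n) \<ge> 2"
    and unit: "v \<in> V \<Longrightarrow> v \<bullet> v = 1"
    and angle: "v \<in> V \<Longrightarrow> w \<in> V \<Longrightarrow> v \<noteq> w \<Longrightarrow> (v \<bullet> w)\<^sup>2 = \<kappa>\<^sup>2"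
    and kappa: "0 \<le> \<kappa>" "\<kappa> < 1"
begin

lemma finite_V: "finite V"
proof (rule ccontr)
  assume "infinite V"
  then have "CARD('n) * (CARD('n) + 1) div 2 = 0" using card_V by simp
  moreover have "2 \<le> CARD('n) * (CARD('n) + 1)" using dim_ge_2
    using mult_le_mono[of 2 "CARD('n)" 1 "CARD('n) + 1"] by simp
  ultimately show False by linarith
qed

lemma kappa_sq: "\<kappa>\<^sup>2 < 1"
  using kappa by (simp add: power_less_one_iff abs_square_less_1)

text \<open>The Gram matrix of the projections is (1 - \<kappa>^2) I + \<kappa>^2 J. The part from
  the all-ones matrix J is the sum of the coefficients, which is the trace of the combination
  because every projection has trace one.\<close>

lemma gram_expansion:
  assumes "w \<in> V"
  shows "outer w w \<bullet> (\<Sum>v\<in>V. c v *\<^sub>R outer v v)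
    = (1 - \<kappa>\<^sup>2) * c w + \<kappa>\<^sup>2 * (mat 1 \<bullet> (\<Sum>v\<in>V. c v *\<^sub>R outer v v))"
proof -
  have "outer w w \<bullet> (\<Sum>v\<in>V. c v *\<^sub>R outer v v) = (\<Sum>v\<in>V. c v * (w \<bullet> v)\<^sup>2)"
    by (simp add: inner_sum_right outer_inner_outer power2_eq_square)
  also have "\<dots> = (\<Sum>v\<in>V. (if v = w then c v * (1 - \<kappa>\<^sup>2) else 0) + \<kappa>\<^sup>2 * c v)"
    using assms by (intro sum.cong) (auto simp: angle unit algebra_simps)
  also have "\<dots> = (1 - \<kappa>\<^sup>2) * c w + \<kappa>\<^sup>2 * (\<Sum>v\<in>V. c v)"
    using assms finite_V by (simp add: sum.distrib sum_distrib_left)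
  also have "(\<Sum>v\<in>V. c v) = mat 1 \<bullet> (\<Sum>v\<in>V. c v *\<^sub>R outer v v)"
    by (simp add: inner_sum_right mat_1_inner_outer unit)
  finally show ?thesis .
qed

lemma inj_on_outer: "inj_on (\<lambda>v. outer v v) V"
proof (rule inj_onI, rule ccontr)
  fix v w assume vw: "v \<in> V" "w \<in> V" "outer v v = outer w w" "v \<noteq> w"
  have "outer v v \<bullet> outer w w = \<kappa>\<^sup>2" "outer v v \<bullet> outer v v = 1"
    unfolding outer_inner_outer using vw angle[of v w] unit[of v] by (simp_all add: power2_eq_square)
  then show False unfolding vw(3) using vw(1,2) kappa_sq by simp
qed

text \<open>A vanishing combination pairs to zero with \<open>mat 1\<close> and with every
  projection, so \<open>gram_expansion\<close> kills each coefficient. Independence and the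
  dimension bound give a basis.\<close>

lemma symmetric_in_span:
  assumes "A \<in> symmetric_matrices"
  obtains c where "A = (\<Sum>v\<in>V. c v *\<^sub>R outer v v)"
proof -
  let ?B = "(\<lambda>v. outer v v) ` V"
  have "independent ?B"
  proof (rule independent_if_scalars_zero)
    fix f X assume f: "(\<Sum>x\<in>?B. f x *\<^sub>R x) = 0" and X: "X \<in> ?B"
    then obtain w where w: "w \<in> V" "X = outer w w" by auto
    have "(\<Sum>v\<in>V. f (outer v v) *\<^sub>R outer v v) = 0"
      using f by (simp add: sum.reindex[OF inj_on_outer])
    then show "f X = 0" using gram_expansion[OF w(1), of "\<lambda>v. f (outer v v)"] kappa_sq w by simp
  qed (simp add: finite_V)
  moreover have "?B \<subseteq> symmetric_matrices" by (auto simp: outer_symmetric)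
  moreover have "dim (symmetric_matrices :: (real^'n^'n) set) \<le> card ?B"
    using dim_symmetric_matrices_le by (simp add: card_image[OF inj_on_outer] card_V)
  ultimately have "A \<in> span ?B" using assms card_ge_dim_independent by blast
  then obtain u where "A = (\<Sum>x\<in>?B. u x *\<^sub>R x)"
    using span_finite[of ?B] finite_V by auto
  then show thesis using that[of "\<lambda>v. u (outer v v)"] by (simp add: sum.reindex[OF inj_on_outer])
qed

text \<open>\<open>gram_expansion\<close> solved for the coefficients of \<open>A\<close>, then
  paired with \<open>M\<close>. The moments below are its instances with \<open>A\<close> and
  \<open>M\<close> taken from \<open>mat 1\<close> and the matrices
  \<open>outer x y\<close>.\<close>

lemma matrix_identity:
  assumes "A \<in> symmetric_matrices"
  shows "(1 - \<kappa>\<^sup>2) * (A \<bullet> M) = (\<Sum>v\<in>V. (outer v v \<bullet> A - \<kappa>\<^sup>2 * (mat 1 \<bullet> A)) * (outer v v \<bullet> M))"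
proof -
  obtain c where c: "A = (\<Sum>v\<in>V. c v *\<^sub>R outer v v)" using symmetric_in_span[OF assms] .
  have "(1 - \<kappa>\<^sup>2) * (A \<bullet> M) = (\<Sum>v\<in>V. (1 - \<kappa>\<^sup>2) * c v * (outer v v \<bullet> M))"
    unfolding c by (simp add: inner_sum_left sum_distrib_left algebra_simps)
  also have "\<dots> = (\<Sum>v\<in>V. (outer v v \<bullet> A - \<kappa>\<^sup>2 * (mat 1 \<bullet> A)) * (outer v v \<bullet> M))"
    using gram_expansion[of _ c] unfolding c[symmetric] by (intro sum.cong) auto
  finally show ?thesis .
qed

lemma second_moment_raw:
  "(1 - \<kappa>\<^sup>2) * (x \<bullet> y) = (1 - \<kappa>\<^sup>2 * real CARD('n)) * (\<Sum>v\<in>V. (v \<bullet> x) * (v \<bullet> y))"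
proof -
  have "(1 - \<kappa>\<^sup>2) * (x \<bullet> y)
      = (\<Sum>v\<in>V. (outer v v \<bullet> mat 1 - \<kappa>\<^sup>2 * (mat 1 \<bullet> (mat 1 :: real^'n^'n))) * (outer v v \<bullet> outer x y))"
    using matrix_identity[OF mat_1_symmetric, of "outer x y"] by (simp add: mat_1_inner_outer)
  also have "\<dots> = (\<Sum>v\<in>V. (1 - \<kappa>\<^sup>2 * real CARD('n)) * ((v \<bullet> x) * (v \<bullet> y)))"
    by (intro sum.cong)
       (simp_all add: outer_inner_mat_1 mat_1_inner_outer mat_1_inner_mat_1 outer_inner_outer unit)
  finally show ?thesis by (simp add: sum_distrib_left)
qed

text \<open>The instance with both matrices equal to \<open>mat 1\<close>. Inserting the number of
  lines turns it into d(d - 1)(\<kappa>^2 (d + 2) - 1) = 0, and d >= 2 leaves only the last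
  factor.\<close>

lemma kappa_eq: "\<kappa>\<^sup>2 * (real CARD('n) + 2) = 1"
proof -
  let ?d = "real CARD('n)"
  have 1: "(1 - \<kappa>\<^sup>2) * ?d = (1 - \<kappa>\<^sup>2 * ?d) * real (card V)"
    using matrix_identity[OF mat_1_symmetric, of "mat 1"]
    by (simp add: mat_1_inner_mat_1 outer_inner_mat_1 unit)
  have 2: "2 * real (card V) = ?d * (?d + 1)"
    unfolding card_V using of_nat_mult[of 2 "CARD('n) * (CARD('n) + 1) div 2", where ?'a = real]
    by (simp add: algebra_simps)
  have "?d * (?d - 1) * (\<kappa>\<^sup>2 * (?d + 2) - 1)
      = 2 * ((1 - \<kappa>\<^sup>2) * ?d) - (1 - \<kappa>\<^sup>2 * ?d) * (?d * (?d + 1))" by algebra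
  also have "\<dots> = 0" unfolding 1 2[symmetric] by simp
  finally show ?thesis using dim_ge_2 by auto
qed

text \<open>The instance with \<open>outer x y\<close> and \<open>outer z w\<close>. Its trace term
  is a second moment, and \<kappa>^2 = 1/(d + 2) makes the result fully symmetric.\<close>

lemma fourth_moment:
  "2 * (real CARD('n) + 2) * (\<Sum>v\<in>V. (v \<bullet> x) * (v \<bullet> y) * (v \<bullet> z) * (v \<bullet> w))
    = (real CARD('n) + 1) * ((x \<bullet> y) * (z \<bullet> w) + (x \<bullet> z) * (y \<bullet> w) + (x \<bullet> w) * (y \<bullet> z))"
proof -
  let ?d = "real CARD('n)"
  let ?S = "\<Sum>v\<in>V. (v \<bullet> x) * (v \<bullet> y) * (v \<bullet> z) * (v \<bullet> w)"
  have k: "\<kappa>\<^sup>2 = 1 / (?d + 2)" using kappa_eq by (simp add: field_simps)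
  have two: "(?d + 1) * (z \<bullet> w) = 2 * (\<Sum>v\<in>V. (v \<bullet> z) * (v \<bullet> w))"
    using second_moment_raw[of z w] unfolding k by (simp add: field_simps)
  have "(1 - \<kappa>\<^sup>2) * (((x \<bullet> z) * (y \<bullet> w) + (x \<bullet> w) * (y \<bullet> z)) / 2)
     = (\<Sum>v\<in>V. ((v \<bullet> x) * (v \<bullet> y) - \<kappa>\<^sup>2 * (x \<bullet> y)) * ((v \<bullet> z) * (v \<bullet> w)))"
    using matrix_identity[OF outer_symmetric, of x y "outer z w"]
    by (simp add: outer_inner_outer mat_1_inner_outer mult.commute[of "_ \<bullet> w" "_ \<bullet> z"])
  also have "\<dots> = ?S - \<kappa>\<^sup>2 * (x \<bullet> y) * (\<Sum>v\<in>V. (v \<bullet> z) * (v \<bullet> w))"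
    by (simp add: sum_subtractf sum_distrib_left algebra_simps)
  finally have S: "?S = (1 - \<kappa>\<^sup>2) * (((x \<bullet> z) * (y \<bullet> w) + (x \<bullet> w) * (y \<bullet> z)) / 2)
      + \<kappa>\<^sup>2 * (x \<bullet> y) * (\<Sum>v\<in>V. (v \<bullet> z) * (v \<bullet> w))" by linarith
  have 1: "(?d + 2) * (1 - \<kappa>\<^sup>2) = ?d + 1" and 2: "(?d + 2) * \<kappa>\<^sup>2 = 1"
    using kappa_eq by (simp_all add: algebra_simps)
  have "2 * (?d + 2) * ?S = ((?d + 2) * (1 - \<kappa>\<^sup>2)) * ((x \<bullet> z) * (y \<bullet> w) + (x \<bullet> w) * (y \<bullet> z))
      + ((?d + 2) * \<kappa>\<^sup>2) * (x \<bullet> y) * (2 * (\<Sum>v\<in>V. (v \<bullet> z) * (v \<bullet> w)))"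
    unfolding S by algebra
  then show ?thesis unfolding 1 2 two[symmetric] by (simp add: algebra_simps)
qed

end

section \<open>Bases with constant inner product\<close>

locale equiangular_basis =
  fixes \<alpha> :: "'n::finite \<Rightarrow> real^'n" and \<kappa> :: real
  assumes gram: "\<alpha> i \<bullet> \<alpha> j = (if i = j then 1 else \<kappa>)"
    and kappa: "0 < \<kappa>" "\<kappa> < 1"
begin

text \<open>Coordinates come from the inverse of the Gram matrix (1 - \<kappa>) I + \<kappa> J,
  which is (I - \<kappa>/(1 - \<kappa> + d\<kappa>) J)/(1 - \<kappa>).\<close>

definition coord :: "'n \<Rightarrow> real^'n \<Rightarrow> real" where
  "coord i x = (x \<bullet> \<alpha> i - \<kappa> / (1 - \<kappa> + real CARD('n) * \<kappa>) * (\<Sum>j\<in>UNIV. x \<bullet> \<alpha> j)) / (1 - \<kappa>)"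

lemma denominator_pos: "1 - \<kappa> + real CARD('n) * \<kappa> > 0"
  using kappa by (simp add: add_pos_nonneg)

lemma coord_eq:
  "(1 - \<kappa>) * coord i x
    = x \<bullet> \<alpha> i - \<kappa> / (1 - \<kappa> + real CARD('n) * \<kappa>) * (\<Sum>j\<in>UNIV. x \<bullet> \<alpha> j)"
  using kappa by (simp add: coord_def)

lemma sum_gram: "(\<Sum>i\<in>UNIV. c i * (\<alpha> i \<bullet> \<alpha> j)) = (1 - \<kappa>) * c j + \<kappa> * (\<Sum>i\<in>UNIV. c i)"
proof -
  have "(\<Sum>i\<in>UNIV. c i * (\<alpha> i \<bullet> \<alpha> j)) = (\<Sum>i\<in>UNIV. (if i = j then (1 - \<kappa>) * c i else 0) + \<kappa> * c i)"
    by (intro sum.cong) (auto simp: gram algebra_simps)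
  then show ?thesis by (simp add: sum.distrib sum_distrib_left)
qed

lemma inj_basis: "inj \<alpha>"
  using gram kappa by (metis injI less_irrefl)

lemma independent_basis: "independent (range \<alpha>)"
proof (rule independent_if_scalars_zero)
  fix f X assume f: "(\<Sum>x\<in>range \<alpha>. f x *\<^sub>R x) = 0" and X: "X \<in> range \<alpha>"
  have "(\<Sum>i\<in>UNIV. f (\<alpha> i) *\<^sub>R \<alpha> i) = 0" using f by (simp add: sum.reindex[OF inj_basis])
  then have "(\<Sum>i\<in>UNIV. f (\<alpha> i) * (\<alpha> i \<bullet> \<alpha> j)) = 0" for j
    by (metis (mono_tags, lifting) inner_scaleR_left inner_sum_left inner_zero_left sum.cong)
  then have z: "(1 - \<kappa>) * f (\<alpha> j) + \<kappa> * (\<Sum>i\<in>UNIV. f (\<alpha> i)) = 0" for j by (simp add: sum_gram)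
  \<comment> \<open>Adding the d equations isolates the coefficient sum with the positive factor 1 -
    \<kappa> + d\<kappa>. Once this sum is zero, each equation involves a single
    coefficient.\<close>
  have "(\<Sum>j\<in>(UNIV::'n set). (1 - \<kappa>) * f (\<alpha> j) + \<kappa> * (\<Sum>i\<in>UNIV. f (\<alpha> i))) = 0"
    by (simp only: z sum.neutral_const)
  then have "(1 - \<kappa> + real CARD('n) * \<kappa>) * (\<Sum>i\<in>UNIV. f (\<alpha> i)) = 0"
    unfolding sum.distrib sum_distrib_left[symmetric] by (simp, algebra)
  then have "(\<Sum>i\<in>UNIV. f (\<alpha> i)) = 0" using denominator_pos by simp
  then show "f X = 0" using z X kappa by auto
qed simp

lemma span_basis: "span (range \<alpha>) = UNIV"
proof -
  have "card (range \<alpha>) = CARD('n)" by (simp add: card_image inj_basis)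
  then have "UNIV \<subseteq> span (range \<alpha>)"
    by (intro card_ge_dim_independent independent_basis) (auto simp: dim_UNIV)
  then show ?thesis by auto
qed

lemma vec_eqI: "(\<And>i. x \<bullet> \<alpha> i = y \<bullet> \<alpha> i) \<Longrightarrow> x = y"
proof -
  assume "\<And>i. x \<bullet> \<alpha> i = y \<bullet> \<alpha> i"
  then have "orthogonal (x - y) v" if "v \<in> range \<alpha>" for v
    using that by (auto simp: orthogonal_def inner_diff_left)
  then have "orthogonal (x - y) (x - y)"
    using orthogonal_to_span[of "x - y" "range \<alpha>" "x - y"] span_basis by auto
  then show "x = y" by (simp add: orthogonal_def)
qed

lemma sum_coord:
  "(\<Sum>i\<in>UNIV. coord i x) = (\<Sum>j\<in>UNIV. x \<bullet> \<alpha> j) / (1 - \<kappa> + real CARD('n) * \<kappa>)"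
proof -
  let ?D = "1 - \<kappa> + real CARD('n) * \<kappa>" and ?s = "\<Sum>j\<in>UNIV. x \<bullet> \<alpha> j"
  have "(\<Sum>i\<in>UNIV. coord i x) = (?s - real CARD('n) * (\<kappa> / ?D * ?s)) / (1 - \<kappa>)"
    unfolding coord_def sum_divide_distrib[symmetric] sum_subtractf by simp
  also have "\<dots> = ?s / ?D" using denominator_pos kappa by (simp add: divide_simps) (simp add: algebra_simps)
  finally show ?thesis .
qed

lemma expansion: "(\<Sum>i\<in>UNIV. coord i x *\<^sub>R \<alpha> i) = x"
proof (rule vec_eqI)
  fix j
  have "(\<Sum>i\<in>UNIV. coord i x *\<^sub>R \<alpha> i) \<bullet> \<alpha> j = (1 - \<kappa>) * coord j x + \<kappa> * (\<Sum>i\<in>UNIV. coord i x)"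
    by (simp add: inner_sum_left sum_gram)
  also have "\<dots> = x \<bullet> \<alpha> j" unfolding sum_coord coord_eq by simp
  finally show "(\<Sum>i\<in>UNIV. coord i x *\<^sub>R \<alpha> i) \<bullet> \<alpha> j = x \<bullet> \<alpha> j" .
qed

text \<open>One vector is expanded through the inverse Gram matrix. Products with the basis thus
  determine all inner products, which is how sign patterns are compared later.\<close>

lemma inner_formula:
  "(1 - \<kappa>) * (x \<bullet> y) = (\<Sum>i\<in>UNIV. (x \<bullet> \<alpha> i) * (y \<bullet> \<alpha> i))
    - \<kappa> / (1 - \<kappa> + real CARD('n) * \<kappa>) * (\<Sum>i\<in>UNIV. x \<bullet> \<alpha> i) * (\<Sum>i\<in>UNIV. y \<bullet> \<alpha> i)"
proof -
  have "(1 - \<kappa>) * (x \<bullet> y) = (\<Sum>i\<in>UNIV. ((1 - \<kappa>) * coord i x) * (y \<bullet> \<alpha> i))"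
    by (subst (1) expansion[symmetric])
       (simp add: inner_sum_left sum_distrib_left inner_commute[of "\<alpha> _" y] mult.assoc)
  also have "\<dots> = (\<Sum>i\<in>UNIV. (x \<bullet> \<alpha> i) * (y \<bullet> \<alpha> i)
      - \<kappa> / (1 - \<kappa> + real CARD('n) * \<kappa>) * (\<Sum>i\<in>UNIV. x \<bullet> \<alpha> i) * (y \<bullet> \<alpha> i))"
    by (intro sum.cong refl) (simp only: coord_eq, simp only: left_diff_distrib)
  finally show ?thesis by (simp add: sum_subtractf sum_distrib_left)
qed

text \<open>Gram matrices equal up to the factor \<open>r\<close> give an isometry sending
  \<open>\<alpha> i\<close> to the normalised \<open>\<beta> (\<pi> i)\<close>. It carries
  \<open>span {a}\<close> to \<open>span {b}\<close> once their products with the two bases are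
  proportional. After inclusion in \<open>\<Omega>'\<close> the cardinalities force
  equality.\<close>

lemma isometric_linesI:
  fixes \<beta> :: "'m::finite \<Rightarrow> real^'m" and \<pi> :: "'n \<Rightarrow> 'm"
  assumes bij: "bij \<pi>" and r: "r > 0"
    and gram': "\<And>i j. \<beta> i \<bullet> \<beta> j = (if i = j then r else r * \<kappa>)"
    and lines: "\<And>L. L \<in> \<Omega> \<Longrightarrow> \<exists>a b s. L = span {a} \<and> s \<noteq> 0 \<and> span {b} \<in> \<Omega>' \<and>
                  (\<forall>i. b \<bullet> \<beta> (\<pi> i) = s * (a \<bullet> \<alpha> i))"
    and fin: "finite \<Omega>'" and card: "card \<Omega>' \<le> card \<Omega>"
  shows "isometric_lines \<Omega> \<Omega>'"
proof -
  define \<beta>' where "\<beta>' i = \<beta> i /\<^sub>R sqrt r" for i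
  interpret B: equiangular_basis \<beta>' \<kappa>
    by unfold_locales (use kappa r in \<open>auto simp: \<beta>'_def gram' field_simps\<close>)
  define f where "f x = (\<Sum>i\<in>UNIV. coord i x *\<^sub>R \<beta>' (\<pi> i))" for x
  have \<pi>: "\<pi> i = \<pi> j \<longleftrightarrow> i = j" for i j using bij by (simp add: bij_def inj_eq)
  have g: "\<beta>' (\<pi> i) \<bullet> \<beta>' (\<pi> j) = \<alpha> i \<bullet> \<alpha> j" for i j by (simp add: B.gram gram \<pi>)
  have f_inner: "f x \<bullet> f y = x \<bullet> y" for x y
  proof -
    have "f x \<bullet> f y = (\<Sum>i\<in>UNIV. coord i x *\<^sub>R \<alpha> i) \<bullet> (\<Sum>i\<in>UNIV. coord i y *\<^sub>R \<alpha> i)"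
      by (simp add: f_def inner_sum_left inner_sum_right g)
    then show ?thesis by (simp add: expansion)
  qed
  have f_\<beta>: "f x \<bullet> \<beta>' (\<pi> j) = x \<bullet> \<alpha> j" for x j
  proof -
    have "f x \<bullet> \<beta>' (\<pi> j) = (\<Sum>i\<in>UNIV. coord i x *\<^sub>R \<alpha> i) \<bullet> \<alpha> j"
      by (simp add: f_def inner_sum_left g)
    then show ?thesis by (simp add: expansion)
  qed
  have surj: "\<exists>i. \<pi> i = j" for j using bij by (metis bij_pointE)
  have lin: "linear f"
  proof (rule linearI)
    show "f (x + y) = f x + f y" for x y
      by (rule B.vec_eqI) (metis surj f_\<beta> inner_add_left)
    show "f (c *\<^sub>R x) = c *\<^sub>R f x" for c x
      by (rule B.vec_eqI) (metis surj f_\<beta> inner_scaleR_left)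
  qed
  have inj: "inj f"
    by (rule injI) (metis f_\<beta> vec_eqI)
  have "CARD('n) = CARD('m)" using bij by (rule bij_betw_same_card)
  then have bijf: "bij f" using linear_injective_imp_surjective[OF lin inj] inj
    by (simp add: bij_def)
  have sub: "(`) f ` \<Omega> \<subseteq> \<Omega>'"
  proof
    fix M assume "M \<in> (`) f ` \<Omega>"
    then obtain L where L: "L \<in> \<Omega>" "M = f ` L" by auto
    obtain a b s where a: "L = span {a}" "s \<noteq> 0" "span {b} \<in> \<Omega>'"
      and b: "\<And>i. b \<bullet> \<beta> (\<pi> i) = s * (a \<bullet> \<alpha> i)" using lines[OF L(1)] by blast
    have fa: "f a = (sqrt r / s) *\<^sub>R b"
    proof (rule B.vec_eqI)
      fix j obtain i where i: "j = \<pi> i" using surj by metis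
      have "b \<bullet> \<beta>' (\<pi> i) = s * (a \<bullet> \<alpha> i) / sqrt r"
        using b by (simp add: \<beta>'_def field_simps)
      then show "f a \<bullet> \<beta>' j = ((sqrt r / s) *\<^sub>R b) \<bullet> \<beta>' j"
        unfolding i f_\<beta> using a(2) r by simp
    qed
    have "M = span {f a}" unfolding L(2) a(1) using linear_span_image[OF lin, of "{a}"] by simp
    also have "\<dots> = span {b}" unfolding fa
      using span_image_scale[of "{b}" "\<lambda>_. sqrt r / s"] a(2) r by (simp add: divide_inverse)
    finally show "M \<in> \<Omega>'" using a(3) by simp
  qed
  have "card ((`) f ` \<Omega>) = card \<Omega>"
    by (intro card_image inj_onI) (use inj in \<open>simp add: inj_image_eq_iff\<close>)
  then have "(`) f ` \<Omega> = \<Omega>'" using sub card card_subset_eq[OF fin sub] card_mono[OF fin sub] by simp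
  then show ?thesis unfolding isometric_lines_def using lin bijf f_inner by blast
qed

end

section \<open>Uniqueness of the Steiner system S(4,7,23)\<close>

text \<open>Over the field with two elements, with symmetric difference as addition, the parity of
  the intersection with \<open>c\<close> is a linear form.\<close>

lemma even_card_sym_diff_Int:
  fixes a b :: "'p::finite set"
  shows "even (card (sym_diff a b \<inter> c)) \<longleftrightarrow> (even (card (a \<inter> c)) \<longleftrightarrow> even (card (b \<inter> c)))"
proof -
  have "card (a \<inter> c) = card (a \<inter> c - b) + card (a \<inter> b \<inter> c)"
    "card (b \<inter> c) = card (b \<inter> c - a) + card (a \<inter> b \<inter> c)"
    by (subst card_Un_disjoint[symmetric]; (auto intro!: arg_cong[where f=card])?)+
  moreover have "card (sym_diff a b \<inter> c) = card (a \<inter> c - b) + card (b \<inter> c - a)"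
    by (subst card_Un_disjoint[symmetric]) (auto intro!: arg_cong[where f=card])
  ultimately show ?thesis by presburger
qed

lemma card_sym_diff:
  fixes a b :: "'p::finite set"
  shows "card (sym_diff a b) + 2 * card (a \<inter> b) = card a + card b"
proof -
  have "card a = card (a - b) + card (a \<inter> b)" "card b = card (b - a) + card (a \<inter> b)"
    by (subst card_Un_disjoint[symmetric]; (auto intro!: arg_cong[where f=card])?)+
  moreover have "card (sym_diff a b) = card (a - b) + card (b - a)"
    by (subst card_Un_disjoint[symmetric]) auto
  ultimately show ?thesis by presburger
qed

text \<open>On explicit lists, sums of labelled blocks are evaluated by rewriting with the
  distinctness of the labels.\<close>

definition sym_diff_list :: "'a list \<Rightarrow> 'a list \<Rightarrow> 'a list" where
  "sym_diff_list xs ys = filter (\<lambda>x. x \<notin> set ys) xs @ filter (\<lambda>y. y \<notin> set xs) ys"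

text \<open>Uniqueness of the block through four points follows from \<open>meet\<close>, since
  distinct blocks share at most three.\<close>

locale steiner_system =
  fixes \<B> :: "'p::finite set set"
  assumes card_points: "CARD('p) = 23"
    and block_card: "b \<in> \<B> \<Longrightarrow> card b = 7"
    and block_ex: "card T = 4 \<Longrightarrow> \<exists>b\<in>\<B>. T \<subseteq> b"
    and meet: "b \<in> \<B> \<Longrightarrow> c \<in> \<B> \<Longrightarrow> b \<noteq> c \<Longrightarrow> card (b \<inter> c) = 1 \<or> card (b \<inter> c) = 3"
begin

lemma odd_meet: "b \<in> \<B> \<Longrightarrow> c \<in> \<B> \<Longrightarrow> odd (card (b \<inter> c))"
  by (cases "b = c") (use meet[of b c] block_card[of b] in auto)

lemma block_eqI: "b \<in> \<B> \<Longrightarrow> c \<in> \<B> \<Longrightarrow> T \<subseteq> b \<Longrightarrow> T \<subseteq> c \<Longrightarrow> card T > 3 \<Longrightarrow> b = c"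
  by (rule ccontr) (use meet[of b c] card_mono[of "b \<inter> c" T] in auto)

text \<open>For each \<open>p\<close> in \<open>W\<close>, a block through \<open>p\<close> and
  \<open>T\<close> adds only four points to \<open>T\<close>. At most 3 + 3 * 4 = 15 of the 23
  points are covered this way. A block through \<open>T\<close> and an uncovered point contains no
  \<open>p\<close>, since it would then equal the block chosen for \<open>p\<close>.\<close>

lemma block_avoiding:
  assumes T: "card T = 3" and W: "card W \<le> 3" "W \<inter> T = {}"
  obtains b where "b \<in> \<B>" "T \<subseteq> b" "b \<inter> W = {}"
proof -
  have "\<exists>b. b \<in> \<B> \<and> insert p T \<subseteq> b" if "p \<in> W" for p
  proof -
    have "p \<notin> T" using that W by auto
    then have "card (insert p T) = 4" using T by simp
    from block_ex[OF this] show ?thesis by blast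
  qed
  then obtain g where g: "\<And>p. p \<in> W \<Longrightarrow> g p \<in> \<B> \<and> insert p T \<subseteq> g p" by metis
  let ?U = "T \<union> (\<Union>p\<in>W. g p - T)"
  have "card (\<Union>p\<in>W. g p - T) \<le> (\<Sum>p\<in>W. card (g p - T))" by (rule card_UN_le) simp
  also have "\<dots> = (\<Sum>p\<in>W. 4)"
    by (intro sum.cong) (use g block_card T in \<open>auto simp: card_Diff_subset\<close>)
  also have "\<dots> \<le> 12" using W by simp
  finally have "card ?U \<le> 15" using T card_Un_le[of T "\<Union>p\<in>W. g p - T"] by simp
  then have "?U \<noteq> UNIV" using card_points by (intro notI) simp
  then obtain z where z: "z \<notin> ?U" by blast
  then have "card (insert z T) = 4" using T by simp
  then obtain b where b: "b \<in> \<B>" "insert z T \<subseteq> b" using block_ex by blast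
  have "b \<inter> W = {}"
  proof (rule ccontr)
    assume "b \<inter> W \<noteq> {}"
    then obtain p where p: "p \<in> b" "p \<in> W" by auto
    have "b = g p"
      by (rule block_eqI[of _ _ "insert p T"]) (use b p g W T in \<open>auto simp: card_insert_if\<close>)
    then show False using z b p by auto
  qed
  then show thesis using that b by blast
qed

text \<open>A minimum weight bound for the dual of the binary code spanned by the blocks. If
  \<open>T\<close> meets \<open>w\<close> oddly and leaves at most three points of \<open>w\<close>
  outside, a block through \<open>T\<close> avoiding these meets \<open>w\<close> exactly in
  \<open>w \<inter> T\<close>, an odd number of points.\<close>

lemma even_small_empty:
  assumes w: "card w \<le> 6" and even: "\<And>b. b \<in> \<B> \<Longrightarrow> even (card (w \<inter> b))"
  shows "w = {}"
proof (rule ccontr)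
  assume "w \<noteq> {}"
  obtain T where T: "card T = 3" "odd (card (w \<inter> T))" "card (w - T) \<le> 3"
  proof (cases "card w \<ge> 3")
    case True
    then obtain T where "T \<subseteq> w" "card T = 3" using obtain_subset_with_card_n by metis
    then show thesis using that[of T] w by (simp add: Int_absorb1 card_Diff_subset)
  next
    case False
    obtain p where p: "p \<in> w" using \<open>w \<noteq> {}\<close> by auto
    have "card (- w) \<ge> 2" using False card_points by (simp add: Compl_eq_Diff_UNIV card_Diff_subset)
    then obtain T where T: "T \<subseteq> - w" "card T = 2" using obtain_subset_with_card_n by metis
    then have 1: "w \<inter> insert p T = {p}" and 2: "p \<notin> T" using p by auto
    have "card (w - insert p T) \<le> card w" by (intro card_mono) auto
    then show thesis using that[of "insert p T"] T False 2 unfolding 1 by simp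
  qed
  obtain b where b: "b \<in> \<B>" "T \<subseteq> b" "b \<inter> (w - T) = {}"
    using block_avoiding[OF T(1,3)] by blast
  then have "w \<inter> b = w \<inter> T" by auto
  then show False using even[OF b(1)] T(2) by simp
qed

text \<open>Some block differs from \<open>x\<close> in at most six points: it shares four points
  with \<open>x\<close>, or it contains \<open>x\<close>, which is nonempty by parity. The
  difference meets all blocks evenly, so \<open>even_small_empty\<close> applies.\<close>

lemma odd_small_block:
  assumes x: "card x \<le> 7" and odd: "\<And>b. b \<in> \<B> \<Longrightarrow> odd (card (x \<inter> b))"
  shows "x \<in> \<B>"
proof -
  obtain b where b: "b \<in> \<B>" "card (sym_diff x b) \<le> 6"
  proof (cases "card x \<ge> 4")
    case True
    then obtain T where T: "T \<subseteq> x" "card T = 4" using obtain_subset_with_card_n by metis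
    obtain b where b: "b \<in> \<B>" "T \<subseteq> b" using block_ex[OF T(2)] by blast
    have "card (x \<inter> b) \<ge> 4" using card_mono[of "x \<inter> b" T] T b by simp
    then show thesis using that[OF b(1)] card_sym_diff[of x b] x block_card[OF b(1)] by linarith
  next
    case False
    obtain T where T: "x \<subseteq> T" "card T = 4"
    proof -
      have "4 - card x \<le> card (- x)" using False card_points by (simp add: Compl_eq_Diff_UNIV card_Diff_subset)
      then obtain S where "S \<subseteq> - x" "card S = 4 - card x" using obtain_subset_with_card_n by metis
      moreover have "card (x \<union> S) = card x + card S"
        by (rule card_Un_disjoint) (use calculation in auto)
      ultimately show thesis using that[of "x \<union> S"] False by simp
    qed
    obtain b where b: "b \<in> \<B>" "T \<subseteq> b" using block_ex[OF T(2)] by blast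
    have xb: "x \<inter> b = x" using T b by auto
    then have "card x \<ge> 1" using odd[OF b(1)] odd_pos by fastforce
    then show thesis using that[OF b(1)] card_sym_diff[of x b] block_card[OF b(1)] unfolding xb by linarith
  qed
  have "sym_diff x b = {}"
    by (rule even_small_empty[OF b(2)]) (use odd odd_meet[OF b(1)] in \<open>simp add: even_card_sym_diff_Int\<close>)
  then have "x = b" by auto
  then show ?thesis using b by simp
qed

lemma sym_diff_block:
  assumes "b \<in> \<B>" "c \<in> \<B>" "e \<in> \<B>" "x = sym_diff (sym_diff b c) e" "card x \<le> 7"
  shows "x \<in> \<B>"
  using assms(5)
  by (rule odd_small_block) (use assms odd_meet in \<open>simp add: even_card_sym_diff_Int\<close>)

text \<open>Without a common point the sum of the three blocks would have 21 - 2 * 9 = 3 points, yet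
  be a block by \<open>sym_diff_block\<close>.\<close>

lemma three_blocks_common_point:
  assumes "b \<in> \<B>" "c \<in> \<B>" "e \<in> \<B>" "card (b \<inter> c) = 3" "card (b \<inter> e) = 3" "card (c \<inter> e) = 3"
  shows "b \<inter> c \<inter> e \<noteq> {}"
proof
  assume 0: "b \<inter> c \<inter> e = {}"
  let ?x = "sym_diff (sym_diff b c) e"
  have "sym_diff b c \<inter> e = (b \<inter> e) \<union> (c \<inter> e)" using 0 by auto
  moreover have "card ((b \<inter> e) \<union> (c \<inter> e)) = card (b \<inter> e) + card (c \<inter> e)"
    by (rule card_Un_disjoint) (use 0 in auto)
  ultimately have "card (sym_diff b c \<inter> e) = 6" using assms by simp
  then have "card ?x = 3"
    using card_sym_diff[of "sym_diff b c" e] card_sym_diff[of b c] assms block_card by simp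
  then have "?x \<in> \<B>" using sym_diff_block[OF assms(1-3) refl] by simp
  then show False using block_card \<open>card ?x = 3\<close> by fastforce
qed

section \<open>Labelling the points of a Steiner system by an affine space\<close>

lemma block_parity:
  assumes "set xs \<in> \<B>" "distinct xs" "b \<in> \<B>"
  shows "odd (length (filter (\<lambda>x. x \<in> b) xs))"
proof -
  have "set (filter (\<lambda>x. x \<in> b) xs) = set xs \<inter> b" by auto
  then have "length (filter (\<lambda>x. x \<in> b) xs) = card (set xs \<inter> b)"
    using assms(2) by (metis distinct_card distinct_filter)
  then show ?thesis using odd_meet[OF assms(1,3)] by simp
qed

lemma meet3:
  assumes "b \<in> \<B>" "c \<in> \<B>" "y \<in> b" "y \<notin> c" "distinct [p, q, r]"
    "p \<in> b" "q \<in> b" "r \<in> b" "p \<in> c" "q \<in> c" "r \<in> c" "x \<in> b" "x \<in> c"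
  shows "x = p \<or> x = q \<or> x = r"
proof -
  have "card {p, q, r} = 3" using assms(5) by simp
  moreover have "card (b \<inter> c) \<le> 3" using meet[OF assms(1,2)] assms(3,4) by fastforce
  ultimately have "{p, q, r} = b \<inter> c" by (intro card_seteq) (use assms in auto)
  then show ?thesis using assms(12,13) by blast
qed

lemma third_point:
  assumes "b \<in> \<B>" "c \<in> \<B>" "y \<in> b" "y \<notin> c" "p \<noteq> q" "p \<in> b" "q \<in> b" "p \<in> c" "q \<in> c"
  obtains r where "r \<in> b" "r \<in> c" "r \<noteq> p" "r \<noteq> q"
    "\<forall>x. x \<in> b \<longrightarrow> x \<in> c \<longrightarrow> x = p \<or> x = q \<or> x = r"
proof -
  have "card {p, q} \<le> card (b \<inter> c)" by (rule card_mono) (use assms in auto)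
  then have 3: "card (b \<inter> c) = 3" using meet[of b c] assms by auto
  then have "card (b \<inter> c - {p, q}) = 1" using assms by (simp add: card_Diff_subset)
  then obtain r where "b \<inter> c - {p, q} = {r}" using card_1_singletonE by blast
  then show thesis using that[of r] by blast
qed

lemma block_through:
  assumes "distinct [p, q, r, s]"
  obtains b where "b \<in> \<B>" "p \<in> b" "q \<in> b" "r \<in> b" "s \<in> b"
proof -
  have "card {p, q, r, s} = 4" using assms by simp
  from block_ex[OF this] show thesis using that by blast
qed

lemma seventh_point:
  assumes "b \<in> \<B>" "distinct [p1, p2, p3, p4, p5, p6]"
    "{p1, p2, p3, p4, p5, p6} \<subseteq> b"
  obtains x where "distinct [p1, p2, p3, p4, p5, p6, x]" "b = {p1, p2, p3, p4, p5, p6, x}"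
proof -
  have "card {p1, p2, p3, p4, p5, p6} = 6" using assms(2) by simp
  then have "card (b - {p1, p2, p3, p4, p5, p6}) = 1"
    using assms block_card[OF assms(1)] by (simp add: card_Diff_subset)
  then obtain x where x: "b - {p1, p2, p3, p4, p5, p6} = {x}" using card_1_singletonE by blast
  have "x \<notin> {p1, p2, p3, p4, p5, p6}" using x by blast
  moreover have "b = {p1, p2, p3, p4, p5, p6, x}" using x assms by blast
  ultimately show thesis using that[of x] assms(2) by auto
qed

lemma meet3_list:
  assumes "set xs \<in> \<B>" "c \<in> \<B>" "y \<in> c" "y \<notin> set xs" "distinct [p, q, r]"
    "p \<in> set xs" "q \<in> set xs" "r \<in> set xs" "p \<in> c" "q \<in> c" "r \<in> c"
  shows "\<forall>x\<in>set xs. x \<in> c \<longrightarrow> x = p \<or> x = q \<or> x = r"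
  using meet3[OF assms(2,1,3,4,5)] assms(6-) by blast

text \<open>The points \<open>p\<^sub>1, \<dots>, p\<^sub>7\<close> form a block. On its complement, \<open>z\<close> is the origin of an affine space over
  the field with two elements, \<open>e\<^sub>1, \<dots>, e\<^sub>4\<close> is a basis, \<open>f\<^sub>i\<^sub>j\<close> and \<open>g\<^sub>i\<^sub>j\<^sub>k\<close> are the sums of two and three
  basis vectors, and \<open>h\<close> is the sum of all four. A block meeting the first one in three points consists
  of these points and an affine plane.\<close>

lemma labelled_start:
  obtains p1 p2 p3 p4 p5 p6 p7 z e1 b1 b2 b3 where
    "distinct [p1, p2, p3, p4, p5, p6, p7, z, e1]"
    "{p1, p2, p3, p4, p5, p6, p7} \<in> \<B>" "b1 \<in> \<B>" "b2 \<in> \<B>" "b3 \<in> \<B>"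
    "{p1, p2, p3, z, e1} \<subseteq> b1" "{p1, p4, p5, z, e1} \<subseteq> b2" "{p2, p4, p6, z, e1} \<subseteq> b3"
proof -
  obtain T :: "'p set" where "card T = 4"
    using obtain_subset_with_card_n[of 4 "UNIV::'p set"] card_points by auto
  then obtain B0 where B0: "B0 \<in> \<B>" using block_ex by blast
  have "card (- B0) = 16"
    using block_card[OF B0] card_points by (simp add: Compl_eq_Diff_UNIV card_Diff_subset)
  then obtain E where E: "E \<subseteq> - B0" "card E = 2" using obtain_subset_with_card_n[of 2 "- B0"] by auto
  then obtain z e1 where z: "z \<noteq> e1" "z \<notin> B0" "e1 \<notin> B0" by (auto simp: card_2_iff)
  obtain P where "P \<subseteq> B0" "card P = 2"
    using obtain_subset_with_card_n[of 2 B0] block_card[OF B0] by auto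
  then obtain p1 p2 where p12: "p1 \<noteq> p2" "p1 \<in> B0" "p2 \<in> B0" by (auto simp: card_2_iff)
  have nz: "x \<noteq> z" "x \<noteq> e1" if "x \<in> B0" for x using z that by blast+
  \<comment> \<open>The blocks \<open>b1\<close>, \<open>b2\<close>, \<open>b3\<close> through
    \<open>z\<close> and \<open>e1\<close> cut \<open>B0\<close> in the sides of a triangle with
    corners \<open>p1\<close>, \<open>p2\<close>, \<open>p4\<close>. Two of them share only
    \<open>z\<close>, \<open>e1\<close> and a corner, so the further points \<open>p3\<close>,
    \<open>p5\<close>, \<open>p6\<close> are distinct.\<close>
  obtain b1 where b1: "b1 \<in> \<B>" "p1 \<in> b1" "p2 \<in> b1" "z \<in> b1" "e1 \<in> b1"
    using block_through[of p1 p2 z e1] z p12 nz by auto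
  obtain p3 where p3: "p3 \<in> b1" "p3 \<in> B0" "p3 \<noteq> p1" "p3 \<noteq> p2"
    and B0b1: "\<And>x. x \<in> b1 \<Longrightarrow> x \<in> B0 \<Longrightarrow> x = p1 \<or> x = p2 \<or> x = p3"
    using third_point[OF b1(1) B0 b1(4) z(2) p12(1)] b1 p12 by blast
  have "card {p1, p2, p3} < card B0" using p3 p12 block_card[OF B0] by simp
  then have "\<not> B0 \<subseteq> {p1, p2, p3}" by (meson card_mono finite leD)
  then obtain p4 where p4: "p4 \<in> B0" "p4 \<noteq> p1" "p4 \<noteq> p2" "p4 \<noteq> p3" by auto
  have p4b1: "p4 \<notin> b1" using B0b1 p4 by blast
  obtain b2 where b2: "b2 \<in> \<B>" "p1 \<in> b2" "p4 \<in> b2" "z \<in> b2" "e1 \<in> b2"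
    using block_through[of p1 p4 z e1] z p12 p4 nz by auto
  obtain p5 where p5: "p5 \<in> b2" "p5 \<in> B0" "p5 \<noteq> p1" "p5 \<noteq> p4"
    and B0b2: "\<And>x. x \<in> b2 \<Longrightarrow> x \<in> B0 \<Longrightarrow> x = p1 \<or> x = p4 \<or> x = p5"
    using third_point[OF b2(1) B0 b2(4) z(2) p4(2)[symmetric]] b2 p12 p4 by blast
  have "distinct [p1, z, e1]" using nz p12 z(1) by auto
  from meet3[OF b2(1) b1(1) b2(3) p4b1 this b2(2,4,5) b1(2,4,5)]
  have b12: "x = p1 \<or> x = z \<or> x = e1" if "x \<in> b1" "x \<in> b2" for x using that by blast
  have p5': "p5 \<noteq> p2" "p5 \<noteq> p3" "p2 \<notin> b2" using b12 b1 p3 p5 p12 nz by metis+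
  obtain b3 where b3: "b3 \<in> \<B>" "p2 \<in> b3" "p4 \<in> b3" "z \<in> b3" "e1 \<in> b3"
    using block_through[of p2 p4 z e1] z p12 p4 nz by auto
  obtain p6 where p6: "p6 \<in> b3" "p6 \<in> B0" "p6 \<noteq> p2" "p6 \<noteq> p4"
    and B0b3: "\<And>x. x \<in> b3 \<Longrightarrow> x \<in> B0 \<Longrightarrow> x = p2 \<or> x = p4 \<or> x = p6"
    using third_point[OF b3(1) B0 b3(4) z(2) p4(3)[symmetric]] b3 p12 p4 by blast
  have "distinct [p2, z, e1]" "distinct [p4, z, e1]" using nz p12 z(1) p4 by auto
  from meet3[OF b3(1) b1(1) b3(3) p4b1 this(1) b3(2,4,5) b1(3,4,5)]
    meet3[OF b3(1) b2(1) b3(2) p5'(3) this(2) b3(3,4,5) b2(3,4,5)]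
  have b13: "\<And>x. x \<in> b1 \<Longrightarrow> x \<in> b3 \<Longrightarrow> x = p2 \<or> x = z \<or> x = e1"
    and b23: "\<And>x. x \<in> b2 \<Longrightarrow> x \<in> b3 \<Longrightarrow> x = p4 \<or> x = z \<or> x = e1" by blast+
  have p6': "p6 \<noteq> p1" "p6 \<noteq> p3" "p6 \<noteq> p5" using b13 b23 p3 p5 p6 b1 b2 nz by metis+
  have d6: "distinct [p1, p2, p3, p4, p5, p6]"
    using p12(1) p3(3,4) p4(2-) p5(3,4) p5'(1,2) p6(3,4) p6' by auto
  have "{p1, p2, p3, p4, p5, p6} \<subseteq> B0" using p12 p3 p4 p5 p6 by simp
  from seventh_point[OF B0 d6 this]
  obtain p7 where p7: "distinct [p1, p2, p3, p4, p5, p6, p7]" "B0 = {p1, p2, p3, p4, p5, p6, p7}" .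
  show thesis
  proof (rule that)
    show "distinct [p1, p2, p3, p4, p5, p6, p7, z, e1]" using p7 z by auto
    show "{p1, p2, p3, p4, p5, p6, p7} \<in> \<B>" using B0 p7 by simp
  qed (use b1 b2 b3 p3 p5 p6 in simp_all)
qed

text \<open>One more block \<open>c\<close>, through \<open>p2\<close>, \<open>p4\<close>,
  \<open>p7\<close>, \<open>z\<close>, has a third point in common with each of \<open>b1\<close>
  and \<open>b2\<close>; these become \<open>e2\<close> and \<open>e3\<close>. It avoids
  \<open>e1\<close> because it already shares \<open>p2\<close>, \<open>p4\<close>, \<open>z\<close>
  with \<open>b3\<close>. The seventh points of \<open>b1\<close>, \<open>b2\<close>,
  \<open>c\<close> are the pairwise sums.\<close>

lemma labelled_blocks_14:
  obtains p1 p2 p3 p4 p5 p6 p7 z e1 e2 f12 e3 f13 f23 b3 where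
    "distinct [p1, p2, p3, p4, p5, p6, p7, z, e1, e2, f12, e3, f13, f23]"
    "{p1, p2, p3, p4, p5, p6, p7} \<in> \<B>" "{p1, p2, p3, z, e1, e2, f12} \<in> \<B>"
    "{p1, p4, p5, z, e1, e3, f13} \<in> \<B>" "{p2, p4, p7, z, e2, e3, f23} \<in> \<B>"
    "b3 \<in> \<B>" "{p2, p4, p6, z, e1} \<subseteq> b3"
proof -
  obtain p1 p2 p3 p4 p5 p6 p7 z e1 b1 b2 b3 where
    D: "distinct [p1, p2, p3, p4, p5, p6, p7, z, e1]" and
    B0: "{p1, p2, p3, p4, p5, p6, p7} \<in> \<B>" and b: "b1 \<in> \<B>" "b2 \<in> \<B>" "b3 \<in> \<B>"
    and bs: "{p1, p2, p3, z, e1} \<subseteq> b1" "{p1, p4, p5, z, e1} \<subseteq> b2" "{p2, p4, p6, z, e1} \<subseteq> b3"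
    using labelled_start .
  let ?B0 = "{p1, p2, p3, p4, p5, p6, p7}"
  have b0: "x = p1 \<or> x = p2 \<or> x = p3" if "x \<in> b1" "x \<in> ?B0" for x
    using meet3[OF b(1) B0, of z p1 p2 p3 x] D bs that by auto
  have b1: "x = p1 \<or> x = p4 \<or> x = p5" if "x \<in> b2" "x \<in> ?B0" for x
    using meet3[OF b(2) B0, of z p1 p4 p5 x] D bs that by auto
  have b2: "x = p2 \<or> x = p4 \<or> x = p6" if "x \<in> b3" "x \<in> ?B0" for x
    using meet3[OF b(3) B0, of z p2 p4 p6 x] D bs that by auto
  have p4: "p4 \<notin> b1" using b0[of p4] D by auto
  have b12: "x = p1 \<or> x = z \<or> x = e1" if "x \<in> b2" "x \<in> b1" for x
    using meet3[OF b(2,1), of p4 p1 z e1 x] D bs p4 that by auto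
  have "distinct [p2, p4, p7, z]" using D by simp
  from block_through[OF this] obtain c where c: "c \<in> \<B>" "p2 \<in> c" "p4 \<in> c" "p7 \<in> c" "z \<in> c" .
  have c0: "x = p2 \<or> x = p4 \<or> x = p7" if "x \<in> c" "x \<in> ?B0" for x
    using meet3[OF c(1) B0, of z p2 p4 p7 x] D c that by auto
  have p7: "p7 \<notin> b3" "p7 \<notin> b1" "p7 \<notin> b2" using b0[of p7] b1[of p7] b2[of p7] D by auto
  have c3: "x = p2 \<or> x = p4 \<or> x = z" if "x \<in> c" "x \<in> b3" for x
    using meet3[OF c(1) b(3), of p7 p2 p4 z x] D bs c p7 that by auto
  have e1: "e1 \<notin> c" using c3[of e1] bs D by auto
  have ne: "p2 \<noteq> z" "p4 \<noteq> z" using D by auto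
  have m: "p2 \<in> b1" "z \<in> b1" "p4 \<in> b2" "z \<in> b2" using bs by simp_all
  from third_point[OF c(1) b(1) c(4) p7(2) ne(1) c(2,5) m(1,2)]
  obtain e2 where e2: "e2 \<in> c" "e2 \<in> b1" "e2 \<noteq> p2" "e2 \<noteq> z"
    and c1: "\<forall>x. x \<in> c \<longrightarrow> x \<in> b1 \<longrightarrow> x = p2 \<or> x = z \<or> x = e2" .
  from third_point[OF c(1) b(2) c(4) p7(3) ne(2) c(3,5) m(3,4)]
  obtain e3 where e3: "e3 \<in> c" "e3 \<in> b2" "e3 \<noteq> p4" "e3 \<noteq> z"
    and c2: "\<forall>x. x \<in> c \<longrightarrow> x \<in> b2 \<longrightarrow> x = p4 \<or> x = z \<or> x = e3" .
  have e2n: "e2 \<notin> ?B0" using c0[OF e2(1)] b0[OF e2(2)] e2(3) D by force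
  have e3n: "e3 \<notin> ?B0" using c0[OF e3(1)] b1[OF e3(2)] e3(3) D by force
  have e2e: "e2 \<noteq> e1" "e3 \<noteq> e1" using e1 e2(1) e3(1) by auto
  have D1: "distinct [p1, p2, p3, z, e1, e2]" and D2: "distinct [p1, p4, p5, z, e1, e3]"
    using D e2n e3n e2e e2(4) e3(4) by auto
  have "{p1, p2, p3, z, e1, e2} \<subseteq> b1" "{p1, p4, p5, z, e1, e3} \<subseteq> b2" using bs e2 e3 by simp_all
  from seventh_point[OF b(1) D1 this(1)] seventh_point[OF b(2) D2 this(2)]
  obtain f12 f13 where
    f12: "distinct [p1, p2, p3, z, e1, e2, f12]" "b1 = {p1, p2, p3, z, e1, e2, f12}" and
    f13: "distinct [p1, p4, p5, z, e1, e3, f13]" "b2 = {p1, p4, p5, z, e1, e3, f13}" by metis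
  have f12n: "f12 \<notin> ?B0" using b0[of f12] f12 by auto
  have f13n: "f13 \<notin> ?B0" using b1[of f13] f13 by auto
  have e3b: "e3 \<notin> b1" "f13 \<notin> b1" using b12[of e3] b12[of f13] f13 by auto
  have D13: "distinct [p1, p2, p3, p4, p5, p6, p7, z, e1, e2, f12, e3, f13]"
    using D f12(1) f13(1) f12n f13n e2n e3n e3b unfolding f12(2) by auto
  have "distinct [p2, p4, p7, z, e2, e3]" using D13 by auto
  moreover have "{p2, p4, p7, z, e2, e3} \<subseteq> c" using c e2 e3 by simp
  ultimately obtain f23 where
    f23: "distinct [p2, p4, p7, z, e2, e3, f23]" "c = {p2, p4, p7, z, e2, e3, f23}"
    by (rule seventh_point[OF c(1)])
  have f23n: "f23 \<notin> ?B0" "f23 \<notin> b1" "f23 \<notin> b2" using c0[of f23] c1 c2 f23 by auto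
  have "distinct [p1, p2, p3, p4, p5, p6, p7, z, e1, e2, f12, e3, f13, f23]"
    using D13 f23n unfolding f12(2) f13(2) by auto
  then show thesis by (rule that) (use B0 b bs c f12 f13 f23 in simp_all)
qed

lemma sym_diff_list_block:
  assumes "set xs \<in> \<B>" "set ys \<in> \<B>" "set zs \<in> \<B>"
    "sym_diff_list (sym_diff_list xs ys) zs = ws" "length ws \<le> 7"
  shows "set ws \<in> \<B>"
proof (rule sym_diff_block[OF assms(1-3)])
  show "set ws = sym_diff (sym_diff (set xs) (set ys)) (set zs)"
    unfolding assms(4)[symmetric] sym_diff_list_def by auto
  show "card (set ws) \<le> 7" using card_length[of ws] assms(5) by linarith
qed

text \<open>The seventh point of \<open>c\<close> lies in none of the blocks in \<open>YS\<close>: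
  each meets the six known points oddly already, and one more common point would make the
  intersection even.\<close>

lemma extend_labelling:
  assumes c: "c \<in> \<B>" and xs: "length xs = 6" "set xs \<subseteq> c" "distinct xs"
    and YS: "\<forall>ys\<in>set YS. set ys \<in> \<B> \<and> distinct ys \<and> odd (length (filter (\<lambda>y. y \<in> set xs) ys))"
    and L: "distinct L" "set L \<subseteq> set (concat YS) \<union> set xs"
  obtains x where "set (xs @ [x]) \<in> \<B>" "distinct (L @ [x])"
proof -
  have "card (c - set xs) = 1"
    using xs block_card[OF c] by (simp add: card_Diff_subset distinct_card)
  then obtain x where x: "c - set xs = {x}" using card_1_singletonE by blast
  then have c': "c = set (xs @ [x])" and nx: "x \<notin> set xs" using xs(2) by auto
  have "x \<notin> set ys" if "ys \<in> set YS" for ys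
  proof
    assume "x \<in> set ys"
    have ys: "set ys \<in> \<B>" "distinct ys" "odd (length (filter (\<lambda>y. y \<in> set xs) ys))"
      using YS that by auto
    have "length (filter (\<lambda>y. y \<in> set xs) ys) = card (set ys \<inter> set xs)"
      using ys(2) by (metis distinct_card distinct_filter set_filter Int_def)
    moreover have "set ys \<inter> c = insert x (set ys \<inter> set xs)" using \<open>x \<in> set ys\<close> c' by auto
    ultimately have "even (card (set ys \<inter> c))" using ys(3) nx by simp
    then show False using odd_meet[OF ys(1) c] by simp
  qed
  then have "x \<notin> set L" using L(2) nx by auto
  then show thesis using that[of x] c c' L(1) by simp
qed

text \<open>A block through four labelled points is pinned down by the blocks known so far: three
  known common points exclude all others, and parity forces the last undecided point in. The label
  \<open>e4\<close> goes to the third common point of \<open>b3\<close> and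
  \<open>c2\<close>.\<close>

lemma labelled_blocks_18:
  obtains p1 p2 p3 p4 p5 p6 p7 z e1 e2 f12 e3 f13 f23 e4 f14 f24 f34 where
    "distinct [p1, p2, p3, p4, p5, p6, p7, z, e1, e2, f12, e3, f13, f23, e4, f14, f24, f34]"
    "set [p1, p2, p3, p4, p5, p6, p7] \<in> \<B>" "set [p1, p2, p3, z, e1, e2, f12] \<in> \<B>"
    "set [p1, p4, p5, z, e1, e3, f13] \<in> \<B>" "set [p2, p4, p6, z, e1, e4, f14] \<in> \<B>"
    "set [p2, p4, p7, z, e2, e3, f23] \<in> \<B>" "set [p3, p6, p7, z, e2, e4, f24] \<in> \<B>"
    "set [p2, p3, p5, z, e3, e4, f34] \<in> \<B>"
proof -
  obtain p1 p2 p3 p4 p5 p6 p7 z e1 e2 f12 e3 f13 f23 b3 where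
    D: "distinct [p1, p2, p3, p4, p5, p6, p7, z, e1, e2, f12, e3, f13, f23]" and
    B: "{p1, p2, p3, p4, p5, p6, p7} \<in> \<B>" "{p1, p2, p3, z, e1, e2, f12} \<in> \<B>"
    "{p1, p4, p5, z, e1, e3, f13} \<in> \<B>" "{p2, p4, p7, z, e2, e3, f23} \<in> \<B>" and
    b3: "b3 \<in> \<B>" "{p2, p4, p6, z, e1} \<subseteq> b3"
    using labelled_blocks_14 .
  note N [simp] = D[simplified] D[THEN distinct_rev[THEN iffD2], unfolded rev.simps append.simps, simplified]
  have B0: "set [p1, p2, p3, p4, p5, p6, p7] \<in> \<B>" and b1: "set [p1, p2, p3, z, e1, e2, f12] \<in> \<B>"
    and b2: "set [p1, p4, p5, z, e1, e3, f13] \<in> \<B>" and c1: "set [p2, p4, p7, z, e2, e3, f23] \<in> \<B>"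
    using B by simp_all
  \<comment> \<open>Two sums with \<open>B0\<close> lead to the block of \<open>d4\<close>, the sum
    of those of \<open>b1\<close>, \<open>b2\<close>, \<open>c1\<close>. Its affine plane consists
    of \<open>z\<close>, \<open>f12\<close>, \<open>f13\<close>, \<open>f23\<close>.\<close>
  have d1: "set [p3, p6, e1, f13, p4, e2, f23] \<in> \<B>"
    by (rule sym_diff_list_block[OF B0 b2 c1]) (simp_all add: sym_diff_list_def N)
  have d4: "set [p5, p7, z, f12, p3, f13, f23] \<in> \<B>"
    by (rule sym_diff_list_block[OF B0 b1 d1]) (simp_all add: sym_diff_list_def N)
  have b3m: "p2 \<in> b3" "p4 \<in> b3" "p6 \<in> b3" "z \<in> b3" "e1 \<in> b3" using b3(2) by simp_all
  have "distinct [p3, p6, p7, z]" by (simp add: N)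
  from block_through[OF this] obtain c2 where
    c2: "c2 \<in> \<B>" "p3 \<in> c2" "p6 \<in> c2" "p7 \<in> c2" "z \<in> c2" .
  have n0: "p1 \<notin> c2 \<and> p2 \<notin> c2 \<and> p4 \<notin> c2 \<and> p5 \<notin> c2"
    using meet3_list[OF B0 c2(1), of z p3 p6 p7] c2 by (simp add: N)
  have n4: "f12 \<notin> c2 \<and> f13 \<notin> c2 \<and> f23 \<notin> c2"
    using meet3_list[OF d4 c2(1), of p6 p3 p7 z] c2 by (simp add: N)
  \<comment> \<open>If \<open>e1\<close> were in \<open>c2\<close>, parity against the block of
    \<open>b2\<close> would add \<open>e3\<close>. Then this block, the first block and
    \<open>c2\<close> would meet pairwise in three points without a common one.\<close>
  have n1: "e1 \<notin> c2"
  proof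
    assume e1: "e1 \<in> c2"
    have e3: "e3 \<in> c2"
      by (rule ccontr) (use block_parity[OF b2 _ c2(1)] in \<open>simp add: N n0 n4 e1 c2\<close>)
    have "card (set [p1, p2, p3, p4, p5, p6, p7] \<inter> set [p1, p4, p5, z, e1, e3, f13]) = 3"
      "card (set [p1, p2, p3, p4, p5, p6, p7] \<inter> c2) = 3"
      "card (set [p1, p4, p5, z, e1, e3, f13] \<inter> c2) = 3"
      using c2 n0 n4 e1 e3 by (simp_all add: N)
    from three_blocks_common_point[OF B0 b2 c2(1) this] show False
      using n0 by (auto simp: N)
  qed
  \<comment> \<open>Otherwise \<open>c2\<close> would meet the block of \<open>b1\<close> only in
    \<open>p3\<close> and \<open>z\<close>, an even number of points.\<close>
  have e2: "e2 \<in> c2"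
    by (rule ccontr) (use block_parity[OF b1 _ c2(1)] in \<open>simp add: N n0 n4 n1 c2\<close>)
  have n3: "e3 \<notin> c2"
    using meet3_list[OF c1 c2(1), of p6 p7 z e2] c2 e2 by (simp add: N)
  obtain e4 where e4: "e4 \<in> b3" "e4 \<in> c2" "e4 \<noteq> p6" "e4 \<noteq> z"
    using third_point[OF b3(1) c2(1) b3m(1) _ _ b3m(3,4) c2(3,5)] n0 N by blast
  have e4n: "e4 \<notin> set [p1, p2, p3, p4, p5, p6, p7]"
    using meet3_list[OF B0 b3(1), of z p2 p4 p6] b3m e4 n0 by (auto simp: N)
  have e4b1: "e4 \<notin> set [p1, p2, p3, z, e1, e2, f12]"
    using meet3_list[OF b1 b3(1), of p4 p2 z e1] b3m e4 n0 n1 by (auto simp: N)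
  have e4b2: "e4 \<notin> set [p1, p4, p5, z, e1, e3, f13]"
    using meet3_list[OF b2 b3(1), of p2 p4 z e1] b3m e4 n0 n1 by (auto simp: N)
  have e4c1: "e4 \<notin> set [p2, p4, p7, z, e2, e3, f23]"
    using meet3_list[OF c1 b3(1), of p6 p2 p4 z] b3m e4 n0 by (auto simp: N)
  have D15: "distinct [p1, p2, p3, p4, p5, p6, p7, z, e1, e2, f12, e3, f13, f23, e4]"
    using D e4n e4b1 e4b2 e4c1 by auto
  note [simp] = D15[simplified]
    D15[THEN distinct_rev[THEN iffD2], unfolded rev.simps append.simps, simplified]
  obtain f14 where b3': "set ([p2, p4, p6, z, e1, e4] @ [f14]) \<in> \<B>" and
    D16: "distinct ([p1, p2, p3, p4, p5, p6, p7, z, e1, e2, f12, e3, f13, f23, e4] @ [f14])"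
    by (rule extend_labelling[OF b3(1), of "[p2, p4, p6, z, e1, e4]"
          "[[p1, p2, p3, p4, p5, p6, p7], [p1, p2, p3, z, e1, e2, f12],
            [p1, p4, p5, z, e1, e3, f13], [p2, p4, p7, z, e2, e3, f23]]"
          "[p1, p2, p3, p4, p5, p6, p7, z, e1, e2, f12, e3, f13, f23, e4]"])
       (use b3m e4 B in simp_all)
  note [simp] = D16[unfolded append.simps, simplified]
    D16[THEN distinct_rev[THEN iffD2], unfolded rev.simps append.simps, simplified]
  have b3s: "set [p2, p4, p6, z, e1, e4, f14] \<in> \<B>" using b3' by simp
  obtain f24 where c2': "set ([p3, p6, p7, z, e2, e4] @ [f24]) \<in> \<B>" and
    D17: "distinct ([p1, p2, p3, p4, p5, p6, p7, z, e1, e2, f12, e3, f13, f23, e4, f14] @ [f24])"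
    by (rule extend_labelling[OF c2(1), of "[p3, p6, p7, z, e2, e4]"
          "[[p1, p2, p3, p4, p5, p6, p7], [p1, p2, p3, z, e1, e2, f12], [p1, p4, p5, z, e1, e3, f13],
            [p2, p4, p7, z, e2, e3, f23], [p2, p4, p6, z, e1, e4, f14]]"
          "[p1, p2, p3, p4, p5, p6, p7, z, e1, e2, f12, e3, f13, f23, e4, f14]"])
       (use c2 e2 e4 B b3s in simp_all)
  note [simp] = D17[unfolded append.simps, simplified]
    D17[THEN distinct_rev[THEN iffD2], unfolded rev.simps append.simps, simplified]
  have c2s: "set [p3, p6, p7, z, e2, e4, f24] \<in> \<B>" using c2' by simp
  \<comment> \<open>As for \<open>d4\<close>, two sums with the first block produce the plane of
    \<open>z\<close>, \<open>f12\<close>, \<open>f14\<close>, \<open>f24\<close> in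
    \<open>d5\<close>.\<close>
  have d6: "set [p4, p5, e1, f12, p3, e4, f24] \<in> \<B>"
    by (rule sym_diff_list_block[OF B0 b1 c2s]) (simp_all add: sym_diff_list_def)
  have d5: "set [p1, p7, z, f14, p4, f12, f24] \<in> \<B>"
    by (rule sym_diff_list_block[OF B0 b3s d6]) (simp_all add: sym_diff_list_def)
  have "distinct [p2, p3, p5, z]" by simp
  from block_through[OF this] obtain c3 where
    c3: "c3 \<in> \<B>" "p2 \<in> c3" "p3 \<in> c3" "p5 \<in> c3" "z \<in> c3" .
  have n0: "p1 \<notin> c3 \<and> p4 \<notin> c3 \<and> p6 \<notin> c3 \<and> p7 \<notin> c3"
    using meet3_list[OF B0 c3(1), of z p2 p3 p5] c3 by simp
  have n1: "e1 \<notin> c3 \<and> e2 \<notin> c3 \<and> f12 \<notin> c3"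
    using meet3_list[OF b1 c3(1), of p5 p2 p3 z] c3 by simp
  have n4: "f13 \<notin> c3 \<and> f23 \<notin> c3"
    using meet3_list[OF d4 c3(1), of p2 p3 p5 z] c3 by simp
  have e3: "e3 \<in> c3"
    by (rule ccontr) (use block_parity[OF b2 _ c3(1)] in \<open>simp add: n0 n1 n4 c3\<close>)
  \<comment> \<open>Otherwise parity puts \<open>f14\<close> and \<open>f24\<close> into
    \<open>c3\<close>, and the first block, the block of \<open>d5\<close> and \<open>c3\<close>
    meet pairwise in threes without a common point.\<close>
  have e4': "e4 \<in> c3"
  proof (rule ccontr)
    assume e4: "e4 \<notin> c3"
    have f14: "f14 \<in> c3"
      by (rule ccontr) (use block_parity[OF b3s _ c3(1)] in \<open>simp add: n0 n1 e4 c3\<close>)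
    have f24: "f24 \<in> c3"
      by (rule ccontr) (use block_parity[OF c2s _ c3(1)] in \<open>simp add: n0 n1 e4 c3\<close>)
    have "card (set [p1, p2, p3, p4, p5, p6, p7] \<inter> set [p1, p7, z, f14, p4, f12, f24]) = 3"
      "card (set [p1, p2, p3, p4, p5, p6, p7] \<inter> c3) = 3"
      "card (set [p1, p7, z, f14, p4, f12, f24] \<inter> c3) = 3"
      using c3 n0 n1 f14 f24 by simp_all
    from three_blocks_common_point[OF B0 d5 c3(1) this] show False using n0 by auto
  qed
  obtain f34 where c3': "set ([p2, p3, p5, z, e3, e4] @ [f34]) \<in> \<B>" and
    D18: "distinct ([p1, p2, p3, p4, p5, p6, p7, z, e1, e2, f12, e3, f13, f23, e4, f14, f24] @ [f34])"
    by (rule extend_labelling[OF c3(1), of "[p2, p3, p5, z, e3, e4]"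
          "[[p1, p2, p3, p4, p5, p6, p7], [p1, p2, p3, z, e1, e2, f12], [p1, p4, p5, z, e1, e3, f13],
            [p2, p4, p7, z, e2, e3, f23], [p2, p4, p6, z, e1, e4, f14], [p3, p6, p7, z, e2, e4, f24]]"
          "[p1, p2, p3, p4, p5, p6, p7, z, e1, e2, f12, e3, f13, f23, e4, f14, f24]"])
       (use c3 e3 e4' B b3s c2s in simp_all)
  show thesis
    by (rule that[OF D18[unfolded append.simps] B0 b1 b2 b3s c1 c2s c3'[unfolded append.simps]])
qed

text \<open>The plane of \<open>e1\<close>, \<open>e2\<close>, \<open>e3\<close>,
  \<open>g123\<close> is parallel to that of \<open>z\<close>, \<open>f12\<close>,
  \<open>f13\<close>, \<open>f23\<close> and carries the same triple of the first block; likewise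
  for the other \<open>g\<close>. The last block carries the plane of \<open>z\<close>,
  \<open>e1\<close>, \<open>g234\<close>, \<open>h\<close>.\<close>

lemma labelled_blocks:
  obtains p1 p2 p3 p4 p5 p6 p7 z e1 e2 f12 e3 f13 f23 e4 f14 f24 f34 g123 g124 g134 g234 h where
    "distinct [p1, p2, p3, p4, p5, p6, p7, z, e1, e2, f12, e3, f13, f23, e4, f14, f24, f34,
       g123, g124, g134, g234, h]"
    "set [p1, p2, p3, p4, p5, p6, p7] \<in> \<B>" "set [p1, p2, p3, z, e1, e2, f12] \<in> \<B>"
    "set [p1, p4, p5, z, e1, e3, f13] \<in> \<B>" "set [p2, p4, p6, z, e1, e4, f14] \<in> \<B>"
    "set [p2, p4, p7, z, e2, e3, f23] \<in> \<B>" "set [p3, p6, p7, z, e2, e4, f24] \<in> \<B>"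
    "set [p2, p3, p5, z, e3, e4, f34] \<in> \<B>" "set [p3, p5, p7, e1, e2, e3, g123] \<in> \<B>"
    "set [p1, p4, p7, e1, e2, e4, g124] \<in> \<B>" "set [p1, p3, p6, e1, e3, e4, g134] \<in> \<B>"
    "set [p4, p5, p6, e2, e3, e4, g234] \<in> \<B>" "set [p3, p5, p6, z, e1, g234, h] \<in> \<B>"
proof -
  obtain p1 p2 p3 p4 p5 p6 p7 z e1 e2 f12 e3 f13 f23 e4 f14 f24 f34 where
    D18: "distinct [p1, p2, p3, p4, p5, p6, p7, z, e1, e2, f12, e3, f13, f23, e4, f14, f24, f34]" and
    b: "set [p1, p2, p3, p4, p5, p6, p7] \<in> \<B>" "set [p1, p2, p3, z, e1, e2, f12] \<in> \<B>"
    "set [p1, p4, p5, z, e1, e3, f13] \<in> \<B>" "set [p2, p4, p6, z, e1, e4, f14] \<in> \<B>"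
    "set [p2, p4, p7, z, e2, e3, f23] \<in> \<B>" "set [p3, p6, p7, z, e2, e4, f24] \<in> \<B>"
    "set [p2, p3, p5, z, e3, e4, f34] \<in> \<B>"
    using labelled_blocks_18 .
  let ?B = "[[p1, p2, p3, p4, p5, p6, p7], [p1, p2, p3, z, e1, e2, f12],
    [p1, p4, p5, z, e1, e3, f13], [p2, p4, p6, z, e1, e4, f14], [p2, p4, p7, z, e2, e3, f23],
    [p3, p6, p7, z, e2, e4, f24], [p2, p3, p5, z, e3, e4, f34]]"
  note [simp] = D18[simplified]
    D18[THEN distinct_rev[THEN iffD2], unfolded rev.simps append.simps, simplified]
  \<comment> \<open>Sums of three blocks through \<open>z\<close>, each formed in two steps with the
    first block, give the planes of \<open>z\<close> and three pairwise sums.\<close>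
  have d: "set [p3, p6, e1, f13, p4, e2, f23] \<in> \<B>"
    by (rule sym_diff_list_block[OF b(1) b(3) b(5)]) (simp_all add: sym_diff_list_def)
  have d123: "set [p5, p7, z, f12, p3, f13, f23] \<in> \<B>"
    by (rule sym_diff_list_block[OF b(1) b(2) d]) (simp_all add: sym_diff_list_def)
  have d: "set [p4, p5, e1, f12, p3, e4, f24] \<in> \<B>"
    by (rule sym_diff_list_block[OF b(1) b(2) b(6)]) (simp_all add: sym_diff_list_def)
  have d124: "set [p1, p7, z, f14, p4, f12, f24] \<in> \<B>"
    by (rule sym_diff_list_block[OF b(1) b(4) d]) (simp_all add: sym_diff_list_def)
  have d: "set [p1, p7, e1, f14, p2, e3, f34] \<in> \<B>"
    by (rule sym_diff_list_block[OF b(1) b(4) b(7)]) (simp_all add: sym_diff_list_def)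
  have d134: "set [p3, p6, z, f13, p1, f14, f34] \<in> \<B>"
    by (rule sym_diff_list_block[OF b(1) b(3) d]) (simp_all add: sym_diff_list_def)
  have d: "set [p1, p4, e2, f24, p3, e3, f34] \<in> \<B>"
    by (rule sym_diff_list_block[OF b(1) b(6) b(7)]) (simp_all add: sym_diff_list_def)
  have d234: "set [p5, p6, z, f23, p4, f24, f34] \<in> \<B>"
    by (rule sym_diff_list_block[OF b(1) b(5) d]) (simp_all add: sym_diff_list_def)

  \<comment> \<open>The block through this triple and \<open>e1\<close> shares only the triple with
    the block of \<open>d123\<close>; parity then puts \<open>e2\<close> and \<open>e3\<close> into
    it. The next three paragraphs follow this pattern with other indices.\<close>
  have "distinct [p3, p5, p7, e1]" by simp
  from block_through[OF this] obtain c where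
    c: "c \<in> \<B>" "p3 \<in> c" "p5 \<in> c" "p7 \<in> c" "e1 \<in> c" .
  have n: "p1 \<notin> c \<and> p2 \<notin> c \<and> p4 \<notin> c \<and> p6 \<notin> c"
    using meet3_list[OF b(1) c(1), of e1 p3 p5 p7] c by simp
  have n': "z \<notin> c \<and> f12 \<notin> c \<and> f13 \<notin> c \<and> f23 \<notin> c"
    using meet3_list[OF d123 c(1), of e1 p3 p5 p7] c by simp
  have e2: "e2 \<in> c"
    by (rule ccontr) (use block_parity[OF b(2) _ c(1)] in \<open>simp add: n n' c\<close>)
  have e3: "e3 \<in> c"
    by (rule ccontr) (use block_parity[OF b(3) _ c(1)] in \<open>simp add: n n' c\<close>)
  obtain g123 where k1': "set ([p3, p5, p7, e1, e2, e3] @ [g123]) \<in> \<B>" and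
        D: "distinct ([p1, p2, p3, p4, p5, p6, p7, z, e1, e2, f12, e3, f13, f23, e4, f14, f24,
          f34] @ [g123])"
    by (rule extend_labelling[OF c(1), of "[p3, p5, p7, e1, e2, e3]" ?B
          "[p1, p2, p3, p4, p5, p6, p7, z, e1, e2, f12, e3, f13, f23, e4, f14, f24, f34]"])
       (use c e2 e3 b  in simp_all)
  have k1: "set [p3, p5, p7, e1, e2, e3, g123] \<in> \<B>" using k1' by simp
  note [simp] = D[unfolded append.simps, simplified]
    D[THEN distinct_rev[THEN iffD2], unfolded rev.simps append.simps, simplified]

  have "distinct [p1, p4, p7, e1]" by simp
  from block_through[OF this] obtain c where
    c: "c \<in> \<B>" "p1 \<in> c" "p4 \<in> c" "p7 \<in> c" "e1 \<in> c" .
  have n: "p2 \<notin> c \<and> p3 \<notin> c \<and> p5 \<notin> c \<and> p6 \<notin> c"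
    using meet3_list[OF b(1) c(1), of e1 p1 p4 p7] c by simp
  have n': "z \<notin> c \<and> f14 \<notin> c \<and> f12 \<notin> c \<and> f24 \<notin> c"
    using meet3_list[OF d124 c(1), of e1 p1 p4 p7] c by simp
  have e2: "e2 \<in> c"
    by (rule ccontr) (use block_parity[OF b(2) _ c(1)] in \<open>simp add: n n' c\<close>)
  have e4: "e4 \<in> c"
    by (rule ccontr) (use block_parity[OF b(4) _ c(1)] in \<open>simp add: n n' c\<close>)
  obtain g124 where k2': "set ([p1, p4, p7, e1, e2, e4] @ [g124]) \<in> \<B>" and
        D: "distinct ([p1, p2, p3, p4, p5, p6, p7, z, e1, e2, f12, e3, f13, f23, e4, f14, f24,
          f34, g123] @ [g124])"
        by (rule extend_labelling[OF c(1), of "[p1, p4, p7, e1, e2, e4]" "?B @ [[p3, p5, p7, e1,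
          e2, e3, g123]]"
          "[p1, p2, p3, p4, p5, p6, p7, z, e1, e2, f12, e3, f13, f23, e4, f14, f24, f34, g123]"])
       (use c e2 e4 b k1 in simp_all)
  have k2: "set [p1, p4, p7, e1, e2, e4, g124] \<in> \<B>" using k2' by simp
  note [simp] = D[unfolded append.simps, simplified]
    D[THEN distinct_rev[THEN iffD2], unfolded rev.simps append.simps, simplified]

  have "distinct [p1, p3, p6, e1]" by simp
  from block_through[OF this] obtain c where
    c: "c \<in> \<B>" "p1 \<in> c" "p3 \<in> c" "p6 \<in> c" "e1 \<in> c" .
  have n: "p2 \<notin> c \<and> p4 \<notin> c \<and> p5 \<notin> c \<and> p7 \<notin> c"
    using meet3_list[OF b(1) c(1), of e1 p1 p3 p6] c by simp
  have n': "z \<notin> c \<and> f13 \<notin> c \<and> f14 \<notin> c \<and> f34 \<notin> c"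
    using meet3_list[OF d134 c(1), of e1 p1 p3 p6] c by simp
  have e3: "e3 \<in> c"
    by (rule ccontr) (use block_parity[OF b(3) _ c(1)] in \<open>simp add: n n' c\<close>)
  have e4: "e4 \<in> c"
    by (rule ccontr) (use block_parity[OF b(4) _ c(1)] in \<open>simp add: n n' c\<close>)
  obtain g134 where k3': "set ([p1, p3, p6, e1, e3, e4] @ [g134]) \<in> \<B>" and
        D: "distinct ([p1, p2, p3, p4, p5, p6, p7, z, e1, e2, f12, e3, f13, f23, e4, f14, f24,
          f34, g123, g124] @ [g134])"
        by (rule extend_labelling[OF c(1), of "[p1, p3, p6, e1, e3, e4]" "?B @ [[p3, p5, p7, e1,
          e2, e3, g123], [p1, p4, p7, e1, e2, e4, g124]]"
                    "[p1, p2, p3, p4, p5, p6, p7, z, e1, e2, f12, e3, f13, f23, e4, f14, f24, f34,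
                g123, g124]"])
       (use c e3 e4 b k1 k2 in simp_all)
  have k3: "set [p1, p3, p6, e1, e3, e4, g134] \<in> \<B>" using k3' by simp
  note [simp] = D[unfolded append.simps, simplified]
    D[THEN distinct_rev[THEN iffD2], unfolded rev.simps append.simps, simplified]

  have "distinct [p4, p5, p6, e2]" by simp
  from block_through[OF this] obtain c where
    c: "c \<in> \<B>" "p4 \<in> c" "p5 \<in> c" "p6 \<in> c" "e2 \<in> c" .
  have n: "p1 \<notin> c \<and> p2 \<notin> c \<and> p3 \<notin> c \<and> p7 \<notin> c"
    using meet3_list[OF b(1) c(1), of e2 p4 p5 p6] c by simp
  have n': "z \<notin> c \<and> f23 \<notin> c \<and> f24 \<notin> c \<and> f34 \<notin> c"
    using meet3_list[OF d234 c(1), of e2 p4 p5 p6] c by simp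
  have e3: "e3 \<in> c"
    by (rule ccontr) (use block_parity[OF b(5) _ c(1)] in \<open>simp add: n n' c\<close>)
  have e4: "e4 \<in> c"
    by (rule ccontr) (use block_parity[OF b(6) _ c(1)] in \<open>simp add: n n' c\<close>)
  obtain g234 where k4': "set ([p4, p5, p6, e2, e3, e4] @ [g234]) \<in> \<B>" and
        D: "distinct ([p1, p2, p3, p4, p5, p6, p7, z, e1, e2, f12, e3, f13, f23, e4, f14, f24,
          f34, g123, g124, g134] @ [g234])"
        by (rule extend_labelling[OF c(1), of "[p4, p5, p6, e2, e3, e4]" "?B @ [[p3, p5, p7, e1,
          e2, e3, g123], [p1, p4, p7, e1, e2, e4, g124], [p1, p3, p6, e1, e3, e4, g134]]"
                    "[p1, p2, p3, p4, p5, p6, p7, z, e1, e2, f12, e3, f13, f23, e4, f14, f24, f34,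
                g123, g124, g134]"])
       (use c e3 e4 b k1 k2 k3 in simp_all)
  have k4: "set [p4, p5, p6, e2, e3, e4, g234] \<in> \<B>" using k4' by simp
  note [simp] = D[unfolded append.simps, simplified]
    D[THEN distinct_rev[THEN iffD2], unfolded rev.simps append.simps, simplified]

  have "distinct [p3, p5, p6, e1]" by simp
  from block_through[OF this] obtain c where
    c: "c \<in> \<B>" "p3 \<in> c" "p5 \<in> c" "p6 \<in> c" "e1 \<in> c" .
  have n: "p1 \<notin> c \<and> p2 \<notin> c \<and> p4 \<notin> c \<and> p7 \<notin> c"
    using meet3_list[OF b(1) c(1), of e1 p3 p5 p6] c by simp
  have n1: "e2 \<notin> c \<and> e3 \<notin> c"
    using meet3_list[OF k1 c(1), of p6 p3 p5 e1] c by simp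
  have n2: "e4 \<notin> c"
    using meet3_list[OF k3 c(1), of p5 p3 p6 e1] c by simp
  have g234: "g234 \<in> c"
    by (rule ccontr) (use block_parity[OF k4 _ c(1)] in \<open>simp add: n n1 n2 c\<close>)
  \<comment> \<open>Without \<open>z\<close>, parity would force \<open>f12\<close> and
    \<open>f13\<close> into \<open>c\<close>, which would then share four points with the different
    block of \<open>d123\<close>.\<close>
  have z: "z \<in> c"
  proof (rule ccontr)
    assume z: "z \<notin> c"
    have f12: "f12 \<in> c"
      by (rule ccontr) (use block_parity[OF b(2) _ c(1)] in \<open>simp add: n n1 z c\<close>)
    have f13: "f13 \<in> c"
      by (rule ccontr) (use block_parity[OF b(3) _ c(1)] in \<open>simp add: n n1 z c\<close>)
    show False using meet3_list[OF d123 c(1), of p6 p3 p5 f12] c f12 f13 by simp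
  qed
  obtain h where k5': "set ([p3, p5, p6, z, e1, g234] @ [h]) \<in> \<B>" and
        D: "distinct ([p1, p2, p3, p4, p5, p6, p7, z, e1, e2, f12, e3, f13, f23, e4, f14, f24,
          f34, g123, g124, g134, g234] @ [h])"
        by (rule extend_labelling[OF c(1), of "[p3, p5, p6, z, e1, g234]" "?B @ [[p3, p5, p7, e1,
          e2, e3, g123], [p1, p4, p7, e1, e2, e4, g124], [p1, p3, p6, e1, e3, e4, g134], [p4, p5,
          p6, e2, e3, e4, g234]]"
                    "[p1, p2, p3, p4, p5, p6, p7, z, e1, e2, f12, e3, f13, f23, e4, f14, f24, f34,
                g123, g124, g134, g234]"])
       (use c z g234 b k1 k2 k3 k4 in simp_all)
  have k5: "set [p3, p5, p6, z, e1, g234, h] \<in> \<B>" using k5' by simp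
  show thesis
    by (rule that[OF D[unfolded append.simps] b k1 k2 k3 k4 k5])
qed

end

section \<open>Enumerating the blocks as binary words\<close>

fun xor_word :: "bool list \<Rightarrow> bool list \<Rightarrow> bool list" where
  "xor_word (a # as) (b # bs) = (if b then \<not> a else a) # xor_word as bs"
| "xor_word _ _ = []"

fun has_weight :: "nat \<Rightarrow> bool list \<Rightarrow> bool" where
  "has_weight n [] = (n = 0)"
| "has_weight n (False # w) = has_weight n w"
| "has_weight 0 (True # w) = False"
| "has_weight (Suc n) (True # w) = has_weight n w"

text \<open>The recursion runs over all subfamilies of the generators; \<open>w\<close> is the sum
  so far and \<open>p\<close> tells whether an odd number of them has been used. Such odd sums meet
  every block oddly, so weight 7 makes them blocks.\<close>

fun odd_sums :: "bool \<Rightarrow> bool list \<Rightarrow> bool list list \<Rightarrow> bool list list" where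
  "odd_sums p w [] = (if p \<and> has_weight 7 w then [w] else [])"
| "odd_sums p w (g # gs) = odd_sums p w gs @ odd_sums (\<not> p) (xor_word w g) gs"

text \<open>Comparing all pairs of words by rewriting, as \<open>distinct\<close> does, would be too slow.\<close>

fun trie_distinct :: "nat \<Rightarrow> bool list list \<Rightarrow> bool" where
  "trie_distinct n [] = True"
| "trie_distinct n [w] = True"
| "trie_distinct 0 ws = False"
| "trie_distinct (Suc n) ws =
     (trie_distinct n (map tl (filter hd ws)) \<and> trie_distinct n (map tl (filter (Not \<circ> hd) ws)))"

text \<open>The blocks of \<open>labelled_blocks\<close> with its points numbered from 0 in the order listed there.\<close>

definition generators :: "nat list list" where
  "generators = [[0,1,2,3,4,5,6], [0,1,2,7,8,9,10], [0,3,4,7,8,11,12], [1,3,5,7,8,14,15],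
     [1,3,6,7,9,11,13], [2,5,6,7,9,14,16], [1,2,4,7,11,14,17], [2,4,6,8,9,11,18],
     [0,3,6,8,9,14,19], [0,2,5,8,11,14,20], [3,4,5,9,11,14,21], [2,4,5,7,8,21,22]]"

definition block_words :: "bool list list" where
  "block_words = odd_sums False (replicate 23 False)
     (map (\<lambda>g. map (\<lambda>i. i \<in> set g) [0..<23]) generators)"

text \<open>This is the number of blocks of an S(4,7,23), (23 choose 4) / (7 choose 4) = 8855 / 35,
  found among the 4096 subfamilies of the generators.\<close>

lemma length_block_words: "length block_words = 253"
  by code_simp

lemma trie_distinct_block_words: "trie_distinct 23 block_words"
  by code_simp

text \<open>The first letter separates the two halves, and within a half distinct tails imply
  distinct words.\<close>

lemma trie_distinct_imp_distinct:
  "trie_distinct n ws \<Longrightarrow> \<forall>w\<in>set ws. length w = n \<Longrightarrow> distinct ws"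
proof (induction n ws rule: trie_distinct.induct)
  case (4 n v w ws)
  define xs where "xs = v # w # ws"
  have split: "distinct (filter P xs) \<Longrightarrow> distinct (filter (Not \<circ> P) xs) \<Longrightarrow> distinct xs"
    for P and xs :: "bool list list" by (induction xs) (auto split: if_splits)
  have t: "trie_distinct n (map tl (filter hd xs))" "trie_distinct n (map tl (filter (Not \<circ> hd) xs))"
    using "4.prems"(1) unfolding xs_def by (simp_all only: trie_distinct.simps)
  have l: "\<forall>x\<in>set xs. length x = Suc n" using "4.prems"(2) unfolding xs_def .
  have "distinct (map tl (filter hd xs))"
    by (rule "4.IH"(1)[folded xs_def, OF t(1)]) (use l in auto)
  moreover have "distinct (map tl (filter (Not \<circ> hd) xs))"
    by (rule "4.IH"(2)[folded xs_def, OF t(2)]) (use l in auto)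
  ultimately have "distinct xs" using split[of hd xs] unfolding distinct_map by blast
  then show ?case unfolding xs_def .
qed simp_all

definition word_image :: "(nat \<Rightarrow> 'p) \<Rightarrow> bool list \<Rightarrow> 'p set" where
  "word_image f w = f ` {i. i < length w \<and> w ! i}"

lemma word_of_set:
  "X \<subseteq> {..<n} \<Longrightarrow> {i. i < length (map (\<lambda>i. i \<in> X) [0..<n]) \<and> map (\<lambda>i. i \<in> X) [0..<n] ! i} = X"
  by auto

lemma length_xor_word: "length w = length g \<Longrightarrow> length (xor_word w g) = length g"
  by (induction w g rule: xor_word.induct) auto

lemma nth_xor_word:
  "length w = length g \<Longrightarrow> i < length g \<Longrightarrow> xor_word w g ! i \<longleftrightarrow> w ! i \<noteq> g ! i"
  by (induction w g arbitrary: i rule: xor_word.induct) (auto simp: nth_Cons split: nat.split)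

lemma support_Cons:
  "{i. i < length (a # w) \<and> (a # w) ! i} = (if a then {0} else {}) \<union> Suc ` {i. i < length w \<and> w ! i}"
  by (auto simp: less_Suc_eq_0_disj)

lemma has_weight_iff: "has_weight n w \<longleftrightarrow> card {i. i < length w \<and> w ! i} = n"
proof (induction n w rule: has_weight.induct)
  case (2 n w)
  then show ?case unfolding support_Cons by (simp add: card_image)
next
  case (3 w)
  then show ?case unfolding support_Cons by simp
next
  case (4 n w)
  then show ?case unfolding support_Cons by (simp add: card_image card_insert_if)
qed auto

lemma word_image_xor:
  assumes "inj_on f {..<length g}" "length w = length g"
  shows "word_image f (xor_word w g) = sym_diff (word_image f w) (word_image f g)"
proof -
  have "{i. i < length g \<and> xor_word w g ! i}
      = sym_diff {i. i < length g \<and> w ! i} {i. i < length g \<and> g ! i}"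
    using nth_xor_word[OF assms(2)] by auto
  moreover have "inj_on f ({i. i < length g \<and> w ! i} \<union> {i. i < length g \<and> g ! i})"
    by (rule inj_on_subset[OF assms(1)]) auto
  ultimately show ?thesis unfolding word_image_def length_xor_word[OF assms(2)] assms(2)
    by (auto simp: inj_on_def)
qed

lemma card_word_image: "inj_on f {..<length w} \<Longrightarrow> card (word_image f w) = card {i. i < length w \<and> w ! i}"
  unfolding word_image_def by (rule card_image) (auto intro: inj_on_subset)

lemma inj_on_word_image:
  assumes "inj_on f {..<n}"
  shows "inj_on (word_image f) {w. length w = n}"
proof (rule inj_onI)
  fix v w assume "v \<in> {w. length w = n}" "w \<in> {w. length w = n}" and e: "word_image f v = word_image f w"
  then have l: "length v = n" "length w = n" by auto
  have "{i. i < n \<and> v ! i} = {i. i < n \<and> w ! i}"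
    using e unfolding word_image_def l by (subst (asm) inj_on_image_eq_iff[OF assms]) auto
  then show "v = w" using l by (intro nth_equalityI) auto
qed

context steiner_system
begin

text \<open>The invariant says that the image of \<open>w\<close> meets each block oddly exactly
  when \<open>p\<close> holds; adding a generator flips both. At the end
  \<open>odd_small_block\<close> applies.\<close>

lemma odd_sums_blocks:
  assumes f: "inj_on f {..<23}"
  shows "length w = 23 \<Longrightarrow> \<forall>g\<in>set gs. length g = 23 \<and> word_image f g \<in> \<B> \<Longrightarrow>
    \<forall>b\<in>\<B>. odd (card (word_image f w \<inter> b)) \<longleftrightarrow> p \<Longrightarrow> v \<in> set (odd_sums p w gs) \<Longrightarrow>
    length v = 23 \<and> word_image f v \<in> \<B>"
proof (induction p w gs rule: odd_sums.induct)
  case (1 p w)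
  then have "v = w" "p" "has_weight 7 w" by (auto split: if_splits)
  moreover have "card (word_image f w) = 7"
    using card_word_image[of f w] 1 f \<open>has_weight 7 w\<close> by (simp add: has_weight_iff)
  ultimately show ?case using 1 odd_small_block[of "word_image f w"] by simp
next
  case (2 p w g gs)
  have l: "length w = length g" using 2 by simp
  have x: "word_image f (xor_word w g) = sym_diff (word_image f w) (word_image f g)"
    by (rule word_image_xor) (use 2 f in auto)
  have "odd (card (word_image f (xor_word w g) \<inter> b)) \<longleftrightarrow> \<not> p" if "b \<in> \<B>" for b
    unfolding x even_card_sym_diff_Int using 2 that odd_meet by auto
  then show ?case using 2 length_xor_word[OF l] by auto
qed

lemma block_labelling:
  obtains f :: "nat \<Rightarrow> 'p" where "inj_on f {..<23}" "\<forall>g\<in>set generators. f ` set g \<in> \<B>"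
    "\<forall>w\<in>set block_words. length w = 23 \<and> word_image f w \<in> \<B>"
proof -
  obtain p1 p2 p3 p4 p5 p6 p7 z e1 e2 f12 e3 f13 f23 e4 f14 f24 f34 g123 g124 g134 g234 h where
    D: "distinct [p1, p2, p3, p4, p5, p6, p7, z, e1, e2, f12, e3, f13, f23, e4, f14, f24, f34,
       g123, g124, g134, g234, h]" and b:
    "set [p1, p2, p3, p4, p5, p6, p7] \<in> \<B>" "set [p1, p2, p3, z, e1, e2, f12] \<in> \<B>"
    "set [p1, p4, p5, z, e1, e3, f13] \<in> \<B>" "set [p2, p4, p6, z, e1, e4, f14] \<in> \<B>"
    "set [p2, p4, p7, z, e2, e3, f23] \<in> \<B>" "set [p3, p6, p7, z, e2, e4, f24] \<in> \<B>"
    "set [p2, p3, p5, z, e3, e4, f34] \<in> \<B>" "set [p3, p5, p7, e1, e2, e3, g123] \<in> \<B>"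
    "set [p1, p4, p7, e1, e2, e4, g124] \<in> \<B>" "set [p1, p3, p6, e1, e3, e4, g134] \<in> \<B>"
    "set [p4, p5, p6, e2, e3, e4, g234] \<in> \<B>" "set [p3, p5, p6, z, e1, g234, h] \<in> \<B>"
    using labelled_blocks .
  define f where "f = (!) [p1, p2, p3, p4, p5, p6, p7, z, e1, e2, f12, e3, f13, f23, e4, f14, f24, f34,
       g123, g124, g134, g234, h]"
  have inj: "inj_on f {..<23}"
    unfolding f_def by (rule inj_on_nth[OF D]) simp
  have gen: "\<forall>g\<in>set generators. f ` set g \<in> \<B>"
    using b by (simp add: generators_def f_def)
  have "length w = 23 \<and> word_image f w \<in> \<B>" if "w \<in> set block_words" for w
  proof (rule odd_sums_blocks[OF inj _ _ _ that[unfolded block_words_def]])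
    show "\<forall>g\<in>set (map (\<lambda>g. map (\<lambda>i. i \<in> set g) [0..<23]) generators). length g = 23 \<and> word_image f g \<in> \<B>"
    proof safe
      fix w assume "w \<in> set (map (\<lambda>g. map (\<lambda>i. i \<in> set g) [0..<23]) generators)"
      then obtain g where g: "g \<in> set generators" "w = map (\<lambda>i. i \<in> set g) [0..<23]" by auto
      show "length w = 23" using g by simp
      have "\<forall>g\<in>set generators. set g \<subseteq> {..<23}" by (simp add: generators_def)
      then have "{i. i < length w \<and> w ! i} = set g" unfolding g(2) using g(1) by (intro word_of_set) blast
      then show "word_image f w \<in> \<B>" using gen g by (simp add: word_image_def)
    qed
    have "word_image f (replicate 23 False) = {}" by (auto simp: word_image_def)
    then show "\<forall>b\<in>\<B>. odd (card (word_image f (replicate 23 False) \<inter> b)) \<longleftrightarrow> False" by simp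
  qed simp
  then show thesis using that[OF inj gen] by blast
qed

text \<open>A labelling of \<open>\<B>\<close> supplies the word lengths that the trie criterion
  asks for.\<close>

lemma distinct_block_words: "distinct block_words"
proof -
  obtain f :: "nat \<Rightarrow> 'p" where "\<forall>w\<in>set block_words. length w = 23 \<and> word_image f w \<in> \<B>"
    using block_labelling by metis
  then show ?thesis using trie_distinct_imp_distinct[OF trie_distinct_block_words] by blast
qed

lemma blocks_eq_word_images:
  assumes "card \<B> = 253" "inj_on f {..<23}" "\<forall>w\<in>set block_words. length w = 23 \<and> word_image f w \<in> \<B>"
  shows "\<B> = word_image f ` set block_words"
proof -
  have "card (word_image f ` set block_words) = 253"
    using card_image[OF inj_on_subset[OF inj_on_word_image[OF assms(2)], of "set block_words"]] assms(3)
      distinct_card[OF distinct_block_words] length_block_words by auto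
  then show ?thesis using card_subset_eq[of \<B> "word_image f ` set block_words"] assms by auto
qed

text \<open>The set of intersection sizes of the design has to be exactly {3, 1}, so both must
  occur; two pairs of generators show this.\<close>

lemma both_intersection_sizes:
  "\<exists>b\<in>\<B>. \<exists>c\<in>\<B>. b \<noteq> c \<and> card (b \<inter> c) = 1" "\<exists>b\<in>\<B>. \<exists>c\<in>\<B>. b \<noteq> c \<and> card (b \<inter> c) = 3"
proof -
  obtain f :: "nat \<Rightarrow> 'p" where f: "inj_on f {..<23}" "\<forall>g\<in>set generators. f ` set g \<in> \<B>"
    using block_labelling by metis
  have m: "card (f ` X \<inter> f ` Y) = card (X \<inter> Y)" if "X \<subseteq> {..<23}" "Y \<subseteq> {..<23}" for X Y
    using inj_on_image_Int[OF f(1) that] card_image[OF inj_on_subset[OF f(1), of "X \<inter> Y"]] that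
    by (simp add: le_infI1)
  have ex: "\<exists>b\<in>\<B>. \<exists>c\<in>\<B>. b \<noteq> c \<and> card (b \<inter> c) = n"
    if "b \<in> \<B>" "c \<in> \<B>" "card (b \<inter> c) = n" "n < 7" for b c n
    using block_card[OF that(1)] that by (intro bexI[of _ b] bexI[of _ c]) auto
  have B: "f ` {1,3,5,7,8,14,15} \<in> \<B>" "f ` {2,4,6,8,9,11,18} \<in> \<B>"
    "f ` {0,1,2,3,4,5,6} \<in> \<B>" "f ` {0,1,2,7,8,9,10} \<in> \<B>"
    using f(2) by (simp_all add: generators_def)
  have "card (f ` {1,3,5,7,8,14,15} \<inter> f ` {2,4,6,8,9,11,18}) = 1"
    by (subst m; simp)
  from ex[OF B(1,2) this] show "\<exists>b\<in>\<B>. \<exists>c\<in>\<B>. b \<noteq> c \<and> card (b \<inter> c) = 1" by simp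
  have "card (f ` {0,1,2,3,4,5,6} \<inter> f ` {0,1,2,7,8,9,10}) = 3"
    by (subst m; simp)
  from ex[OF B(3,4) this] show "\<exists>b\<in>\<B>. \<exists>c\<in>\<B>. b \<noteq> c \<and> card (b \<inter> c) = 3" by simp
qed

end

text \<open>The words are the same for both systems, so matching the labellings sends blocks to
  blocks. Conversely, the preimages of four points of a block \<open>c\<close> of
  \<open>\<C>\<close> lie in a block of \<open>\<B>\<close>, whose image shares these points with
  \<open>c\<close> and hence equals it.\<close>

lemma steiner_system_unique:
  fixes \<B> :: "'p::finite set set" and \<C> :: "'q::finite set set"
  assumes B: "steiner_system \<B>" "card \<B> = 253" and C: "steiner_system \<C>"
  obtains \<pi> where "bij \<pi>" "(`) \<pi> ` \<B> = \<C>"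
proof -
  interpret B: steiner_system \<B> by fact
  interpret C: steiner_system \<C> by fact
  obtain f :: "nat \<Rightarrow> 'p" where f: "inj_on f {..<23}"
    "\<forall>w\<in>set block_words. length w = 23 \<and> word_image f w \<in> \<B>"
    using B.block_labelling by metis
  obtain f' :: "nat \<Rightarrow> 'q" where f': "inj_on f' {..<23}"
    "\<forall>w\<in>set block_words. length w = 23 \<and> word_image f' w \<in> \<C>"
    using C.block_labelling by metis
  have bf: "bij_betw f {..<23} UNIV" "bij_betw f' {..<23} UNIV"
    using f(1) f'(1) B.card_points C.card_points
    by (simp_all add: bij_betw_def card_image card_subset_eq)
  define \<pi> where "\<pi> = f' \<circ> inv_into {..<23} f"
  have bij: "bij \<pi>" unfolding \<pi>_def
    using bij_betw_trans[OF bij_betw_inv_into[OF bf(1)] bf(2)] .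
  have "\<pi> ` b \<in> \<C>" if b: "b \<in> \<B>" for b
  proof -
    obtain w where w: "w \<in> set block_words" "b = word_image f w"
      using B.blocks_eq_word_images[OF B(2) f] b by auto
    have "\<pi> ` b = word_image f' w"
      using f w(1) unfolding w(2) word_image_def \<pi>_def image_comp
      by (intro image_cong) (auto simp: inv_into_f_f)
    then show ?thesis using f' w by simp
  qed
  then have sub: "(`) \<pi> ` \<B> \<subseteq> \<C>" by auto
  moreover have "c \<in> (`) \<pi> ` \<B>" if c: "c \<in> \<C>" for c
  proof -
    obtain T where T: "T \<subseteq> c" "card T = 4"
      using obtain_subset_with_card_n[of 4 c] C.block_card[OF c] by auto
    have i: "\<pi> ` (inv \<pi> ` T) = T" using bij by (simp add: image_f_inv_f bij_is_surj)
    have "card (inv \<pi> ` T) = 4"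
      using T bij by (simp add: card_image inj_on_subset[OF bij_is_inj[OF bij_imp_bij_inv]])
    then obtain b where b: "b \<in> \<B>" "inv \<pi> ` T \<subseteq> b" using B.block_ex by blast
    have "T \<subseteq> \<pi> ` b" using b(2) i by (metis image_mono)
    then have "\<pi> ` b = c"
      by (intro C.block_eqI[of _ _ T]) (use b sub c T in auto)
    then show ?thesis using b by auto
  qed
  ultimately have "(`) \<pi> ` \<B> = \<C>" by blast
  then show thesis by (rule that[OF bij])
qed

text \<open>Replacing \<open>q\<^sup>2\<close> by d + 2 makes the equation for \<open>m\<close>
  linear in \<open>q\<close>, so \<open>q\<close> is rational and hence an integer \<open>k\<close>.
  The equation for \<open>s\<close> times \<open>m\<close> reduces to 2s(k - 2) = m(k^2 - 6k + 7),
  which makes k - 2 divide \<open>m\<close> and then 3.\<close>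

lemma dimension_arithmetic:
  fixes q :: real and d :: nat and m s :: int
  assumes d: "d \<ge> 4" and q: "q > 0" "q\<^sup>2 = real d + 2"
    and m: "(of_int m)\<^sup>2 = (q - 2) * (q\<^sup>2 + q - 3)"
    and s: "2 * of_int m * of_int s = (q\<^sup>2 + q - 3) * (q\<^sup>2 - 6 * q + 7)"
  shows "d = 7 \<and> q = 3 \<or> d = 23 \<and> q = 5"
proof -
  have "(q - 2) * (q\<^sup>2 + q - 3) = q * q\<^sup>2 - q\<^sup>2 - 5 * q + 6" by (simp add: algebra_simps power2_eq_square)
  then have qd: "q * (real d - 3) = (of_int m)\<^sup>2 + real d - 4" unfolding m q(2) by (simp add: algebra_simps)
  define n where "n = m\<^sup>2 + int d - 4"
  have qn: "q * (real d - 3) = of_int n" unfolding qd n_def by simp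
  have "of_int (n\<^sup>2) = q\<^sup>2 * (real d - 3)\<^sup>2" unfolding of_int_power qn[symmetric] by (simp add: power_mult_distrib)
  also have "\<dots> = of_int ((int d + 2) * (int d - 3)\<^sup>2)" unfolding q(2) by simp
  finally have "n\<^sup>2 = (int d + 2) * (int d - 3)\<^sup>2" using of_int_eq_iff by blast
  then have "(int d - 3)\<^sup>2 dvd n\<^sup>2" by simp
  then have "int d - 3 dvd n" by simp
  then obtain k where k: "n = (int d - 3) * k" by (elim dvdE)
  have "q * (real d - 3) = of_int k * (real d - 3)" unfolding qn k by simp
  then have qk: "q = of_int k" using d by simp
  have k2: "k\<^sup>2 = int d + 2"
  proof -
    have "of_int (k\<^sup>2) = (of_int (int d + 2) :: real)" using q(2) unfolding qk by simp
    then show ?thesis using of_int_eq_iff by blast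
  qed
  have k0: "k > 0" using q(1) qk by simp
  have k3: "k \<ge> 3"
  proof (rule ccontr)
    assume "\<not> k \<ge> 3"
    then have "k\<^sup>2 \<le> 2\<^sup>2" using k0 by (intro power_mono) auto
    then show False using k2 d by simp
  qed
  have m': "m\<^sup>2 = (k - 2) * (k\<^sup>2 + k - 3)"
  proof -
    have "of_int (m\<^sup>2) = (of_int ((k - 2) * (k\<^sup>2 + k - 3)) :: real)" using m unfolding qk by simp
    then show ?thesis using of_int_eq_iff by blast
  qed
  have s': "2 * m * s = (k\<^sup>2 + k - 3) * (k\<^sup>2 - 6 * k + 7)"
  proof -
    have "of_int (2 * m * s) = (of_int ((k\<^sup>2 + k - 3) * (k\<^sup>2 - 6 * k + 7)) :: real)" using s unfolding qk by simp
    then show ?thesis using of_int_eq_iff by blast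
  qed
  have pos: "k\<^sup>2 + k - 3 > 0" using k2 k3 by simp
  have "(k\<^sup>2 + k - 3) * (2 * s * (k - 2)) = 2 * s * m\<^sup>2" unfolding m' by (simp add: algebra_simps)
  also have "\<dots> = m * (2 * m * s)" by (simp add: power2_eq_square)
  also have "\<dots> = (k\<^sup>2 + k - 3) * (m * (k\<^sup>2 - 6 * k + 7))" unfolding s' by (simp add: algebra_simps)
  finally have "2 * s * (k - 2) = m * (k\<^sup>2 - 6 * k + 7)" using pos by simp
  \<comment> \<open>This uses k^2 - 6k + 7 = (k - 2)(k - 4) - 1.\<close>
  then have "m = (k - 2) * (m * (k - 4) - 2 * s)" by (simp add: algebra_simps power2_eq_square)
  then obtain t where t: "m = (k - 2) * t" by blast
  have "(k - 2) * ((k - 2) * t\<^sup>2) = (k - 2) * (k\<^sup>2 + k - 3)"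
    using m' unfolding t by (simp add: power2_eq_square algebra_simps)
  then have "(k - 2) * t\<^sup>2 = k\<^sup>2 + k - 3" using k3 by simp
  \<comment> \<open>This uses k^2 + k - 3 = (k - 2)(k + 3) + 3.\<close>
  then have "3 = (k - 2) * (t\<^sup>2 - (k + 3))" by (simp add: algebra_simps power2_eq_square)
  then have "k - 2 dvd 3" by (metis dvd_triv_left)
  moreover have "k - 2 \<le> 3" using zdvd_imp_le[OF calculation] by simp
  ultimately have "k = 3 \<or> k = 4 \<or> k = 5" using k3 by auto
  moreover have "k \<noteq> 4" using \<open>k - 2 dvd 3\<close> by auto
  ultimately show ?thesis using k2 qk by auto
qed

text \<open>Blocks sharing at most three points contain disjoint families of 4-sets, and 253 * 35 =
  8855 is the number of all 4-sets, so none is missed.\<close>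

lemma steiner_systemI:
  fixes \<B> :: "'p::finite set set"
  assumes card_points: "CARD('p) = 23" and card: "card \<B> = 253"
    and block_card: "\<And>b. b \<in> \<B> \<Longrightarrow> card b = 7"
    and meet: "\<And>b c. b \<in> \<B> \<Longrightarrow> c \<in> \<B> \<Longrightarrow> b \<noteq> c \<Longrightarrow> card (b \<inter> c) = 1 \<or> card (b \<inter> c) = 3"
  shows "steiner_system \<B>"
proof
  fix T :: "'p set" assume T: "card T = 4"
  let ?S = "\<lambda>b. {T::'p set. T \<subseteq> b \<and> card T = 4}"
  have dis: "?S b \<inter> ?S c = {}" if "b \<in> \<B>" "c \<in> \<B>" "b \<noteq> c" for b c
  proof -
    have False if T: "T \<subseteq> b" "T \<subseteq> c" "card T = 4" for T
    proof -
      have "card T \<le> card (b \<inter> c)" by (rule card_mono) (use T in auto)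
      then show False using meet[OF \<open>b \<in> \<B>\<close> \<open>c \<in> \<B>\<close> \<open>b \<noteq> c\<close>] T(3) by linarith
    qed
    then show ?thesis by blast
  qed
  have "card (\<Union>b\<in>\<B>. ?S b) = (\<Sum>b\<in>\<B>. card (?S b))"
    by (rule card_UN_disjoint) (use dis in auto)
  also have "\<dots> = (\<Sum>b\<in>\<B>. 7 choose 4)"
    by (intro sum.cong refl) (simp add: n_subsets block_card)
  also have "\<dots> = 23 choose 4"
    unfolding sum_constant card using binomial_fact_lemma[of 4 7] binomial_fact_lemma[of 4 23]
    by (simp add: fact_numeral)
  also have "\<dots> = card {T::'p set. card T = 4}"
    using n_subsets[of "UNIV::'p set" 4] card_points by simp
  finally have "(\<Union>b\<in>\<B>. ?S b) = {T. card T = 4}" by (intro card_subset_eq) auto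
  then show "\<exists>b\<in>\<B>. T \<subseteq> b" using T by blast
qed (use assms in auto)

lemma steiner_system_image:
  fixes \<B> :: "'p::finite set set" and \<pi> :: "'p \<Rightarrow> 'q::finite"
  assumes "steiner_system \<B>" "bij \<pi>"
  shows "steiner_system ((`) \<pi> ` \<B>)"
proof -
  interpret steiner_system \<B> by fact
  have inj: "inj \<pi>" using assms(2) by (rule bij_is_inj)
  have c: "card (\<pi> ` b) = card b" for b by (rule card_image) (rule inj_on_subset[OF inj], simp)
  show ?thesis
  proof
    show "CARD('q) = 23" using bij_betw_same_card[OF assms(2)] card_points by simp
  next
    fix T :: "'q set" assume T: "card T = 4"
    have i: "\<pi> ` (inv \<pi> ` T) = T" using assms(2) by (simp add: image_f_inv_f bij_is_surj)
    then have "card (inv \<pi> ` T) = 4" using c[of "inv \<pi> ` T"] T by simp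
    then obtain b where "b \<in> \<B>" "inv \<pi> ` T \<subseteq> b" using block_ex by blast
    then show "\<exists>b\<in>(`) \<pi> ` \<B>. T \<subseteq> b" using i by (metis image_mono imageI)
  next
    fix b c assume "b \<in> (`) \<pi> ` \<B>" "c \<in> (`) \<pi> ` \<B>" "b \<noteq> c"
    then obtain b' c' where "b' \<in> \<B>" "c' \<in> \<B>" "b = \<pi> ` b'" "c = \<pi> ` c'" "b' \<noteq> c'" by auto
    then show "card (b \<inter> c) = 1 \<or> card (b \<inter> c) = 3"
      using meet[of b' c'] by (simp add: image_Int[OF inj, symmetric] c)
  qed (use block_card c in auto)
qed

lemma steiner_system_iff_design:
  fixes \<B> :: "'p::finite set set"
  shows "steiner_system \<B> \<longleftrightarrow> quasi_symmetric_design 4 23 7 1 3 1 UNIV \<B>"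
proof
  assume "steiner_system \<B>"
  then interpret steiner_system \<B> .
  have "card {b \<in> \<B>. T \<subseteq> b} = 1" if T: "card T = 4" for T
  proof -
    obtain b where b: "b \<in> \<B>" "T \<subseteq> b" using block_ex[OF T] by blast
    have "c = b" if "c \<in> \<B>" "T \<subseteq> c" for c
      using block_eqI[OF that(1) b(1) that(2) b(2)] T by simp
    then have "{b \<in> \<B>. T \<subseteq> b} = {b}" using b by blast
    then show ?thesis by simp
  qed
  moreover have "{card (b \<inter> c) | b c. b \<in> \<B> \<and> c \<in> \<B> \<and> b \<noteq> c} = {3, 1}"
  proof
    show "{card (b \<inter> c) | b c. b \<in> \<B> \<and> c \<in> \<B> \<and> b \<noteq> c} \<subseteq> {3, 1}" using meet by blast
    show "{3, 1} \<subseteq> {card (b \<inter> c) | b c. b \<in> \<B> \<and> c \<in> \<B> \<and> b \<noteq> c}"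
    proof -
      obtain b c b' c' where "b \<in> \<B>" "c \<in> \<B>" "b \<noteq> c" "card (b \<inter> c) = 1"
        "b' \<in> \<B>" "c' \<in> \<B>" "b' \<noteq> c'" "card (b' \<inter> c') = 3"
        using both_intersection_sizes by blast
      then show ?thesis by (intro insert_subsetI empty_subsetI) (rule CollectI, metis)+
    qed
  qed
  ultimately show "quasi_symmetric_design 4 23 7 1 3 1 UNIV \<B>"
    unfolding quasi_symmetric_design_def using card_points block_card by simp
next
  assume d: "quasi_symmetric_design 4 23 7 1 3 1 UNIV \<B>"
  then have s: "{card (b \<inter> c) | b c. b \<in> \<B> \<and> c \<in> \<B> \<and> b \<noteq> c} = {3, 1}"
    and t: "\<And>T. card T = 4 \<Longrightarrow> card {b \<in> \<B>. T \<subseteq> b} = 1"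
    by (simp_all add: quasi_symmetric_design_def)
  show "steiner_system \<B>"
  proof
    fix T :: "'p set" assume "card T = 4"
    then have "card {b \<in> \<B>. T \<subseteq> b} \<noteq> 0" using t by simp
    then have "{b \<in> \<B>. T \<subseteq> b} \<noteq> {}" by (metis card.empty)
    then show "\<exists>b\<in>\<B>. T \<subseteq> b" by blast
  next
    fix b c assume "b \<in> \<B>" "c \<in> \<B>" "b \<noteq> c"
    then have "card (b \<inter> c) \<in> {3, 1}" unfolding s[symmetric] by blast
    then show "card (b \<inter> c) = 1 \<or> card (b \<inter> c) = 3" by auto
  qed (use d in \<open>simp_all add: quasi_symmetric_design_def\<close>)
qed

text \<open>The choice in \<open>steiner_4_7_23\<close> has a witness, namely \<open>\<B>\<close>
  moved to the type \<open>23\<close>; uniqueness then identifies the chosen system with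
  \<open>\<B>\<close>.\<close>

lemma steiner_4_7_23:
  fixes \<B> :: "'p::finite set set"
  assumes "steiner_system \<B>" "card \<B> = 253"
  obtains \<pi> :: "'p \<Rightarrow> 23" where "bij \<pi>" "(`) \<pi> ` \<B> = steiner_4_7_23"
proof -
  interpret steiner_system \<B> by fact
  obtain \<pi> :: "'p \<Rightarrow> 23" where "bij_betw \<pi> UNIV UNIV"
    using finite_same_card_bij[of "UNIV::'p set" "UNIV::23 set"] card_points by auto
  then have "quasi_symmetric_design 4 23 7 1 3 1 UNIV ((`) \<pi> ` \<B>)"
    using steiner_system_image[OF assms(1)] steiner_system_iff_design by blast
  then have "steiner_system steiner_4_7_23"
    unfolding steiner_system_iff_design steiner_4_7_23_def by (rule someI)
  then show thesis using steiner_system_unique[OF assms] that by blast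
qed

section \<open>Sign patterns relative to an incoherent basis\<close>

text \<open>\<open>W\<close> holds the unit vectors outside the basis. Each is signed so that its
  products with the basis have nonpositive sum, which selects the same root of
  \<open>excess_sq\<close> for all of them.\<close>

locale saturated_lines = equiangular_basis \<alpha> \<kappa>
  for \<alpha> :: "'n::finite \<Rightarrow> real^'n" and \<kappa> :: real +
  fixes W :: "(real^'n) set"
  assumes tight: "tight_equiangular (range \<alpha> \<union> W) \<kappa>"
    and disjoint: "range \<alpha> \<inter> W = {}"
    and nonpos: "\<beta> \<in> W \<Longrightarrow> (\<Sum>i\<in>UNIV. \<beta> \<bullet> \<alpha> i) \<le> 0"
begin

sublocale tight: tight_equiangular "range \<alpha> \<union> W" \<kappa>
  by (rule tight)

definition positives :: "real^'n \<Rightarrow> 'n set" where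
  "positives \<beta> = {i. \<beta> \<bullet> \<alpha> i = \<kappa>}"

text \<open>The sum m of the signs, positive minus negative ones, kept as an integer for the
  divisibility argument.\<close>

definition excess :: "real^'n \<Rightarrow> int" where
  "excess \<beta> = 2 * int (card (positives \<beta>)) - int CARD('n)"

definition q :: real where
  "q = 1 / \<kappa>"

lemma q_kappa: "q * \<kappa> = 1"
  using kappa by (simp add: q_def)

lemma q_gt_1: "q > 1"
  using kappa by (simp add: q_def)

lemma q_sq: "q\<^sup>2 = real CARD('n) + 2"
  using tight.kappa_eq kappa by (simp add: q_def field_simps power2_eq_square)

lemma finite_W: "finite W"
  using tight.finite_V by simp

lemma card_W: "2 * card W = CARD('n) * (CARD('n) - 1)"
proof -
  have "card (range \<alpha> \<union> W) = CARD('n) + card W"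
    using card_Un_disjoint[OF _ finite_W disjoint] by (simp add: card_image inj_basis)
  moreover have "2 * (CARD('n) * (CARD('n) + 1) div 2) = CARD('n) * (CARD('n) + 1)" by simp
  ultimately have "2 * (CARD('n) + card W) = CARD('n) * (CARD('n) + 1)" using tight.card_V by simp
  moreover have "CARD('n) * (CARD('n) + 1) = CARD('n) * (CARD('n) - 1) + 2 * CARD('n)"
    by (cases "CARD('n)") (simp_all add: algebra_simps)
  ultimately show ?thesis by simp
qed

lemma inner_basis:
  assumes "\<beta> \<in> W"
  shows "\<beta> \<bullet> \<alpha> i = (if i \<in> positives \<beta> then \<kappa> else - \<kappa>)"
proof -
  have "(\<beta> \<bullet> \<alpha> i)\<^sup>2 = \<kappa>\<^sup>2" by (rule tight.angle) (use assms disjoint in auto)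
  then show ?thesis by (auto simp: positives_def power2_eq_iff)
qed

lemma inj_on_positives: "inj_on positives W"
  by (rule inj_onI) (rule vec_eqI, simp add: inner_basis)

lemma sum_inner_basis: "\<beta> \<in> W \<Longrightarrow> (\<Sum>i\<in>UNIV. \<beta> \<bullet> \<alpha> i) = \<kappa> * of_int (excess \<beta>)"
proof -
  assume b: "\<beta> \<in> W"
  have "(\<Sum>i\<in>UNIV. \<beta> \<bullet> \<alpha> i) = (\<Sum>i\<in>UNIV. 2 * \<kappa> * of_bool (i \<in> positives \<beta>) - \<kappa>)"
    by (intro sum.cong) (auto simp: inner_basis[OF b])
  also have "\<dots> = 2 * \<kappa> * real (card (positives \<beta>)) - real CARD('n) * \<kappa>"
    by (simp add: sum_subtractf sum_distrib_left[symmetric])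
  finally show ?thesis by (simp add: excess_def algebra_simps)
qed

lemma sum_inner_basis_mult:
  assumes "\<beta> \<in> W" "\<gamma> \<in> W"
  shows "(\<Sum>i\<in>UNIV. (\<beta> \<bullet> \<alpha> i) * (\<gamma> \<bullet> \<alpha> i)) = \<kappa>\<^sup>2 * (real CARD('n) - 2 * real (card (positives \<beta>))
    - 2 * real (card (positives \<gamma>)) + 4 * real (card (positives \<beta> \<inter> positives \<gamma>)))"
proof -
  have "(\<Sum>i\<in>UNIV. (\<beta> \<bullet> \<alpha> i) * (\<gamma> \<bullet> \<alpha> i)) = (\<Sum>i\<in>UNIV. \<kappa>\<^sup>2 * (1 - 2 * of_bool (i \<in> positives \<beta>)
      - 2 * of_bool (i \<in> positives \<gamma>) + 4 * of_bool (i \<in> positives \<beta> \<inter> positives \<gamma>)))"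
    by (intro sum.cong) (auto simp: inner_basis assms power2_eq_square)
  also have "\<dots> = \<kappa>\<^sup>2 * (\<Sum>i\<in>UNIV. 1 - 2 * of_bool (i \<in> positives \<beta>)
      - 2 * of_bool (i \<in> positives \<gamma>) + 4 * of_bool (i \<in> positives \<beta> \<inter> positives \<gamma>))"
    by (rule sum_distrib_left[symmetric])
  also have "(\<Sum>i\<in>UNIV. 1 - 2 * of_bool (i \<in> positives \<beta>)
      - 2 * of_bool (i \<in> positives \<gamma>) + 4 * of_bool (i \<in> positives \<beta> \<inter> positives \<gamma>) :: real)
     = real CARD('n) - 2 * real (card (positives \<beta>)) - 2 * real (card (positives \<gamma>))
       + 4 * real (card (positives \<beta> \<inter> positives \<gamma>))"
    unfolding sum.distrib sum_subtractf sum_distrib_left[symmetric] by (simp add: Int_def)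
  finally show ?thesis .
qed

lemma denominator_q: "q\<^sup>2 + q - 3 > 0"
proof -
  have "q\<^sup>2 \<ge> 4" unfolding q_sq using tight.dim_ge_2 by simp
  then show ?thesis using q_gt_1 by linarith
qed

text \<open>This is \<open>inner_formula\<close> multiplied by \<open>q\<^sup>2\<close>. With d =
  q^2 - 2 the factor of the correction term becomes 1/(q^2 + q - 3), and the cardinalities express
  the sum of the products of signs.\<close>

lemma scaled_inner_formula:
  assumes "\<beta> \<in> W" "\<gamma> \<in> W"
  shows "(q\<^sup>2 - q) * (\<beta> \<bullet> \<gamma>) = real CARD('n) - 2 * real (card (positives \<beta>)) - 2 * real (card (positives \<gamma>))
    + 4 * real (card (positives \<beta> \<inter> positives \<gamma>)) - of_int (excess \<beta>) * of_int (excess \<gamma>) / (q\<^sup>2 + q - 3)"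
proof -
  have D: "\<kappa> / (1 - \<kappa> + real CARD('n) * \<kappa>) = 1 / (q\<^sup>2 + q - 3)"
  proof -
    have "\<kappa> * (q\<^sup>2 + q - 3) = 1 - \<kappa> + real CARD('n) * \<kappa>"
      using q_kappa unfolding q_sq by (simp add: algebra_simps)
    then show ?thesis using denominator_pos denominator_q by (simp add: frac_eq_eq)
  qed
  have 1: "q\<^sup>2 * ((1 - \<kappa>) * (\<beta> \<bullet> \<gamma>)) = q\<^sup>2 * \<kappa>\<^sup>2 * (real CARD('n) - 2 * real (card (positives \<beta>))
      - 2 * real (card (positives \<gamma>)) + 4 * real (card (positives \<beta> \<inter> positives \<gamma>))
      - of_int (excess \<beta>) * of_int (excess \<gamma>) / (q\<^sup>2 + q - 3))"
    unfolding inner_formula D sum_inner_basis_mult[OF assms] assms[THEN sum_inner_basis]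
    by (simp add: algebra_simps power2_eq_square)
  have 2: "q\<^sup>2 * \<kappa>\<^sup>2 = 1" and 3: "q\<^sup>2 * (1 - \<kappa>) = q\<^sup>2 - q"
    using q_kappa by algebra+
  show ?thesis using 1 unfolding 2 mult.assoc[symmetric] 3 by simp
qed

text \<open>The formula for \<open>\<beta>\<close> with itself and unit norm read q^2 - q = d -
  m^2/(q^2 + q - 3), where d = q^2 - 2.\<close>

lemma excess_sq: "\<beta> \<in> W \<Longrightarrow> (of_int (excess \<beta>))\<^sup>2 = (q - 2) * (q\<^sup>2 + q - 3)"
proof -
  assume b: "\<beta> \<in> W"
  have "q\<^sup>2 - q = real CARD('n) - (of_int (excess \<beta>))\<^sup>2 / (q\<^sup>2 + q - 3)"
    using scaled_inner_formula[OF b b] tight.unit[of \<beta>] b by (simp add: power2_eq_square)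
  then have "(of_int (excess \<beta>))\<^sup>2 / (q\<^sup>2 + q - 3) = q - 2" using q_sq by linarith
  then show ?thesis using denominator_q by (simp add: divide_eq_eq)
qed

lemma excess_nonpos: "\<beta> \<in> W \<Longrightarrow> excess \<beta> \<le> 0"
  using nonpos[of \<beta>] sum_inner_basis[of \<beta>] kappa by (simp add: mult_le_0_iff)

lemma excess_eq: "\<beta> \<in> W \<Longrightarrow> \<gamma> \<in> W \<Longrightarrow> excess \<beta> = excess \<gamma>"
proof -
  assume b: "\<beta> \<in> W" "\<gamma> \<in> W"
  have "(of_int ((excess \<beta>)\<^sup>2) :: real) = of_int ((excess \<gamma>)\<^sup>2)" using b[THEN excess_sq] by simp
  then have "(excess \<beta>)\<^sup>2 = (excess \<gamma>)\<^sup>2" using of_int_eq_iff by blast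
  then show ?thesis using b[THEN excess_nonpos] by (auto simp: power2_eq_iff)
qed

text \<open>Equal excess makes the correction term q - 2, and the inner product contributes q - 1 or
  1 - q. For d = 23, q = 5 and seven positive signs this leaves 3 or 1 common points.\<close>

lemma positives_Int:
  assumes "\<beta> \<in> W" "\<gamma> \<in> W" "\<beta> \<noteq> \<gamma>"
  shows "real CARD('n) - 4 * real (card (positives \<beta>)) + 4 * real (card (positives \<beta> \<inter> positives \<gamma>))
    \<in> {2 * q - 3, -1}"
proof -
  have c: "card (positives \<gamma>) = card (positives \<beta>)"
    using excess_eq[OF assms(1,2)] by (simp add: excess_def)
  have "of_int (excess \<beta>) * of_int (excess \<gamma>) / (q\<^sup>2 + q - 3) = q - 2"
    using excess_sq[OF assms(1)] excess_eq[OF assms(1,2)] denominator_q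
    by (simp add: power2_eq_square divide_eq_eq)
  then have e: "(q\<^sup>2 - q) * (\<beta> \<bullet> \<gamma>) = real CARD('n) - 4 * real (card (positives \<beta>))
      + 4 * real (card (positives \<beta> \<inter> positives \<gamma>)) - (q - 2)"
    using scaled_inner_formula[OF assms(1,2)] unfolding c by linarith
  have "(\<beta> \<bullet> \<gamma>)\<^sup>2 = \<kappa>\<^sup>2" by (rule tight.angle) (use assms in auto)
  then have "\<beta> \<bullet> \<gamma> = \<kappa> \<or> \<beta> \<bullet> \<gamma> = - \<kappa>" by (simp add: power2_eq_iff)
  then have "(q\<^sup>2 - q) * (\<beta> \<bullet> \<gamma>) = q - 1 \<or> (q\<^sup>2 - q) * (\<beta> \<bullet> \<gamma>) = - (q - 1)"
  proof -
    have "(q\<^sup>2 - q) * \<kappa> = q - 1" using q_kappa by algebra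
    then show ?thesis using \<open>\<beta> \<bullet> \<gamma> = \<kappa> \<or> \<beta> \<bullet> \<gamma> = - \<kappa>\<close> by auto
  qed
  then show ?thesis using e by auto
qed

text \<open>The fourth moment is even in each vector of \<^term>\<open>W\<close>. Since all of them have the same inner
  product with \<open>\<Sum>i. \<alpha> i\<close>, taking this sum as the fourth argument yields a third moment of
  the sign patterns, an integer.\<close>

lemma third_moment:
  fixes i j l :: 'n
  assumes ij: "i \<noteq> j" "i \<noteq> l" "j \<noteq> l" and m: "\<And>\<beta>. \<beta> \<in> W \<Longrightarrow> excess \<beta> = m"
  shows "\<exists>s. 2 * of_int m * of_int s = (q\<^sup>2 + q - 3) * (q\<^sup>2 - 6 * q + 7)"
proof -
  define e :: "real^'n \<Rightarrow> 'n \<Rightarrow> int" where "e \<beta> t = (if t \<in> positives \<beta> then 1 else -1)" for \<beta> t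
  define s where "s = (\<Sum>\<beta>\<in>W. e \<beta> i * e \<beta> j * e \<beta> l)"
  define w where "w = (\<Sum>t\<in>UNIV. \<alpha> t)"
  let ?d = "real CARD('n)"
  define \<omega> where "\<omega> = 1 + (?d - 1) * \<kappa>"
  have aw: "\<alpha> t \<bullet> w = \<omega>" for t
  proof -
    have "\<alpha> t \<bullet> w = (\<Sum>u\<in>UNIV. 1 * (\<alpha> u \<bullet> \<alpha> t))" by (simp add: w_def inner_sum_right inner_commute)
    also have "\<dots> = \<omega>" by (simp only: sum_gram) (simp add: \<omega>_def algebra_simps)
    finally show ?thesis .
  qed
  let ?f = "\<lambda>v. (v \<bullet> \<alpha> i) * (v \<bullet> \<alpha> j) * (v \<bullet> \<alpha> l) * (v \<bullet> w)"
  \<comment> \<open>The product of \<open>\<alpha> t\<close> with itself is 1, so for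
    \<open>t\<close> among the three indices one factor \<open>\<kappa>\<close> is lost.\<close>
  have "sum ?f (range \<alpha>) = (\<Sum>t\<in>UNIV. (\<kappa>^3 + (\<kappa>\<^sup>2 - \<kappa>^3) * of_bool (t \<in> {i, j, l})) * \<omega>)"
    unfolding sum.reindex[OF inj_basis] o_def
    by (intro sum.cong) (use ij in \<open>auto simp: gram aw power2_eq_square power3_eq_cube\<close>)
  also have "\<dots> = (?d * \<kappa>^3 + (\<kappa>\<^sup>2 - \<kappa>^3) * 3) * \<omega>"
  proof -
    have "(\<Sum>t\<in>UNIV. of_bool (t \<in> {i, j, l}) :: real) = 3"
      using ij by (subst sum_of_bool_eq) (simp_all add: Collect_disj_eq)
    then show ?thesis unfolding sum_distrib_right[symmetric] sum.distrib sum_distrib_left[symmetric] by simp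
  qed
  finally have f1: "sum ?f (range \<alpha>) = (?d * \<kappa>^3 + (\<kappa>\<^sup>2 - \<kappa>^3) * 3) * \<omega>" .
  have "sum ?f W = (\<Sum>\<beta>\<in>W. \<kappa>^4 * of_int m * of_int (e \<beta> i * e \<beta> j * e \<beta> l))"
  proof (rule sum.cong)
    fix \<beta> assume b: "\<beta> \<in> W"
    have "\<beta> \<bullet> w = \<kappa> * of_int m" using sum_inner_basis[OF b] m[OF b] by (simp add: w_def inner_sum_right)
    moreover have "\<beta> \<bullet> \<alpha> t = \<kappa> * of_int (e \<beta> t)" for t by (simp add: inner_basis[OF b] e_def)
    ultimately show "?f \<beta> = \<kappa>^4 * of_int m * of_int (e \<beta> i * e \<beta> j * e \<beta> l)"
      by (simp add: power4_eq_xxxx)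
  qed simp
  then have f2: "sum ?f W = \<kappa>^4 * of_int m * of_int s" by (simp add: s_def sum_distrib_left)
  have "sum ?f (range \<alpha> \<union> W) = sum ?f (range \<alpha>) + sum ?f W"
    by (rule sum.union_disjoint) (use finite_W disjoint in auto)
  then have "2 * (?d + 2) * (sum ?f (range \<alpha>) + sum ?f W) = (?d + 1) * (3 * (\<kappa> * \<omega>))"
    using tight.fourth_moment[of "\<alpha> i" "\<alpha> j" "\<alpha> l" w] ij by (simp add: gram aw)
  then have E: "2 * q\<^sup>2 * ((?d * \<kappa>^3 + (\<kappa>\<^sup>2 - \<kappa>^3) * 3) * \<omega> + \<kappa>^4 * of_int m * of_int s)
      = (q\<^sup>2 - 1) * (3 * (\<kappa> * \<omega>))"
    unfolding f1 f2 q_sq by simp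
  note k = q_kappa
  have d: "?d = q\<^sup>2 - 2" using q_sq by simp
  have w: "q * \<omega> = q\<^sup>2 + q - 3"
  proof -
    have "q * \<omega> = q + (?d - 1) * (q * \<kappa>)" unfolding \<omega>_def by (simp add: algebra_simps)
    then show ?thesis unfolding k d by simp
  qed
  let ?M = "of_int m * of_int s :: real"
  \<comment> \<open>Multiplying \<open>E\<close> by \<open>q\<^sup>2\<close> provides enough powers
    of \<open>q\<close> to pair with every \<open>\<kappa>\<close> and \<open>\<omega>\<close>,
    which leaves a polynomial identity in \<open>q\<close>.\<close>
  have "2 * ((?d * (q * \<kappa>)^3 + ((q * \<kappa>)\<^sup>2 * q - (q * \<kappa>)^3) * 3) * (q * \<omega>) + (q * \<kappa>)^4 * ?M)
      = q\<^sup>2 * (2 * q\<^sup>2 * ((?d * \<kappa>^3 + (\<kappa>\<^sup>2 - \<kappa>^3) * 3) * \<omega> + \<kappa>^4 * of_int m * of_int s))"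
    by algebra
  also have "\<dots> = (q\<^sup>2 - 1) * 3 * (q * \<kappa>) * (q * \<omega>)" unfolding E by algebra
  finally have "2 * ((q\<^sup>2 - 2 + (q - 1) * 3) * (q\<^sup>2 + q - 3) + ?M) = (q\<^sup>2 - 1) * 3 * (q\<^sup>2 + q - 3)"
    unfolding k w d by simp
  then have "2 * ?M = (q\<^sup>2 + q - 3) * (q\<^sup>2 - 6 * q + 7)" by algebra
  then have "2 * of_int m * of_int s = (q\<^sup>2 + q - 3) * (q\<^sup>2 - 6 * q + 7)" by (simp add: mult.assoc)
  then show ?thesis by blast
qed

text \<open>Here m is the nonpositive root of (q - 2)(q^2 + q - 3), namely 0, -1, -3, -9 for d = 2,
  3, 7, 23, and (d + m)/2 signs are positive.\<close>

lemma dimension_cases: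
  obtains "CARD('n) = 2" "q = 2" "\<And>\<beta>. \<beta> \<in> W \<Longrightarrow> card (positives \<beta>) = 1"
  | "CARD('n) = 3" "q = sqrt 5" "\<And>\<beta>. \<beta> \<in> W \<Longrightarrow> card (positives \<beta>) = 1"
  | "CARD('n) = 7" "q = 3" "\<And>\<beta>. \<beta> \<in> W \<Longrightarrow> card (positives \<beta>) = 2"
  | "CARD('n) = 23" "q = 5" "\<And>\<beta>. \<beta> \<in> W \<Longrightarrow> card (positives \<beta>) = 7"
proof -
  have "CARD('n) * (CARD('n) - 1) \<noteq> 0" using tight.dim_ge_2 by simp
  then have "W \<noteq> {}" using card_W by auto
  then obtain \<gamma> where g: "\<gamma> \<in> W" by blast
  define m where "m = excess \<gamma>"
  have m: "excess \<beta> = m" if "\<beta> \<in> W" for \<beta> unfolding m_def using excess_eq[OF that g] .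
  have c: "2 * int (card (positives \<beta>)) = int CARD('n) + m" if "\<beta> \<in> W" for \<beta>
    using m[OF that] by (simp add: excess_def)
  have m0: "m \<le> 0" and msq: "(of_int m)\<^sup>2 = (q - 2) * (q\<^sup>2 + q - 3)"
    using excess_nonpos[OF g] excess_sq[OF g] by (simp_all add: m_def)
  have mI: "m = - k" if "(of_int m)\<^sup>2 = (of_int (k\<^sup>2) :: real)" "k \<ge> 0" for k
  proof -
    have "(of_int (m\<^sup>2) :: real) = of_int (k\<^sup>2)" using that by simp
    then have "m\<^sup>2 = k\<^sup>2" using of_int_eq_iff by blast
    then show ?thesis using m0 that(2) by (auto simp: power2_eq_iff)
  qed
  have q_sqrt: "q = sqrt (real CARD('n) + 2)" using q_sq q_gt_1 by (simp add: real_sqrt_unique)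
  consider "CARD('n) = 2" | "CARD('n) = 3" | "CARD('n) \<ge> 4" using tight.dim_ge_2 by linarith
  then show thesis
  proof cases
    case 1
    have q: "q = 2" using q_sqrt 1 by simp
    have "m = - 0" by (rule mI) (use msq q in simp_all)
    then have "card (positives \<beta>) = 1" if "\<beta> \<in> W" for \<beta> using c[OF that] 1 by simp
    then show thesis using that(1) 1 q by blast
  next
    case 2
    have q: "q = sqrt 5" using q_sqrt 2 by simp
    have "(q - 2) * (q\<^sup>2 + q - 3) = (q - 2) * (q + 2)" using q_sq 2 by simp
    also have "\<dots> = 1" using q_sq 2 by (simp add: algebra_simps power2_eq_square)
    finally have "m = - 1" by (intro mI) (use msq in simp_all)
    then have "card (positives \<beta>) = 1" if "\<beta> \<in> W" for \<beta> using c[OF that] 2 by simp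
    then show thesis using that(2) 2 q by blast
  next
    case 3
    obtain X :: "'n set" where "card X = 3" using obtain_subset_with_card_n[of 3 "UNIV::'n set"] 3 by auto
    then obtain i j l :: 'n where "i \<noteq> j" "i \<noteq> l" "j \<noteq> l" by (auto simp: card_3_iff)
    from third_moment[OF this m] obtain s :: int
      where s: "2 * of_int m * of_int s = (q\<^sup>2 + q - 3) * (q\<^sup>2 - 6 * q + 7)" by blast
    have "q > 0" using q_gt_1 by simp
    from dimension_arithmetic[OF 3 this q_sq msq s]
    show thesis
    proof (elim disjE conjE)
      assume *: "CARD('n) = 7" "q = 3"
      have "m = - 3" by (rule mI) (use msq * in simp_all)
      then have "card (positives \<beta>) = 2" if "\<beta> \<in> W" for \<beta> using c[OF that] * by simp
      then show thesis using that(3) * by blast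
    next
      assume *: "CARD('n) = 23" "q = 5"
      have "m = - 9" by (rule mI) (use msq * in simp_all)
      then have "card (positives \<beta>) = 7" if "\<beta> \<in> W" for \<beta> using c[OF that] * by simp
      then show thesis using that(4) * by blast
    qed
  qed
qed

lemma steiner_system_positives:
  assumes "CARD('n) = 23"
  shows "steiner_system (positives ` W)" "card (positives ` W) = 253"
proof -
  have q: "q = 5" by (rule dimension_cases) (use assms in simp_all)
  have c: "card (positives \<beta>) = 7" if "\<beta> \<in> W" for \<beta>
    by (rule dimension_cases) (use assms that in simp_all)
  show 253: "card (positives ` W) = 253"
    using card_W assms by (simp add: card_image[OF inj_on_positives])
  show "steiner_system (positives ` W)"
  proof (rule steiner_systemI[OF assms 253])
    fix b b' assume "b \<in> positives ` W" "b' \<in> positives ` W" "b \<noteq> b'"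
    then obtain \<beta> \<gamma> where b: "\<beta> \<in> W" "\<gamma> \<in> W" "\<beta> \<noteq> \<gamma>" "b = positives \<beta>" "b' = positives \<gamma>" by auto
    show "card (b \<inter> b') = 1 \<or> card (b \<inter> b') = 3"
      using positives_Int[OF b(1-3)] unfolding c[OF b(1)] q assms b(4,5) by auto
  qed (use c in auto)
qed

end

section \<open>The standard sets of lines\<close>

text \<open>With a = s1 - s2 and g = a + sqrt Delta_2, the constant terms combine to d(g^2 - 2ag) =
  d((g - a)^2 - a^2), so the root disappears.\<close>

lemma point_vec_inner_point_vec:
  fixes i l :: "'n::finite"
  assumes "Delta_2 CARD('n) k s1 s2 \<ge> 0"
  shows "point_vec k s1 s2 i \<bullet> point_vec k s1 s2 l
    = (if i = l then (real CARD('n) * (real s1 - real s2))\<^sup>2 else 0)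
      + real CARD('n) * (Delta_2 CARD('n) k s1 s2 - (real s1 - real s2)\<^sup>2)"
proof -
  let ?d = "real CARD('n)" and ?a = "real s1 - real s2" and ?D = "Delta_2 CARD('n) k s1 s2"
  let ?g = "?a + sqrt ?D"
  have "point_vec k s1 s2 i \<bullet> point_vec k s1 s2 l
      = (\<Sum>j\<in>UNIV. (?d * ?a)\<^sup>2 * of_bool (j = i \<and> j = l) - ?d * ?a * ?g * of_bool (j = i)
          - ?d * ?a * ?g * of_bool (j = l) + ?g\<^sup>2)"
    unfolding inner_vec_def point_vec_def
    by (intro sum.cong) (auto simp: algebra_simps power2_eq_square)
  also have "\<dots> = (?d * ?a)\<^sup>2 * (if i = l then 1 else 0) - 2 * ?d * ?a * ?g + ?d * ?g\<^sup>2"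
    unfolding sum.distrib sum_subtractf sum_distrib_left[symmetric]
    by (auto simp: sum_of_bool_eq Collect_conv_if)
  also have "?g\<^sup>2 = ?a\<^sup>2 + 2 * ?a * sqrt ?D + ?D"
    using assms by (simp add: power2_sum)
  finally show ?thesis by (auto simp: algebra_simps power2_eq_square)
qed

text \<open>With a and g as before and c = sqrt Delta_1 - k, the terms dac - dg(k + c) reduce to
  -dak - d sqrt (Delta_1 Delta_2).\<close>

lemma block_vec_inner_point_vec:
  fixes i :: "'n::finite"
  assumes "card B = k" "Delta_1 CARD('n) k s1 s2 \<ge> 0" "Delta_2 CARD('n) k s1 s2 \<ge> 0"
  shows "block_vec k s1 s2 B \<bullet> point_vec k s1 s2 i
    = (if i \<in> B then (real s1 - real s2) * (real CARD('n))\<^sup>2 else 0)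
      - real CARD('n) * ((real s1 - real s2) * real k
        + sqrt (Delta_1 CARD('n) k s1 s2 * Delta_2 CARD('n) k s1 s2))"
proof -
  let ?d = "real CARD('n)" and ?a = "real s1 - real s2"
  let ?c = "sqrt (Delta_1 CARD('n) k s1 s2) - real k" and ?g = "?a + sqrt (Delta_2 CARD('n) k s1 s2)"
  have "block_vec k s1 s2 B \<bullet> point_vec k s1 s2 i
      = (\<Sum>j\<in>UNIV. ?d * ?d * ?a * of_bool (j = i \<and> i \<in> B) + ?d * ?a * ?c * of_bool (j = i)
          - ?d * ?g * of_bool (j \<in> B) - ?c * ?g)"
    unfolding inner_vec_def point_vec_def block_vec_def
    by (intro sum.cong) (auto simp: algebra_simps)
  also have "\<dots> = ?d * ?d * ?a * (if i \<in> B then 1 else 0) + ?d * ?a * ?c - ?d * ?g * real k - ?d * (?c * ?g)"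
  proof -
    have sums: "(\<Sum>j\<in>UNIV. of_bool (j = i \<and> i \<in> B) :: real) = (if i \<in> B then 1 else 0)"
      "(\<Sum>j\<in>UNIV. of_bool (j = i) :: real) = 1" "(\<Sum>j\<in>UNIV. of_bool (j \<in> B) :: real) = real k"
      using assms(1) by (auto simp: sum_of_bool_eq Collect_conv_if)
    show ?thesis unfolding sum.distrib sum_subtractf sum_distrib_left[symmetric] sums
      by (simp add: algebra_simps)
  qed
  finally show ?thesis unfolding real_sqrt_mult
    by (cases "i \<in> B") (simp_all add: algebra_simps power2_eq_square)
qed

lemma span_uminus_singleton: "span {- v} = span {v}" for v :: "'a::real_vector"
  using span_image_scale[of "{v}" "\<lambda>_. - 1"] by simp

lemma uminus_vector:
  "- (vector [a, b] :: real^2) = vector [- a, - b]"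
  "- (vector [a, b, c] :: real^3) = vector [- a, - b, - c]"
  by (simp_all add: vec_eq_iff forall_2 forall_3)

section \<open>Matching the lines with the standard sets\<close>

context saturated_lines
begin

definition lines :: "(real^'n) set set" where
  "lines = (\<lambda>v. span {v}) ` (range \<alpha> \<union> W)"

lemma card_lines: "card lines = CARD('n) * (CARD('n) + 1) div 2"
proof -
  have "v = w" if vw: "v \<in> range \<alpha> \<union> W" "w \<in> range \<alpha> \<union> W" "span {v} = span {w}" for v w
  proof (rule ccontr)
    assume ne: "v \<noteq> w"
    have "v \<in> span {w}" using vw(3) by (metis insertI1 span_base)
    then obtain c where c: "v = c *\<^sub>R w" by (auto simp: span_singleton)
    have "v \<bullet> v = (v \<bullet> w)\<^sup>2"
      using tight.unit[OF vw(2)] unfolding c by (simp add: power2_eq_square)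
    then show False using tight.unit[OF vw(1)] tight.angle[OF vw(1,2) ne] tight.kappa_sq by simp
  qed
  then have "inj_on (\<lambda>v. span {v}) (range \<alpha> \<union> W)" by (rule inj_onI)
  then show ?thesis unfolding lines_def by (simp add: card_image tight.card_V)
qed

text \<open>The basis lines match the lines of \<open>\<beta>\<close> with factor \<open>r\<close>,
  so only the lines of \<open>W\<close> remain to be located in the target.\<close>

lemma isometric_lines_target:
  fixes \<beta> :: "'m::finite \<Rightarrow> real^'m" and \<pi> :: "'n \<Rightarrow> 'm"
  assumes bij: "bij \<pi>" and r: "r > 0"
    and gram': "\<And>i j. \<beta> i \<bullet> \<beta> j = (if i = j then r else r * \<kappa>)"
    and basis: "\<And>j. span {\<beta> j} \<in> \<Omega>'"
    and W: "\<And>v. v \<in> W \<Longrightarrow> \<exists>b s. s \<noteq> 0 \<and> span {b} \<in> \<Omega>' \<and> (\<forall>i. b \<bullet> \<beta> (\<pi> i) = s * (v \<bullet> \<alpha> i))"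
    and fin: "finite \<Omega>'" and card: "card \<Omega>' \<le> CARD('n) * (CARD('n) + 1) div 2"
  shows "isometric_lines lines \<Omega>'"
proof (rule isometric_linesI[OF bij r gram' _ fin])
  show "card \<Omega>' \<le> card lines" using card card_lines by simp
  fix L assume "L \<in> lines"
  then consider i where "L = span {\<alpha> i}" | v where "v \<in> W" "L = span {v}" by (auto simp: lines_def)
  then show "\<exists>a b s. L = span {a} \<and> s \<noteq> 0 \<and> span {b} \<in> \<Omega>' \<and> (\<forall>i. b \<bullet> \<beta> (\<pi> i) = s * (a \<bullet> \<alpha> i))"
  proof cases
    case 1
    have "\<pi> i = \<pi> j \<longleftrightarrow> i = j" for j using bij by (simp add: bij_def inj_eq)
    then have "\<forall>j. \<beta> (\<pi> i) \<bullet> \<beta> (\<pi> j) = r * (\<alpha> i \<bullet> \<alpha> j)" by (simp add: gram' gram)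
    then show ?thesis using 1 basis r by (intro exI[of _ "\<alpha> i"] exI[of _ "\<beta> (\<pi> i)"] exI[of _ r]) simp
  next
    case 2
    then show ?thesis using W[of v] by blast
  qed
qed

text \<open>Points play the role of the basis and blocks that of \<open>W\<close>: membership in a
  block gives the sign pattern of its vector.\<close>

lemma isometric_design_lines:
  fixes \<pi> :: "'n \<Rightarrow> 'm::finite" and \<C> :: "'m set set"
  assumes bij: "bij \<pi>" and c: "c > 0"
    and gram': "\<And>i j :: 'm. point_vec k s1 s2 i \<bullet> point_vec k s1 s2 j = (if i = j then r else r * \<kappa>)"
    and r: "r > 0"
    and blocks: "\<And>B i. card B = k \<Longrightarrow> block_vec k s1 s2 B \<bullet> point_vec k s1 s2 (i :: 'm) = (if i \<in> B then c else - c)"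
    and W: "\<And>v. v \<in> W \<Longrightarrow> card (positives v) = k \<and> \<pi> ` positives v \<in> \<C>"
    and card: "card \<C> \<le> card W"
  shows "isometric_lines lines (design_lines k s1 s2 \<C>)"
proof (rule isometric_lines_target[OF bij r gram'])
  have mem: "\<pi> i \<in> \<pi> ` X \<longleftrightarrow> i \<in> X" for i X using bij by (simp add: bij_def inj_image_mem_iff)
  fix v assume v: "v \<in> W"
  have "card (\<pi> ` positives v) = k"
    using W[OF v] card_image[OF inj_on_subset[OF bij_is_inj[OF bij]], of "positives v"] by simp
  then have "block_vec k s1 s2 (\<pi> ` positives v) \<bullet> point_vec k s1 s2 (\<pi> i) = c / \<kappa> * (v \<bullet> \<alpha> i)" for i
    using kappa by (simp add: blocks mem inner_basis[OF v])
  then show "\<exists>b s. s \<noteq> 0 \<and> span {b} \<in> design_lines k s1 s2 \<C> \<and>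
      (\<forall>i. b \<bullet> point_vec k s1 s2 (\<pi> i) = s * (v \<bullet> \<alpha> i))"
    using W[OF v] c kappa
    by (intro exI[of _ "block_vec k s1 s2 (\<pi> ` positives v)"] exI[of _ "c / \<kappa>"])
       (auto simp: design_lines_def)
next
  have "card (design_lines k s1 s2 \<C>) \<le> card ((\<lambda>B. span {block_vec k s1 s2 B}) ` \<C>)
      + card (range (\<lambda>i::'m. span {point_vec k s1 s2 i}))"
    unfolding design_lines_def by (rule card_Un_le)
  also have "\<dots> \<le> card W + CARD('m)"
    by (intro add_mono card_image_le order.trans[OF card_image_le card]) simp_all
  also have "\<dots> = card (range \<alpha> \<union> W)"
    using bij_betw_same_card[OF bij] card_Un_disjoint[OF _ finite_W disjoint] by (simp add: card_image inj_basis)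
  finally show "card (design_lines k s1 s2 \<C>) \<le> CARD('n) * (CARD('n) + 1) div 2" using tight.card_V by simp
qed (auto simp: design_lines_def)

lemma isometric_Omega_7:
  assumes "CARD('n) = 7" "q = 3" and p: "\<And>\<beta>. \<beta> \<in> W \<Longrightarrow> card (positives \<beta>) = 2"
  shows "isometric_lines lines Omega_7"
proof -
  obtain \<pi> :: "'n \<Rightarrow> 7" where bij: "bij \<pi>"
    using finite_same_card_bij[of "UNIV::'n set" "UNIV::7 set"] assms by auto
  have k: "\<kappa> = 1 / 3" using assms(2) q_kappa by (simp add: field_simps)
  have s: "sqrt (1 / 2 * (9 / 2)) = 3 / 2" by (rule real_sqrt_unique) (simp_all add: power2_eq_square)
  show ?thesis unfolding Omega_7_def
  \<comment> \<open>Here Delta_1 = 1/2 and Delta_2 = 9/2; point vectors have squared norm 49 + 49/2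
    = 147/2 and mutual products 49/2, a third of it.\<close>
  proof (rule isometric_design_lines[OF bij, of "49 / 2" 2 1 0 "147 / 2"])
    show "point_vec 2 1 0 i \<bullet> point_vec 2 1 0 j = (if i = j then 147 / 2 else 147 / 2 * \<kappa>)" for i j :: 7
      by (subst point_vec_inner_point_vec) (simp_all add: Delta_2_def k power2_eq_square)
    show "block_vec 2 1 0 B \<bullet> point_vec 2 1 0 i = (if i \<in> B then 49 / 2 else - (49 / 2))"
      if "card B = 2" for B and i :: 7
      using that s by (subst block_vec_inner_point_vec) (simp_all add: Delta_1_def Delta_2_def power2_eq_square)
    show "card (positives v) = 2 \<and> \<pi> ` positives v \<in> {B. card B = 2}" if "v \<in> W" for v
      using p[OF that] card_image[OF inj_on_subset[OF bij_is_inj[OF bij]], of "positives v"] by simp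
    have "card {B :: 7 set. card B = 2} = 7 choose 2"
      using n_subsets[of "UNIV::7 set" 2] by simp
    then show "card {B :: 7 set. card B = 2} \<le> card W"
      using card_W assms(1) by (simp add: choose_two)
  qed simp_all
qed

lemma isometric_Omega_23:
  assumes "CARD('n) = 23" "q = 5" and p: "\<And>\<beta>. \<beta> \<in> W \<Longrightarrow> card (positives \<beta>) = 7"
  shows "isometric_lines lines Omega_23"
proof -
  obtain \<pi> :: "'n \<Rightarrow> 23" where bij: "bij \<pi>" and \<pi>: "(`) \<pi> ` positives ` W = steiner_4_7_23"
    using steiner_4_7_23[OF steiner_system_positives[OF assms(1)]] .
  have k: "\<kappa> = 1 / 5" using assms(2) q_kappa by (simp add: field_simps)
  have s: "sqrt (3 * 27) = 9" by (rule real_sqrt_unique) (simp_all add: power2_eq_square)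
  show ?thesis unfolding Omega_23_def
  \<comment> \<open>Here Delta_1 = 3 and Delta_2 = 27; point vectors have squared norm 46^2 + 23 *
    23 = 2645 and mutual products 529, a fifth of it.\<close>
  proof (rule isometric_design_lines[OF bij, of "529" 7 3 1 "2645"])
    show "point_vec 7 3 1 i \<bullet> point_vec 7 3 1 j = (if i = j then 2645 else 2645 * \<kappa>)" for i j :: 23
      by (subst point_vec_inner_point_vec) (simp_all add: Delta_2_def k power2_eq_square)
    show "block_vec 7 3 1 B \<bullet> point_vec 7 3 1 i = (if i \<in> B then 529 else - 529)"
      if "card B = 7" for B and i :: 23
      using that s by (subst block_vec_inner_point_vec) (simp_all add: Delta_1_def Delta_2_def power2_eq_square)
    show "card (positives v) = 7 \<and> \<pi> ` positives v \<in> steiner_4_7_23" if "v \<in> W" for v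
      using p[OF that] that unfolding \<pi>[symmetric] by auto
    have "card steiner_4_7_23 \<le> card (positives ` W)"
      unfolding \<pi>[symmetric] by (rule card_image_le) (simp add: finite_W)
    also have "\<dots> \<le> card W" by (rule card_image_le) (rule finite_W)
    finally show "card steiner_4_7_23 \<le> card W" .
  qed simp_all
qed

lemma positives_singleton:
  assumes "v \<in> W" "card (positives v) = 1"
  obtains t where "\<And>i. v \<bullet> \<alpha> i = (if i = t then \<kappa> else - \<kappa>)"
proof -
  obtain t where "positives v = {t}" using assms(2) card_1_singletonE by blast
  then show thesis using that[of t] inner_basis[OF assms(1)] by auto
qed

text \<open>Three icosahedral lines, spanned by the \<open>\<beta> j\<close>, have mutual products g
  and squared norm g + 2 = g sqrt 5, with g the golden ratio. The other three realise the patterns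
  with one positive sign: \<open>\<gamma> j\<close> has product g with \<open>\<beta> j\<close> and
  -g with the rest.\<close>

lemma isometric_Omega_3:
  assumes d: "CARD('n) = 3" and q: "q = sqrt 5" and p: "\<And>\<beta>. \<beta> \<in> W \<Longrightarrow> card (positives \<beta>) = 1"
  shows "isometric_lines lines Omega_3"
proof -
  obtain \<pi> :: "'n \<Rightarrow> 3" where bij: "bij \<pi>"
    using finite_same_card_bij[of "UNIV::'n set" "UNIV::3 set"] assms by auto
  let ?g = golden_ratio
  have g: "?g * ?g = ?g + 1" "?g > 0"
    by (simp_all add: golden_ratio_def field_simps add_pos_nonneg)
  have kg: "(?g + 2) * \<kappa> = ?g"
  proof -
    have "?g + 2 = ?g * sqrt 5" by (simp add: golden_ratio_def field_simps)
    then have "(?g + 2) * \<kappa> = ?g * (q * \<kappa>)" unfolding q by simp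
    then show ?thesis using q_kappa by simp
  qed
  define \<beta> :: "3 \<Rightarrow> real^3" where
    "\<beta> j = (if j = 1 then vector [0, 1, ?g] else if j = 2 then vector [1, ?g, 0] else vector [?g, 0, 1])" for j
  define \<gamma> :: "3 \<Rightarrow> real^3" where
    "\<gamma> j = (if j = 1 then vector [- ?g, 0, 1] else if j = 2 then vector [0, 1, - ?g] else vector [1, - ?g, 0])" for j
  have three: "(2::3) \<noteq> 1" "(3::3) \<noteq> 1" "(3::3) \<noteq> 2" "(1::3) \<noteq> 2" "(1::3) \<noteq> 3" "(2::3) \<noteq> 3" by simp_all
  have inner3: "x \<bullet> y = x$1 * y$1 + x$2 * y$2 + x$3 * y$3" for x y :: "real^3"
    by (simp add: inner_vec_def sum_3)
  have gram': "\<forall>i j. \<beta> i \<bullet> \<beta> j = (if i = j then ?g + 2 else (?g + 2) * \<kappa>)"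
    unfolding kg forall_3 \<beta>_def inner3 using three g by (simp add: algebra_simps)
  have \<gamma>\<beta>: "\<forall>i j. \<gamma> j \<bullet> \<beta> i = (if i = j then ?g else - ?g)"
    unfolding forall_3 \<beta>_def \<gamma>_def inner3 using three g by (simp add: algebra_simps)
  define V :: "(real^3) set" where "V = range \<beta> \<union> range \<gamma>"
  have "range \<beta> = {\<beta> 1, \<beta> 2, \<beta> 3}" "range \<gamma> = {\<gamma> 1, \<gamma> 2, \<gamma> 3}" by (auto simp: UNIV_3)
  then have "V = {vector [0, 1, ?g], vector [1, ?g, 0], vector [?g, 0, 1],
      vector [- ?g, 0, 1], vector [0, 1, - ?g], vector [1, - ?g, 0]}"
    unfolding V_def \<beta>_def \<gamma>_def using three by (simp only: if_True if_False simp_thms) auto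
  then have ico: "icosahedron_vertices = V \<union> uminus ` V"
    unfolding icosahedron_vertices_def by (simp add: uminus_vector) blast
  have Om: "Omega_3 = (\<lambda>v. span {v}) ` V"
    unfolding Omega_3_def ico image_Un image_image span_uminus_singleton by simp
  show ?thesis
  proof (rule isometric_lines_target[OF bij, of "?g + 2" \<beta>])
    show "?g + 2 > 0" using g by simp
    show "\<beta> i \<bullet> \<beta> j = (if i = j then ?g + 2 else (?g + 2) * \<kappa>)" for i j using gram' by blast
    show "span {\<beta> j} \<in> Omega_3" for j unfolding Om V_def by auto
    show "finite Omega_3" unfolding Om V_def by simp
    have "card Omega_3 \<le> card V" unfolding Om by (rule card_image_le) (simp add: V_def)
    also have "\<dots> \<le> card (range \<beta>) + card (range \<gamma>)" unfolding V_def by (rule card_Un_le)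
    also have "\<dots> \<le> CARD(3) + CARD(3)" by (intro add_mono card_image_le) simp_all
    finally show "card Omega_3 \<le> CARD('n) * (CARD('n) + 1) div 2" using d by simp
    fix v assume v: "v \<in> W"
    obtain t where t: "\<And>i. v \<bullet> \<alpha> i = (if i = t then \<kappa> else - \<kappa>)"
      using positives_singleton[OF v p[OF v]] by blast
    have "\<gamma> (\<pi> t) \<bullet> \<beta> (\<pi> i) = ?g / \<kappa> * (v \<bullet> \<alpha> i)" for i
      using \<gamma>\<beta> bij kappa by (simp add: t bij_def inj_eq)
    then show "\<exists>b s. s \<noteq> 0 \<and> span {b} \<in> Omega_3 \<and> (\<forall>i. b \<bullet> \<beta> (\<pi> i) = s * (v \<bullet> \<alpha> i))"
      using g kappa by (intro exI[of _ "\<gamma> (\<pi> t)"] exI[of _ "?g / \<kappa>"]) (auto simp: Om V_def)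
  qed
qed

text \<open>The lines at 0 and 60 degrees form the basis. The vector at 120 degrees has products of
  opposite sign with them, and the two patterns with one positive sign are negatives of each other,
  so they describe the same line.\<close>

lemma isometric_Omega_2:
  assumes d: "CARD('n) = 2" and q: "q = 2" and p: "\<And>\<beta>. \<beta> \<in> W \<Longrightarrow> card (positives \<beta>) = 1"
  shows "isometric_lines lines Omega_2"
proof -
  obtain \<pi> :: "'n \<Rightarrow> 2" where bij: "bij \<pi>"
    using finite_same_card_bij[of "UNIV::'n set" "UNIV::2 set"] assms by auto
  have k: "\<kappa> = 1 / 2" using q q_kappa by (simp add: field_simps)
  define hv :: "nat \<Rightarrow> real^2" where "hv j = vector [cos (real j * pi / 3), sin (real j * pi / 3)]" for j
  have c: "cos (pi * 2 / 3) = - 1 / 2" "sin (pi * 2 / 3) = sqrt 3 / 2"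
    using cos_120 sin_120 by (simp_all add: mult.commute)
  have hv: "hv 0 = vector [1, 0]" "hv 1 = vector [1 / 2, sqrt 3 / 2]" "hv 2 = vector [- 1 / 2, sqrt 3 / 2]"
    by (simp_all add: hv_def cos_60 sin_60 c mult.commute)
  have "hv (j + 3) = - hv j" for j
  proof -
    have "real (j + 3) * pi / 3 = real j * pi / 3 + pi" by (simp add: field_simps)
    then show ?thesis unfolding hv_def uminus_vector by (simp only: cos_periodic_pi sin_periodic_pi)
  qed
  from this[of 0] this[of 1] this[of 2]
  have hn: "hv 3 = - hv 0" "hv 4 = - hv 1" "hv 5 = - hv 2" by simp_all
  have "{..<6} = {0, 1, 2, 3, 4, 5::nat}" by auto
  moreover have "hexagon_vertices = hv ` {..<6}"
    unfolding hexagon_vertices_def hv_def by blast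
  ultimately have hex: "hexagon_vertices = {hv 0, hv 1, hv 2, hv 3, hv 4, hv 5}" by simp
  have Om: "Omega_2 = {span {hv 0}, span {hv 1}, span {hv 2}}"
    unfolding Omega_2_def hex hn image_insert image_empty span_uminus_singleton by blast
  define \<beta> :: "2 \<Rightarrow> real^2" where "\<beta> j = (if j = 1 then hv 0 else hv 1)" for j
  have two: "(2::2) \<noteq> 1" "(1::2) \<noteq> 2" by simp_all
  have inner2: "x \<bullet> y = x$1 * y$1 + x$2 * y$2" for x y :: "real^2"
    by (simp add: inner_vec_def sum_2)
  have gram': "\<forall>i j. \<beta> i \<bullet> \<beta> j = (if i = j then 1 else 1 * \<kappa>)"
    unfolding forall_2 \<beta>_def inner2 hv k using two by simp
  have \<gamma>: "\<forall>i. hv 2 \<bullet> \<beta> i = (if i = 2 then 1 / 2 else - 1 / 2)"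
    unfolding forall_2 \<beta>_def inner2 hv using two by simp
  show ?thesis
  proof (rule isometric_lines_target[OF bij, of 1 \<beta>])
    show "\<beta> i \<bullet> \<beta> j = (if i = j then 1 else 1 * \<kappa>)" for i j using gram' by blast
    show "span {\<beta> j} \<in> Omega_2" for j unfolding Om \<beta>_def by auto
    show "card Omega_2 \<le> CARD('n) * (CARD('n) + 1) div 2"
      unfolding Om d by (simp add: card_insert_if)
    fix v assume v: "v \<in> W"
    obtain t where t: "\<And>i. v \<bullet> \<alpha> i = (if i = t then \<kappa> else - \<kappa>)"
      using positives_singleton[OF v p[OF v]] by blast
    have "\<pi> i = \<pi> t \<longleftrightarrow> i = t" for i using bij by (simp add: bij_def inj_eq)
    moreover have "x = 1 \<or> x = 2" for x :: 2 using exhaust_2 by blast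
    ultimately have i: "\<pi> i = 2 \<longleftrightarrow> (i = t \<longleftrightarrow> \<pi> t = 2)" for i using two by metis
    have "hv 2 \<bullet> \<beta> (\<pi> i) = (if \<pi> t = 2 then 1 else - 1) * (v \<bullet> \<alpha> i)" for i
      unfolding t k \<gamma>[rule_format] using i[of i] by (cases "i = t"; cases "\<pi> t = 2") simp_all
    then have "\<forall>i. hv 2 \<bullet> \<beta> (\<pi> i) = (if \<pi> t = 2 then 1 else - 1) * (v \<bullet> \<alpha> i)" by blast
    moreover have "span {hv 2} \<in> Omega_2" by (simp add: Om)
    moreover have "(if \<pi> t = 2 then 1 else - 1) \<noteq> (0::real)" by simp
    ultimately show "\<exists>b s. s \<noteq> 0 \<and> span {b} \<in> Omega_2 \<and> (\<forall>i. b \<bullet> \<beta> (\<pi> i) = s * (v \<bullet> \<alpha> i))"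
      by blast
  qed (simp_all add: Om)
qed

end

lemma (in saturated_lines) isometric_standard_lines:
  "CARD('n) = 2 \<and> isometric_lines lines Omega_2
    \<or> CARD('n) = 3 \<and> isometric_lines lines Omega_3
    \<or> CARD('n) = 7 \<and> isometric_lines lines Omega_7
    \<or> CARD('n) = 23 \<and> isometric_lines lines Omega_23"
  by (rule dimension_cases)
     (simp_all add: isometric_Omega_2 isometric_Omega_3 isometric_Omega_7 isometric_Omega_23)

section \<open>From sets of lines to normalised unit vectors\<close>

lemma is_line_unit:
  assumes "is_line L"
  obtains u where "u \<in> L" "norm u = 1" "span {u} = L"
proof -
  have L: "subspace L" "dim L = 1" using assms by (auto simp: is_line_def)
  then have "\<not> L \<subseteq> {0}" using dim_eq_0[of L] by simp
  then obtain x where x: "x \<in> L" "x \<noteq> 0" by auto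
  define u where "u = x /\<^sub>R norm x"
  have u: "u \<in> L" "norm u = 1" using x L(1) by (simp_all add: u_def subspace_scale)
  then have "u \<noteq> 0" by auto
  have "span {u} \<subseteq> L" using u(1) L(1) by (simp add: span_minimal)
  moreover have "dim (span {u}) = 1" using \<open>u \<noteq> 0\<close> by (simp add: dim_singleton)
  ultimately have "span {u} = L" using L by (intro subspace_dim_equal) auto
  then show thesis using that u by blast
qed

theorem theorem1p1:
  fixes \<Omega> :: "(real^'n) set set"
  assumes "CARD('n) \<ge> 2"
    and "equiangular \<Omega>"
    and "card \<Omega> = CARD('n) * (CARD('n) + 1) div 2"
    and "Inc \<Omega> = CARD('n)"
  shows "CARD('n) = 2 \<and> isometric_lines \<Omega> Omega_2
       \<or> CARD('n) = 3 \<and> isometric_lines \<Omega> Omega_3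
       \<or> CARD('n) = 7 \<and> isometric_lines \<Omega> Omega_7
       \<or> CARD('n) = 23 \<and> isometric_lines \<Omega> Omega_23"
proof -
  let ?d = "CARD('n)"
  obtain \<kappa> where \<kappa>: "0 \<le> \<kappa>" "\<kappa> < 1"
    and ang: "\<And>L M a b. L \<in> \<Omega> \<Longrightarrow> M \<in> \<Omega> \<Longrightarrow> L \<noteq> M \<Longrightarrow> a \<in> L \<Longrightarrow> b \<in> M \<Longrightarrow>
      norm a = 1 \<Longrightarrow> norm b = 1 \<Longrightarrow> a \<bullet> b = \<kappa> \<or> a \<bullet> b = - \<kappa>"
    and line: "\<And>L. L \<in> \<Omega> \<Longrightarrow> is_line L"
    using assms(2) unfolding equiangular_def by auto
  have "\<exists>u. u \<in> L \<and> norm u = 1 \<and> span {u} = L" if "L \<in> \<Omega>" for L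
    using is_line_unit[OF line[OF that]] by metis
  then obtain u where u: "\<And>L. L \<in> \<Omega> \<Longrightarrow> u L \<in> L \<and> norm (u L) = 1 \<and> span {u L} = L" by metis
  \<comment> \<open>Stated for every choice of unit vectors, since it is applied to the arbitrary
    \<open>u\<close> and later to the sign-normalised \<open>w\<close>.\<close>
  have frame: "tight_equiangular (r ` \<Omega>) \<kappa> \<and> inj_on r \<Omega>"
    if r: "\<And>L. L \<in> \<Omega> \<Longrightarrow> r L \<in> L \<and> norm (r L) = 1 \<and> span {r L} = L" for r
  proof
    show inj: "inj_on r \<Omega>" by (rule inj_onI) (metis r)
    show "tight_equiangular (r ` \<Omega>) \<kappa>"
    proof
      show "card (r ` \<Omega>) = ?d * (?d + 1) div 2" using card_image[OF inj] assms(3) by simp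
      show "v \<bullet> v = 1" if "v \<in> r ` \<Omega>" for v using that r by (auto simp: norm_eq_1)
      show "(v \<bullet> w)\<^sup>2 = \<kappa>\<^sup>2" if vw: "v \<in> r ` \<Omega>" "w \<in> r ` \<Omega>" "v \<noteq> w" for v w
      proof -
        obtain L M where LM: "L \<in> \<Omega>" "M \<in> \<Omega>" "v = r L" "w = r M" using vw by auto
        then have "L \<noteq> M" using vw(3) by auto
        then show ?thesis using ang[of L M v w] r LM by (auto simp: power2_eq_iff)
      qed
    qed (use assms(1) \<kappa> in auto)
  qed
  interpret F: tight_equiangular "u ` \<Omega>" \<kappa> using frame[OF u] by blast
  have "\<kappa> \<noteq> 0" using F.kappa_eq by auto
  then have \<kappa>0: "\<kappa> > 0" using \<kappa>(1) by simp
  have fin: "finite \<Omega>" using F.finite_V frame[OF u] finite_imageD by blast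

  \<comment> \<open>The maximum is attained: the set of sizes is finite and contains the size of the
    empty set.\<close>
  obtain \<Gamma> where G: "\<Gamma> \<subseteq> \<Omega>" "incoherent \<Gamma>" "card \<Gamma> = ?d"
  proof -
    let ?S = "{card \<Gamma> | \<Gamma>. \<Gamma> \<subseteq> \<Omega> \<and> incoherent \<Gamma>}"
    have "?S = card ` {\<Gamma>. \<Gamma> \<subseteq> \<Omega> \<and> incoherent \<Gamma>}" by auto
    then have "finite ?S" using fin by simp
    moreover have "incoherent ({} :: (real^'n) set set)"
      by (auto simp: incoherent_def equiangular_def intro: exI[of _ 0])
    then have "?S \<noteq> {}" by blast
    ultimately have "Max ?S \<in> ?S" by (rule Max_in)
    then show thesis using that assms(4) unfolding Inc_def by auto
  qed
  have finG: "finite \<Gamma>" using G(1) fin finite_subset by blast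
  obtain L0 where L0: "L0 \<in> \<Gamma>" using G(3) assms(1) by fastforce
  \<comment> \<open>The flips make all products of \<open>a L0\<close> with the other vectors of
    \<open>\<Gamma>\<close> equal to \<open>\<kappa>\<close>; incoherence then fixes the remaining
    signs.\<close>
  define a where "a L = (if L = L0 \<or> u L0 \<bullet> u L > 0 then u L else - u L)" for L
  have sign: "- u L \<in> L \<and> norm (- u L) = 1 \<and> span {- u L} = L" if "L \<in> \<Omega>" for L
    using u[OF that] line[OF that] by (auto simp: is_line_def subspace_neg span_uminus_singleton)
  have a: "a L \<in> L \<and> norm (a L) = 1 \<and> span {a L} = L" if "L \<in> \<Omega>" for L
    using u[OF that] sign[OF that] by (simp add: a_def)
  have a0: "a L0 \<bullet> a L = \<kappa>" if L: "L \<in> \<Gamma>" "L \<noteq> L0" for L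
  proof -
    have "L \<in> \<Omega>" "L0 \<in> \<Omega>" using L L0 G(1) by auto
    then have "u L0 \<bullet> u L = \<kappa> \<or> u L0 \<bullet> u L = - \<kappa>" using ang[of L0 L] u L(2) by metis
    then show ?thesis using \<kappa>0 L(2) by (auto simp: a_def)
  qed
  have aa: "a L \<bullet> a M = \<kappa>" if LM: "L \<in> \<Gamma>" "M \<in> \<Gamma>" "L \<noteq> M" for L M
  proof (cases "L = L0 \<or> M = L0")
    case True
    then show ?thesis using a0 LM by (metis inner_commute)
  next
    case False
    have O: "L \<in> \<Omega>" "M \<in> \<Omega>" "L0 \<in> \<Omega>" using LM L0 G(1) by auto
    \<comment> \<open>Three lines rule out the alternative \<open>card \<Gamma> \<le> 2\<close> of
      \<open>incoherent\<close>. The triple product is therefore positive, and two of its factors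
      are \<open>\<kappa>\<close>.\<close>
    have "card {L0, L, M} \<le> card \<Gamma>" by (rule card_mono) (use finG LM L0 in auto)
    moreover have ne: "L0 \<noteq> L" "L0 \<noteq> M" "L \<noteq> L0" "M \<noteq> L0" using False by blast+
    then have "card {L0, L, M} = 3" using LM(3) by simp
    ultimately have "\<not> card \<Gamma> \<le> 2" by linarith
    then have "(a L0 \<bullet> a L) * (a L0 \<bullet> a M) * (a L \<bullet> a M) > 0"
      using G(2) a[OF O(1)] a[OF O(2)] a[OF O(3)] L0 LM ne unfolding incoherent_def by metis
    then have "\<kappa> * \<kappa> * (a L \<bullet> a M) > 0" using a0[OF LM(1) ne(3)] a0[OF LM(2) ne(4)] by simp
    then have "a L \<bullet> a M > 0" using \<kappa>0 by (simp add: zero_less_mult_iff)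
    then show ?thesis using ang[OF O(1,2) LM(3), of "a L" "a M"] a[OF O(1)] a[OF O(2)] \<kappa>0 by auto
  qed
  obtain h :: "'n \<Rightarrow> (real^'n) set" where h: "bij_betw h UNIV \<Gamma>"
    using finite_same_card_bij[of "UNIV::'n set" \<Gamma>] finG G(3) by auto
  define \<alpha> where "\<alpha> i = a (h i)" for i
  have hG: "h i \<in> \<Gamma>" for i using h by (auto simp: bij_betw_def)
  \<comment> \<open>Lines of \<open>\<Gamma>\<close> keep their basis vectors; the others receive
    the sign that \<open>saturated_lines\<close> requires.\<close>
  define w where "w L = (if L \<in> \<Gamma> then a L else if (\<Sum>i\<in>UNIV. u L \<bullet> \<alpha> i) \<le> 0 then u L else - u L)" for L
  have w: "w L \<in> L \<and> norm (w L) = 1 \<and> span {w L} = L" if "L \<in> \<Omega>" for L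
    using a[OF that] u[OF that] sign[OF that] by (simp add: w_def)
  have ra: "range \<alpha> = w ` \<Gamma>"
  proof -
    have "range \<alpha> = a ` (h ` UNIV)" by (auto simp: \<alpha>_def)
    also have "h ` UNIV = \<Gamma>" using h by (simp add: bij_betw_def)
    finally show ?thesis by (simp add: w_def cong: image_cong)
  qed
  have un: "range \<alpha> \<union> w ` (\<Omega> - \<Gamma>) = w ` \<Omega>" unfolding ra using G(1) by auto
  interpret saturated_lines \<alpha> \<kappa> "w ` (\<Omega> - \<Gamma>)"
  proof (intro saturated_lines.intro saturated_lines_axioms.intro equiangular_basis.intro)
    show "\<alpha> i \<bullet> \<alpha> j = (if i = j then 1 else \<kappa>)" for i j
    proof (cases "i = j")
      case True
      then show ?thesis using a[of "h i"] hG[of i] G(1) by (auto simp: \<alpha>_def norm_eq_1)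
    next
      case False
      then have "h i \<noteq> h j" using h by (auto simp: bij_betw_def inj_on_def)
      then show ?thesis using aa[OF hG hG] False by (simp add: \<alpha>_def)
    qed
    show "tight_equiangular (range \<alpha> \<union> w ` (\<Omega> - \<Gamma>)) \<kappa>" unfolding un using frame[OF w] by blast
    have "inj_on w \<Omega>" using frame[OF w] by blast
    then show "range \<alpha> \<inter> w ` (\<Omega> - \<Gamma>) = {}" unfolding ra using G(1) by (auto simp: inj_on_def)
    show "(\<Sum>i\<in>UNIV. \<beta> \<bullet> \<alpha> i) \<le> 0" if "\<beta> \<in> w ` (\<Omega> - \<Gamma>)" for \<beta>
      using that by (auto simp: w_def sum_negf)
  qed (use \<kappa>0 \<kappa> in auto)
  have "lines = \<Omega>"
  proof -
    have "lines = (\<lambda>L. span {w L}) ` \<Omega>" unfolding lines_def un image_image ..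
    also have "\<dots> = (\<lambda>L. L) ` \<Omega>" by (rule image_cong) (use w in auto)
    finally show ?thesis by simp
  qed
  then show ?thesis using isometric_standard_lines by simp
qed

end
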